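(* Let $H<\mathrm{GL}(d,\mathbb{R})$ be an admissible dilation group with open dual orbit $\mathcal{O}$ and $G=\mathbb{R}^d\rtimes H$. Let $s\ge0$ and let $v$ be a weight on $G$ satisfying $v(x,h)\le(1+|x|)^sw(h)$ for all $(x,h)\in G$, where $w$ is a weight on $H$. Assume that $\mathcal{O}$ is $(s,1,w)$-temperately embedded with index $\ell\in\mathbb{N}$. Then any function $\psi\in L^1(\mathbb{R}^d)$ with vanishing moments in $\mathcal{O}^c$ of order $t>\ell+s+d+1$ and $|\widehat\psi|_{t,t}<\infty$ is in $\mathcal{H}_{1,v}$. Moreover, there exist nonzero vectors $\psi\in C_c^\infty(\mathbb{R}^d)\cap\mathcal{H}_{1,v}$.
   Context: Let $d>1$ and let $H$ be a closed subgroup of $\mathrm{GL}(d,\mathbb{R})$. $G=\mathbb{R}^d\rtimes H$ has product $(x,h)(y,g)=(x+hy,hg)$ and left Haar measure $|\det h|^{-1}\,dx\,dh$, with $dh$ left Haar measure on $H$. The quasi-regular representation is $[\pi(x,h)f](y)=|\det h|^{-1/2}f(h^{-1}(y-x))$ on $L^2(\mathbb{R}^d)$. $H$ is called an admissible dilation group if $\pi$ is irreducible and square-integrable (there is a nonzero $\psi$ with $(x,h)\mapsto\langle\psi,\pi(x,h)\psi\rangle$ in $L^2(G)$). It is known that this holds iff the dual action $(\xi,h)\mapsto h^T\xi$ has a single open orbit $\mathcal{O}=\{h^T\xi_0:h\in H\}$ of full measure, with compact stabilizers; $\mathcal{O}$ is called the open dual orbit and $\mathcal{O}^c=\mathbb{R}^d\setminus\mathcal{O}$.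 $\mathcal{W}_\psi f(x,h)=\langle f,\pi(x,h)\psi\rangle$. Fourier transform: $\widehat f(\xi)=\int f(x)e^{-2\pi i\langle x,\xi\rangle}dx$. A weight on a locally compact group is a continuous positive submultiplicative function. $L^1_v(G)$ is the space of measurable $F$ with $\int_H\int_{\mathbb{R}^d}|F(x,h)|v(x,h)\,dx\,\frac{dh}{|\det h|}<\infty$. $\mathcal{H}_{1,v}=\{f\in L^2(\mathbb{R}^d):\mathcal{W}_ff\in L^1_v(G)\}$. For $r,m>0$: $|g|_{r,m}=\sup_{x\in\mathbb{R}^d,|\alpha|\le r}(1+|x|)^m|\partial^\alpha g(x)|$, where $|\alpha|=\sum_i\alpha_i$ for multiindices and $|x|$ is the euclidean norm for vectors. Auxiliary function: $A(\xi)=\min\left(\frac{\mathrm{dist}(\xi,\mathcal{O}^c)}{1+\sqrt{|\xi|^2-\mathrm{dist}(\xi,\mathcal{O}^c)^2}},\frac1{1+|\xi|}\right)$ for $\xi\in\mathcal{O}$, with $\mathrm{dist}$ the euclidean distance. For a weight $w$ on $H$, $s\ge0$, $1\le q<\infty$, the orbit $\mathcal{O}$ is $(s,q,w)$-temperately embedded with index $\ell\in\mathbb{N}$ if for a fixed $\xi_0\in\mathcal{O}$ (the choice is immaterial): (i) $h\mapsto|\det h|^{1/2-1/q}(1+\|h\|)^{s+d+1}w(h)A(h^T\xi_0)^\ell$ is in $L^q(H)$, and (ii) $h\mapsto|\det h|^{-1/2-1/q}(1+\|h\|)^{s+d+1}w(h)A(h^{-T}\xi_0)^\ell$ is in $L^1(H)$;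 here $\|\cdot\|$ is any matrix norm, $h^{-T}$ is the transpose inverse, and $L^q(H)$ is with respect to left Haar measure. For $r\in\mathbb{N}$, $f\in L^1(\mathbb{R}^d)$ has vanishing moments in $\mathcal{O}^c$ of order $r$ if all distributional derivatives $\partial^\alpha\widehat f$ with $|\alpha|\le r$ are continuous functions, and all those with $|\alpha|<r$ vanish identically on $\mathcal{O}^c$. *)

theory Defs
  imports "HOL-Analysis.Analysis" "HOL-Algebra.Group"
begin

section \<open>The groups\<close>

definition GL_group :: "(real^'n^'n) monoid" where
  "GL_group = \<lparr>carrier = {A. invertible A}, mult = (**), one = mat 1\<rparr>"

definition closed_subgroup_of_GL :: "(real^'n^'n) set \<Rightarrow> bool" where
  "closed_subgroup_of_GL H \<longleftrightarrow>
     subgroup H GL_group \<and> closedin (top_of_set (carrier GL_group)) H"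

abbreviation dilation_group :: "(real^'n^'n) set \<Rightarrow> (real^'n^'n) monoid" where
  "dilation_group H \<equiv> GL_group\<lparr>carrier := H\<rparr>"

definition affine_group :: "(real^'n^'n) set \<Rightarrow> ((real^'n) \<times> (real^'n^'n)) monoid" where
  "affine_group H =
     \<lparr>carrier = UNIV \<times> H, mult = (\<lambda>(x, h) (y, g). (x + h *v y, h ** g)), one = (0, mat 1)\<rparr>"

definition weight :: "('a::topological_space) monoid \<Rightarrow> ('a \<Rightarrow> real) \<Rightarrow> bool" where
  "weight K v \<longleftrightarrow> continuous_on (carrier K) v \<and> (\<forall>x\<in>carrier K. 0 < v x) \<and>
     (\<forall>x\<in>carrier K. \<forall>y\<in>carrier K. v (x \<otimes>\<^bsub>K\<^esub> y) \<le> v x * v y)"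

text \<open>Regularity is not required explicitly: all groups considered here are locally compact
  and second countable, so that every Borel measure which is finite on compact sets is regular.\<close>

definition left_haar_measure :: "('a::topological_space) monoid \<Rightarrow> 'a measure \<Rightarrow> bool" where
  "left_haar_measure K \<mu> \<longleftrightarrow>
     sets \<mu> = sets (restrict_space borel (carrier K)) \<and>
     (\<forall>g\<in>carrier K. \<forall>A\<in>sets \<mu>. emeasure \<mu> ((\<lambda>h. g \<otimes>\<^bsub>K\<^esub> h) ` A) = emeasure \<mu> A) \<and>
     (\<forall>C. compact C \<and> C \<subseteq> carrier K \<longrightarrow> emeasure \<mu> C < \<infinity>) \<and>
     emeasure \<mu> (carrier K) \<noteq> 0"

text \<open>The left Haar measure of the semidirect product, where \<open>\<mu>\<close> is the one of \<open>H\<close>.\<close>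

definition affine_haar :: "(real^'n^'n) measure \<Rightarrow> ((real^'n) \<times> (real^'n^'n)) measure" where
  "affine_haar \<mu> = lborel \<Otimes>\<^sub>M density \<mu> (\<lambda>h. ennreal (1 / \<bar>det h\<bar>))"


section \<open>Function spaces\<close>

text \<open>Elements of Lebesgue spaces are represented by functions, not by equivalence classes.\<close>

definition Lp :: "real \<Rightarrow> 'a measure \<Rightarrow> ('a \<Rightarrow> 'b::real_normed_vector) set" where
  "Lp p M = {f \<in> borel_measurable M. integrable M (\<lambda>x. norm (f x) powr p)}"

abbreviation L2 :: "(real^'n \<Rightarrow> complex) set" where
  "L2 \<equiv> Lp 2 lebesgue"

definition L2_inner :: "(real^'n \<Rightarrow> complex) \<Rightarrow> (real^'n \<Rightarrow> complex) \<Rightarrow> complex" where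
  "L2_inner f g = (LINT y|lebesgue. f y * cnj (g y))"

definition L2_norm :: "(real^'n \<Rightarrow> complex) \<Rightarrow> real" where
  "L2_norm f = sqrt (LINT y|lebesgue. (cmod (f y))\<^sup>2)"

text \<open>The last condition also makes the subspaces saturated under equality almost everywhere.\<close>

definition closed_subspace_L2 :: "(real^'n \<Rightarrow> complex) set \<Rightarrow> bool" where
  "closed_subspace_L2 V \<longleftrightarrow> V \<subseteq> L2 \<and> (\<lambda>y. 0) \<in> V \<and>
     (\<forall>f\<in>V. \<forall>g\<in>V. (\<lambda>y. f y + g y) \<in> V) \<and>
     (\<forall>c. \<forall>f\<in>V. (\<lambda>y. c * f y) \<in> V) \<and>
     (\<forall>F. \<forall>f\<in>L2. (\<forall>n::nat. F n \<in> V) \<and> (\<lambda>n. L2_norm (\<lambda>y. F n y - f y)) \<longlonglongrightarrow> 0 \<longrightarrow> f \<in> V)"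


section \<open>The quasi-regular representation\<close>

definition quasi_regular ::
  "(real^'n) \<times> (real^'n^'n) \<Rightarrow> (real^'n \<Rightarrow> complex) \<Rightarrow> (real^'n \<Rightarrow> complex)" where
  "quasi_regular = (\<lambda>(x, h) f y.
     complex_of_real (\<bar>det h\<bar> powr (-1/2)) * f (matrix_inv h *v (y - x)))"

definition wavelet_transform ::
  "(real^'n \<Rightarrow> complex) \<Rightarrow> (real^'n \<Rightarrow> complex) \<Rightarrow> (real^'n) \<times> (real^'n^'n) \<Rightarrow> complex" where
  "wavelet_transform \<psi> f z = L2_inner f (quasi_regular z \<psi>)"

definition quasi_regular_irreducible :: "(real^'n^'n) set \<Rightarrow> bool" where
  "quasi_regular_irreducible H \<longleftrightarrow>
     (\<forall>V. closed_subspace_L2 V \<and>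
          (\<forall>z\<in>carrier (affine_group H). \<forall>f\<in>V. quasi_regular z f \<in> V) \<longrightarrow>
          V = {f \<in> L2. AE y in lebesgue. f y = 0} \<or> V = L2)"

definition quasi_regular_square_integrable :: "(real^'n^'n) measure \<Rightarrow> bool" where
  "quasi_regular_square_integrable \<mu> \<longleftrightarrow>
     (\<exists>\<psi>\<in>L2. \<not> (AE y in lebesgue. \<psi> y = 0) \<and>
        wavelet_transform \<psi> \<psi> \<in> Lp 2 (affine_haar \<mu>))"

text \<open>Here \<open>\<mu>\<close> is a left Haar measure on \<open>H\<close>; the notion does not depend on its normalisation.\<close>

definition admissible_dilation_group :: "(real^'n^'n) set \<Rightarrow> (real^'n^'n) measure \<Rightarrow> bool" where
  "admissible_dilation_group H \<mu> \<longleftrightarrow>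
     closed_subgroup_of_GL H \<and> quasi_regular_irreducible H \<and> quasi_regular_square_integrable \<mu>"

definition weighted_L1 ::
  "(real^'n^'n) measure \<Rightarrow> ((real^'n) \<times> (real^'n^'n) \<Rightarrow> real) \<Rightarrow>
     ((real^'n) \<times> (real^'n^'n) \<Rightarrow> complex) set" where
  "weighted_L1 \<mu> v = {F \<in> borel_measurable (affine_haar \<mu>).
     (\<integral>\<^sup>+z. ennreal (cmod (F z) * v z) \<partial>affine_haar \<mu>) < \<infinity>}"

definition H1 ::
  "(real^'n^'n) measure \<Rightarrow> ((real^'n) \<times> (real^'n^'n) \<Rightarrow> real) \<Rightarrow> (real^'n \<Rightarrow> complex) set" where
  "H1 \<mu> v = {f \<in> L2. wavelet_transform f f \<in> weighted_L1 \<mu> v}"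


section \<open>The open dual orbit and temperate embedding\<close>

definition dual_orbit :: "(real^'n^'n) set \<Rightarrow> real^'n \<Rightarrow> (real^'n) set" where
  "dual_orbit H \<xi> = {transpose h *v \<xi> | h. h \<in> H}"

definition dual_stabilizer :: "(real^'n^'n) set \<Rightarrow> real^'n \<Rightarrow> (real^'n^'n) set" where
  "dual_stabilizer H \<xi> = {h \<in> H. transpose h *v \<xi> = \<xi>}"

text \<open>For an admissible dilation group exactly one such orbit exists.\<close>

definition open_dual_orbit :: "(real^'n^'n) set \<Rightarrow> (real^'n) set \<Rightarrow> bool" where
  "open_dual_orbit H \<O> \<longleftrightarrow> (\<exists>\<xi>\<^sub>0. \<O> = dual_orbit H \<xi>\<^sub>0) \<and> open \<O> \<and> negligible (- \<O>) \<and>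
     (\<forall>\<xi>\<in>\<O>. compact (dual_stabilizer H \<xi>))"

definition aux_A :: "(real^'n) set \<Rightarrow> real^'n \<Rightarrow> real" where
  "aux_A \<O> \<xi> = min (infdist \<xi> (- \<O>) / (1 + sqrt ((norm \<xi>)\<^sup>2 - (infdist \<xi> (- \<O>))\<^sup>2)))
                    (1 / (1 + norm \<xi>))"

text \<open>The norm on matrices is the Euclidean one. Since the choice of the base point is
  immaterial, the conditions are only demanded for some point of the orbit.\<close>

definition temperately_embedded ::
  "(real^'n^'n) set \<Rightarrow> (real^'n^'n) measure \<Rightarrow> (real^'n) set \<Rightarrow>
     real \<Rightarrow> real \<Rightarrow> (real^'n^'n \<Rightarrow> real) \<Rightarrow> nat \<Rightarrow> bool" where
  "temperately_embedded H \<mu> \<O> s q w l \<longleftrightarrow>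
     (\<exists>\<xi>\<^sub>0\<in>\<O>.
        (\<lambda>h. \<bar>det h\<bar> powr (1/2 - 1/q) * (1 + norm h) powr (s + real CARD('n) + 1) * w h *
              aux_A \<O> (transpose h *v \<xi>\<^sub>0) ^ l) \<in> Lp q \<mu> \<and>
        (\<lambda>h. \<bar>det h\<bar> powr (-1/2 - 1/q) * (1 + norm h) powr (s + real CARD('n) + 1) * w h *
              aux_A \<O> (transpose (matrix_inv h) *v \<xi>\<^sub>0) ^ l) \<in> Lp 1 \<mu>)"


section \<open>Partial derivatives and test functions\<close>

definition partial_deriv :: "'n \<Rightarrow> (real^'n \<Rightarrow> complex) \<Rightarrow> (real^'n \<Rightarrow> complex)" where
  "partial_deriv i g x = vector_derivative (\<lambda>t. g (x + t *\<^sub>R axis i 1)) (at 0)"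

definition partials :: "'n list \<Rightarrow> (real^'n \<Rightarrow> complex) \<Rightarrow> (real^'n \<Rightarrow> complex)" where
  "partials js g = foldr partial_deriv js g"

text \<open>Multiindices are functions \<open>'n \<Rightarrow> nat\<close>. The index type carries no order, so the order
  of differentiation is left open; by Schwarz's theorem it is irrelevant for functions with
  continuous partial derivatives up to the order of the multiindex.\<close>

definition mi_order :: "('n::finite \<Rightarrow> nat) \<Rightarrow> nat" where
  "mi_order \<alpha> = (\<Sum>i\<in>UNIV. \<alpha> i)"

definition mi_deriv :: "('n \<Rightarrow> nat) \<Rightarrow> (real^'n \<Rightarrow> complex) \<Rightarrow> (real^'n \<Rightarrow> complex)" where
  "mi_deriv \<alpha> g = partials (SOME js. \<forall>i. count_list js i = \<alpha> i) g"

definition smooth :: "(real^'n \<Rightarrow> complex) \<Rightarrow> bool" where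
  "smooth g \<longleftrightarrow> (\<forall>js. continuous_on UNIV (partials js g) \<and>
     (\<forall>i x. (\<lambda>t. partials js g (x + t *\<^sub>R axis i 1)) differentiable (at (0::real))))"

definition test_functions :: "(real^'n \<Rightarrow> complex) set" where
  "test_functions = {\<phi>. smooth \<phi> \<and> compact (closure {x. \<phi> x \<noteq> 0})}"

definition schwartz_norm :: "real \<Rightarrow> real \<Rightarrow> (real^'n \<Rightarrow> complex) \<Rightarrow> ennreal" where
  "schwartz_norm r m g =
     (SUP x. SUP \<alpha>\<in>{\<alpha>. real (mi_order \<alpha>) \<le> r}.
        ennreal ((1 + norm x) powr m * cmod (mi_deriv \<alpha> g x)))"

text \<open>For locally integrable \<open>u\<close> and \<open>g\<close>: the distributional derivative of \<open>u\<close> with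
  respect to \<open>\<alpha>\<close> is the function \<open>g\<close>.\<close>

definition has_distr_deriv ::
  "('n \<Rightarrow> nat) \<Rightarrow> (real^'n \<Rightarrow> complex) \<Rightarrow> (real^'n \<Rightarrow> complex) \<Rightarrow> bool" where
  "has_distr_deriv \<alpha> u g \<longleftrightarrow> (\<forall>\<phi>\<in>test_functions.
     (LINT x|lebesgue. g x * \<phi> x) =
       (-1) ^ mi_order \<alpha> * (LINT x|lebesgue. u x * mi_deriv \<alpha> \<phi> x))"


section \<open>Fourier transform and vanishing moments\<close>

definition fourier :: "(real^'n \<Rightarrow> complex) \<Rightarrow> (real^'n \<Rightarrow> complex)" where
  "fourier f \<xi> = (LINT x|lebesgue. f x * exp (- 2 * complex_of_real pi * \<i> * complex_of_real (x \<bullet> \<xi>)))"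

definition vanishing_moments :: "(real^'n) set \<Rightarrow> nat \<Rightarrow> (real^'n \<Rightarrow> complex) \<Rightarrow> bool" where
  "vanishing_moments Z r f \<longleftrightarrow>
     (\<forall>\<alpha>. mi_order \<alpha> \<le> r \<longrightarrow>
        (\<exists>g. continuous_on UNIV g \<and> has_distr_deriv \<alpha> (fourier f) g \<and>
             (mi_order \<alpha> < r \<longrightarrow> (\<forall>\<xi>\<in>Z. g \<xi> = 0))))"

end

theory Submission imports Defs "HOL-Probability.Probability" begin

text \<open>The proof takes place on the Fourier side. For integrable \<open>\<psi>\<close> with integrable transform
  \<open>f = fourier \<psi>\<close>, Parseval's identity turns the wavelet transform into
  \<open>|det h|\<^bsup>1/2\<^esup> \<integral> f \<xi> * cnj (f (h\<^sup>T \<xi>)) * exp (2 \<pi> i \<langle>x, \<xi>\<rangle>) d\<xi>\<close> (\<open>wavelet_transform_fourier\<close>).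
  Integrating by parts \<open>m\<close> times, with \<open>s + d < m \<le> s + d + 1\<close>, yields the factor \<open>(1 + |x|)\<^bsup>-m\<^esup>\<close>,
  which is integrable against \<open>(1 + |x|)\<^sup>s\<close>, and costs at most \<open>(1 + |h|)\<^sup>m\<close> (\<open>correlation_decay\<close>).

  Vanishing moments of order \<open>t\<close> say that the derivatives of \<open>f\<close> of order less than \<open>t\<close> vanish on the
  complement of the orbit. That set is a closed cone, and Taylor expansion at the nearest
  point of the cone bounds the derivatives up to order \<open>m\<close> by a multiple of \<open>A\<^sup>l\<close>, where \<open>A\<close> is the
  auxiliary function (\<open>flat_on_bound\<close>). What remains is to bound
  \<open>\<integral> F h * \<Phi> h dh\<close> with \<open>\<Phi> h = \<integral> A \<xi>\<^sup>l * A (h\<^sup>T \<xi>)\<^sup>l d\<xi>\<close> and the submultiplicative function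
  \<open>F h = |det h|\<^bsup>-1/2\<^esup> (1 + |h|)\<^bsup>s+d+1\<^esup> w h\<close>. By the uniqueness argument for Haar measures, Lebesgue
  measure on the orbit is a multiple of the image of \<open>|det h|\<^bsup>-1\<^esup> dh\<close> under \<open>h \<mapsto> h\<^bsup>-T\<^esup> \<xi>\<^sub>0\<close>
  (\<open>orbit_integral\<close>). In these coordinates \<open>\<Phi>\<close> is a convolution, and the integral is at most a
  multiple of the product of the two integrals that temperate embedding makes finite
  (\<open>convolution_bound\<close>).

  For the existence of a test function, there is a polynomial \<open>P\<close> that vanishes off the orbit
  but not identically, namely \<open>z \<mapsto> det (X\<^sub>i\<^sup>T z)\<^sub>i\<close> for matrices \<open>X\<^sub>i\<close> tangent to \<open>H\<close> at the identity
  with \<open>X\<^sub>i\<^sup>T \<xi>\<^sub>0 = e\<^sub>i\<close> (\<open>vanishing_polynomial\<close>). Multiplication by \<open>P\<^sup>t\<close> on the Fourier side is a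
  differential operator with constant coefficients; applied to a bump function it gives a test
  function whose Fourier transform \<open>P\<^sup>t * fourier b\<close> is rapidly decreasing and vanishes to
  order \<open>t\<close> off the orbit.\<close>

section \<open>Matrices and Lebesgue measure\<close>

(* The dual action is written with transpose throughout and must not become a row vector product. *)
declare transpose_matrix_vector [simp del] vector_transpose_matrix [simp del]

lemma norm_matrix_vector_mult_le:
  fixes A :: "real^'n^'m"
  shows "norm (A *v x) \<le> norm A * norm x"
proof -
  have "norm (A *v x) = L2_set (\<lambda>i. \<bar>A $ i \<bullet> x\<bar>) UNIV"
    by (simp add: norm_vec_def matrix_vector_mul_component)
  also have "\<dots> \<le> L2_set (\<lambda>i. norm (A $ i) * norm x) UNIV"
    by (rule L2_set_mono) (auto intro: Cauchy_Schwarz_ineq2)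
  also have "\<dots> = norm A * norm x"
    by (simp add: L2_set_left_distrib norm_vec_def[of A])
  finally show ?thesis .
qed

lemma norm_transpose [simp]:
  fixes A :: "real^'n^'m"
  shows "norm (transpose A) = norm A"
proof -
  have "(\<Sum>i\<in>UNIV. \<Sum>j\<in>UNIV. (A $ j $ i)\<^sup>2) = (\<Sum>i\<in>UNIV. \<Sum>j\<in>UNIV. (A $ i $ j)\<^sup>2)"
    by (rule sum.swap)
  then show ?thesis
    by (simp add: norm_vec_def L2_set_def transpose_def sum_nonneg)
qed

lemma norm_matrix_mult_le:
  fixes A :: "real^'n^'m" and B :: "real^'k^'n"
  shows "norm (A ** B) \<le> norm A * norm B"
proof -
  have row: "(A ** B) $ i = transpose B *v (A $ i)" for i
    by (simp add: vec_eq_iff matrix_matrix_mult_def matrix_vector_mult_def transpose_def mult.commute)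
  have "norm (A ** B) = L2_set (\<lambda>i. norm (transpose B *v (A $ i))) UNIV"
    by (simp add: norm_vec_def[of "A ** B"] row)
  also have "\<dots> \<le> L2_set (\<lambda>i. norm (A $ i) * norm B) UNIV"
    by (rule L2_set_mono) (auto intro: order_trans[OF norm_matrix_vector_mult_le] simp: mult.commute)
  also have "\<dots> = norm A * norm B"
    by (simp add: L2_set_left_distrib norm_vec_def[of A])
  finally show ?thesis .
qed

lemma bounded_bilinear_matrix_mult: "bounded_bilinear ((**) :: real^'n^'m \<Rightarrow> real^'k^'n \<Rightarrow> real^'k^'m)"
proof
  show "\<exists>K. \<forall>a b. norm ((a :: real^'n^'m) ** (b :: real^'k^'n)) \<le> norm a * norm b * K"
    by (auto intro!: exI[of _ 1] norm_matrix_mult_le)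
qed (auto simp: vec_eq_iff matrix_matrix_mult_def algebra_simps sum_distrib_left sum.distrib)

lemma bounded_bilinear_matrix_vector: "bounded_bilinear ((*v) :: real^'n^'m \<Rightarrow> real^'n \<Rightarrow> real^'m)"
proof
  show "\<exists>K. \<forall>a b. norm ((a :: real^'n^'m) *v (b :: real^'n)) \<le> norm a * norm b * K"
    by (auto intro!: exI[of _ 1] norm_matrix_vector_mult_le)
qed (auto simp: vec_eq_iff matrix_vector_mult_def algebra_simps sum_distrib_left sum.distrib)

lemma bounded_linear_transpose: "bounded_linear (transpose :: real^'n^'m \<Rightarrow> _)"
proof (rule bounded_linear_intro[of _ 1])
  show "norm (transpose A) \<le> norm A * 1" for A :: "real^'n^'m"
    by simp
qed (simp_all add: transpose_def vec_eq_iff)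

lemmas continuous_on_matrix_mult [continuous_intros] =
  bounded_bilinear.continuous_on[OF bounded_bilinear_matrix_mult]
lemmas continuous_on_matrix_vector [continuous_intros] =
  bounded_bilinear.continuous_on[OF bounded_bilinear_matrix_vector]
lemmas continuous_on_transpose [continuous_intros] =
  bounded_linear.continuous_on[OF bounded_linear_transpose]
lemmas tendsto_matrix_mult [tendsto_intros] =
  bounded_bilinear.tendsto[OF bounded_bilinear_matrix_mult]
lemmas tendsto_matrix_vector [tendsto_intros] =
  bounded_bilinear.tendsto[OF bounded_bilinear_matrix_vector]
lemmas tendsto_transpose [tendsto_intros] =
  bounded_linear.tendsto[OF bounded_linear_transpose]

lemma continuous_on_det [continuous_intros]:
  fixes f :: "'a::topological_space \<Rightarrow> real^'n^'n"
  assumes "continuous_on S f"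
  shows "continuous_on S (\<lambda>x. det (f x))"
  unfolding det_def by (intro continuous_intros assms)

lemma matrix_inv_inverse:
  fixes A :: "real^'n^'n"
  assumes "invertible A"
  shows "A ** matrix_inv A = mat 1" "matrix_inv A ** A = mat 1"
  using someI_ex[OF assms[unfolded invertible_def]] by (auto simp: matrix_inv_def)

lemma matrix_inv_eqI:
  fixes A :: "real^'n^'n"
  assumes "A ** B = mat 1"
  shows "matrix_inv A = B"
proof -
  have "invertible A"
    using assms matrix_left_right_inverse by (auto simp: invertible_def)
  then have "B = matrix_inv A ** (A ** B)"
    by (simp add: matrix_mul_assoc matrix_inv_inverse)
  then show ?thesis
    by (simp add: assms)
qed

text \<open>Cramer's rule makes the entries of the inverse continuous.\<close>

lemma continuous_on_matrix_inv:
  "continuous_on {A :: real^'n^'n. invertible A} matrix_inv"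
proof -
  have "matrix_inv A = (\<chi> k j. det (\<chi> i l. if l = k then axis j 1 $ i else A $ i $ l) / det A)"
    if "invertible A" for A :: "real^'n^'n"
  proof -
    have d: "det A \<noteq> 0"
      using that by (simp add: invertible_det_nz)
    have "A *v (matrix_inv A *v axis j 1) = axis j 1" for j
      by (simp add: matrix_vector_mul_assoc matrix_inv_inverse that)
    from cramer[OF d, THEN iffD1, OF this] have "matrix_inv A *v axis j 1 =
        (\<chi> k. det (\<chi> i l. if l = k then axis j 1 $ i else A $ i $ l) / det A)" for j .
    then have "column j (matrix_inv A) =
        (\<chi> k. det (\<chi> i l. if l = k then axis j 1 $ i else A $ i $ l) / det A)" for j
      by (simp add: matrix_vector_mult_basis)
    then show ?thesis
      by (simp add: vec_eq_iff column_def)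
  qed
  then have "continuous_on {A :: real^'n^'n. invertible A} matrix_inv \<longleftrightarrow>
     continuous_on {A :: real^'n^'n. invertible A}
       (\<lambda>A. \<chi> k j. det (\<chi> i l. if l = k then axis j 1 $ i else A $ i $ l) / det A)"
    by (intro continuous_on_cong) auto
  moreover have "continuous_on {A :: real^'n^'n. invertible A}
       (\<lambda>A. if l = k then axis j 1 $ i else A $ i $ l)" for l k j i
    by (cases "l = k") (auto intro!: continuous_intros)
  ultimately show ?thesis
    by (auto intro!: continuous_intros simp: invertible_det_nz)
qed

text \<open>A shear changes neither the volume of boxes nor, being linear, that of measurable sets. This
  covers the one elementary linear map for which the volume is not evident.\<close>

lemma measure_shear:
  fixes m n :: "'n::finite" and S :: "(real^'n) set"
  assumes mn: "m \<noteq> n" and S: "S \<in> lmeasurable"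
  defines "h \<equiv> \<lambda>v::real^'n. \<chi> i. if i = m then v $ m + v $ n else v $ i"
  shows "measure lebesgue (h ` S) = measure lebesgue S"
proof -
  have lin: "linear h"
    unfolding h_def by (rule linearI) (auto simp: algebra_simps vec_eq_iff)
  have "measure lebesgue (h ` cbox a b) = measure lebesgue (cbox a b)" for a b
  proof (cases "cbox a b = {}")
    case False
    \<comment> \<open>a translation makes the \<open>n\<close>-th coordinates nonnegative, as the volume of a sheared box requires\<close>
    define t :: "real^'n" where "t = axis n (- (a $ n))"
    have "measure lebesgue (h ` cbox a b) = measure lebesgue ((+) (h t) ` h ` cbox a b)"
      by (rule measure_translation[symmetric])
    also have "(+) (h t) ` h ` cbox a b = h ` cbox (t + a) (t + b)"
      by (simp add: image_image linear_add[OF lin, symmetric] cbox_translation)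
    also have "measure lebesgue (h ` cbox (t + a) (t + b)) = measure lebesgue (cbox (t + a) (t + b))"
      unfolding h_def
      by (rule measure_shear_interval) (use mn False in \<open>auto simp: t_def cbox_translation\<close>)
    also have "\<dots> = measure lebesgue (cbox a b)"
      by (simp only: cbox_translation measure_translation)
    finally show ?thesis .
  qed simp
  then have "1 * measure lebesgue S = measure lebesgue (h ` S)"
    using measure_linear_sufficient[OF lin S, of 1] by auto
  then show ?thesis
    by simp
qed

lemma Basis_vec_eq_range: "(Basis :: (real^'n) set) = range (\<lambda>i. axis i 1)"
  by (auto simp: Basis_vec_def)

lemma sum_Basis_vec: "(\<Sum>b\<in>(Basis :: (real^'n) set). F b) = (\<Sum>i\<in>UNIV. F (axis i 1))"
  unfolding Basis_vec_eq_range by (subst sum.reindex) (auto simp: inj_on_def axis_eq_axis)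

lemma prod_Basis_vec: "(\<Prod>b\<in>(Basis :: (real^'n) set). F b) = (\<Prod>i\<in>UNIV. F (axis i 1))"
  unfolding Basis_vec_eq_range by (subst prod.reindex) (auto simp: inj_on_def axis_eq_axis)

text \<open>Every linear map is a composition of coordinate projections, diagonal maps, transpositions of
  coordinates and shears; the first do not occur for a nonzero determinant.\<close>

lemma lborel_linear:
  fixes f :: "real^'n \<Rightarrow> real^'n"
  assumes "linear f"
  shows "det (matrix f) \<noteq> 0 \<longrightarrow> lborel = density (distr lborel borel f) (\<lambda>_. ennreal \<bar>det (matrix f)\<bar>)"
  using assms
proof (rule induct_linear_elementary)
  fix f g :: "real^'n \<Rightarrow> real^'n"
  let ?P = "\<lambda>f::real^'n \<Rightarrow> real^'n. det (matrix f) \<noteq> 0 \<longrightarrow> lborel = density (distr lborel borel f) (\<lambda>_. ennreal \<bar>det (matrix f)\<bar>)"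
  assume comp: "linear f" "linear g" "?P f" "?P g"
  then have [measurable]: "f \<in> borel_measurable borel" "g \<in> borel_measurable borel"
    by (auto intro!: borel_measurable_continuous_onI linear_continuous_on simp: linear_linear)
  have mat: "matrix (f \<circ> g) = matrix f ** matrix g"
    using comp by (simp add: matrix_compose)
  show "?P (f \<circ> g)"
  proof
    assume "det (matrix (f \<circ> g)) \<noteq> 0"
    then have d: "det (matrix f) \<noteq> 0" "det (matrix g) \<noteq> 0"
      by (auto simp: mat det_mul)
    have "lborel = density (distr (density (distr lborel borel g) (\<lambda>_. ennreal \<bar>det (matrix g)\<bar>)) borel f)
        (\<lambda>_. ennreal \<bar>det (matrix f)\<bar>)"
      using comp d by metis
    also have "\<dots> = density (distr lborel borel (f \<circ> g)) (\<lambda>_. ennreal \<bar>det (matrix (f \<circ> g))\<bar>)"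
    proof (rule measure_eqI)
      fix A assume "A \<in> sets (density (distr (density (distr lborel borel g) (\<lambda>_. ennreal \<bar>det (matrix g)\<bar>)) borel f)
        (\<lambda>_. ennreal \<bar>det (matrix f)\<bar>))"
      then have A: "A \<in> sets borel"
        by simp
      moreover have "f -` A \<in> sets borel"
        using measurable_sets_borel[of f borel A] A by simp
      moreover have "(f \<circ> g) \<in> borel_measurable borel"
        by measurable
      ultimately show "emeasure (density (distr (density (distr lborel borel g) (\<lambda>_. ennreal \<bar>det (matrix g)\<bar>)) borel f)
        (\<lambda>_. ennreal \<bar>det (matrix f)\<bar>)) A = emeasure (density (distr lborel borel (f \<circ> g)) (\<lambda>_. ennreal \<bar>det (matrix (f \<circ> g))\<bar>)) A"
        by (simp add: emeasure_density_const emeasure_distr mat det_mul abs_mult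
           ennreal_mult mult.assoc vimage_comp)
    qed simp
    finally show "lborel = density (distr lborel borel (f \<circ> g)) (\<lambda>_. ennreal \<bar>det (matrix (f \<circ> g))\<bar>)" .
  qed
next
  fix f :: "real^'n \<Rightarrow> real^'n" and i
  assume zeroes: "linear f" "\<And>x. f x $ i = 0"
  then have "\<not> surj f"
    by (metis one_neq_zero surjE vec_component)
  then show "det (matrix f) \<noteq> 0 \<longrightarrow> lborel = density (distr lborel borel f) (\<lambda>_. ennreal \<bar>det (matrix f)\<bar>)"
    using zeroes by (metis det_nz_iff_inj linear_injective_imp_surjective)
next
  fix c :: "'n \<Rightarrow> real"
  let ?f = "\<lambda>x::real^'n. \<chi> i. c i * x $ i"
  have m: "det (matrix ?f) = prod c UNIV"
    by (simp add: matrix_def axis_def det_diagonal)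
  define c' where "c' = (\<lambda>b::real^'n. c (axis_index b))"
  have f: "?f = (\<lambda>x. 0 + (\<Sum>j\<in>Basis. (c' j * (x \<bullet> j)) *\<^sub>R j))"
    by (simp add: fun_eq_iff vec_eq_iff sum_Basis_vec c'_def axis_index_axis inner_axis)
      (simp add: axis_def if_distrib cong: if_cong)
  have p: "(\<Prod>j\<in>Basis. \<bar>c' j\<bar>) = \<bar>prod c UNIV\<bar>"
    by (simp add: prod_Basis_vec c'_def axis_index_axis abs_prod)
  show "det (matrix ?f) \<noteq> 0 \<longrightarrow> lborel = density (distr lborel borel ?f) (\<lambda>_. ennreal \<bar>det (matrix ?f)\<bar>)"
  proof
    assume "det (matrix ?f) \<noteq> 0"
    then have nz: "c' j \<noteq> 0" for j
      by (auto simp: m c'_def)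
    show "lborel = density (distr lborel borel ?f) (\<lambda>_. ennreal \<bar>det (matrix ?f)\<bar>)"
      unfolding m unfolding f using lborel_affine_euclidean[of c' 0, OF nz] by (simp add: p)
  qed
next
  fix m n :: 'n
  assume "m \<noteq> n"
  let ?f = "\<lambda>x::real^'n. \<chi> i. x $ Transposition.transpose m n i"
  have lin: "linear ?f"
    by (rule linearI) (simp_all add: vec_eq_iff)
  then have [measurable]: "?f \<in> borel_measurable borel"
    by (auto intro!: borel_measurable_continuous_onI linear_continuous_on simp: linear_linear)
  have "matrix ?f = (\<chi> i. (mat 1 :: real^'n^'n) $ Transposition.transpose m n i)"
    by (simp add: matrix_def axis_def mat_def vec_eq_iff)
  then have "\<bar>det (matrix ?f)\<bar> = 1"
    by (simp add: det_permute_rows permutes_swap_id sign_swap_id abs_mult)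
  moreover have "lborel = distr lborel borel ?f"
  proof (rule lborel_eqI)
    fix l u :: "real^'n"
    assume lu: "\<And>b. b \<in> Basis \<Longrightarrow> l \<bullet> b \<le> u \<bullet> b"
    have all: "(\<forall>i. P (Transposition.transpose m n i)) \<longleftrightarrow> (\<forall>i. P i)" for P
      by (metis transpose_involutory)
    have "x \<in> ?f -` box l u \<longleftrightarrow> x \<in> box (?f l) (?f u)" for x
      using all[of "\<lambda>i. l $ Transposition.transpose m n i < x $ i \<and> x $ i < u $ Transposition.transpose m n i"]
      by (simp add: mem_box_cart)
    then have "?f -` box l u = box (?f l) (?f u)"
      by blast
    moreover have "(\<Prod>b\<in>Basis. (?f u - ?f l) \<bullet> b) = (\<Prod>i\<in>UNIV. (u - l) $ Transposition.transpose m n i)"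
      by (simp add: prod_Basis_vec inner_axis)
    moreover have "\<dots> = (\<Prod>i\<in>UNIV. (u - l) $ i)"
      by (rule prod.permute[OF permutes_swap_id, where g = "\<lambda>i. (u - l) $ i", symmetric, unfolded o_def]) auto
    moreover have "\<dots> = (\<Prod>b\<in>Basis. (u - l) \<bullet> b)"
      by (simp add: prod_Basis_vec inner_axis)
    moreover have "?f l \<bullet> b \<le> ?f u \<bullet> b" if "b \<in> Basis" for b
    proof -
      obtain i where b: "b = axis i 1"
        using \<open>b \<in> Basis\<close> by (auto simp: Basis_vec_eq_range)
      have "axis (Transposition.transpose m n i) 1 \<in> (Basis :: (real^'n) set)"
        by (simp add: Basis_vec_eq_range)
      from lu[OF this] show ?thesis
        by (simp add: b inner_axis)
    qed
    ultimately show "emeasure (distr lborel borel ?f) (box l u) = ennreal (\<Prod>b\<in>Basis. (u - l) \<bullet> b)"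
      by (simp add: emeasure_distr emeasure_lborel_box)
  qed simp
  ultimately show "det (matrix ?f) \<noteq> 0 \<longrightarrow> lborel = density (distr lborel borel ?f) (\<lambda>_. ennreal \<bar>det (matrix ?f)\<bar>)"
    by (simp add: density_1)
next
  fix m n :: 'n
  assume idplus: "m \<noteq> n"
  let ?f = "\<lambda>x::real^'n. \<chi> i. if i = m then x $ m + x $ n else x $ i"
  have lin: "linear ?f"
    by (rule linearI) (auto simp: algebra_simps vec_eq_iff)
  then have [measurable]: "?f \<in> borel_measurable borel"
    by (auto intro!: borel_measurable_continuous_onI linear_continuous_on simp: linear_linear)
  have "matrix ?f = (\<chi> k. if k = m then row m (mat 1) + 1 *s row n (mat 1) else row k (mat 1))"
    by (auto simp: matrix_def axis_def mat_def row_def vec_eq_iff)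
  then have "det (matrix ?f) = 1"
    using det_row_operation[OF idplus, of "mat 1 :: real^'n^'n" 1] by (simp only: det_I)
  moreover have "lborel = distr lborel borel ?f"
  proof (rule lborel_eqI)
    fix l u :: "real^'n"
    assume lu: "\<And>b. b \<in> Basis \<Longrightarrow> l \<bullet> b \<le> u \<bullet> b"
    let ?X = "?f -` box l u"
    have bor: "?X \<in> sets borel"
      using measurable_sets_borel[of ?f borel "box l u"] by simp
    have "?X \<subseteq> box (\<chi> i. if i = m then l $ m - u $ n else l $ i) (\<chi> i. if i = m then u $ m - l $ n else u $ i)"
    proof
      fix x assume "x \<in> ?X"
      then have *: "l $ i < (if i = m then x $ m + x $ n else x $ i)"
          "(if i = m then x $ m + x $ n else x $ i) < u $ i" for i
        by (auto simp: mem_box_cart)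
      show "x \<in> box (\<chi> i. if i = m then l $ m - u $ n else l $ i) (\<chi> i. if i = m then u $ m - l $ n else u $ i)"
        unfolding mem_box_cart
      proof
        fix i
        show "(\<chi> i. if i = m then l $ m - u $ n else l $ i) $ i < x $ i \<and>
            x $ i < (\<chi> i. if i = m then u $ m - l $ n else u $ i) $ i"
          using *[of m] *[of n] *[of i] idplus by (cases "i = m") auto
      qed
    qed
    then have lm: "?X \<in> lmeasurable"
      using bor by (intro bounded_set_imp_lmeasurable) (auto intro: bounded_subset[OF bounded_box])
    have "?f ` ?X = box l u"
    proof
      show "box l u \<subseteq> ?f ` ?X"
      proof
        fix y assume y: "y \<in> box l u"
        let ?x = "\<chi> i. if i = m then y $ m - y $ n else y $ i"
        have eq: "?f ?x = y"
          using idplus by (auto simp: vec_eq_iff)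
        show "y \<in> ?f ` ?X"
        proof (rule image_eqI)
          show "y = ?f ?x"
            by (rule eq[symmetric])
          show "?x \<in> ?X"
            using eq y by (simp only: vimage_eq)
        qed
      qed
    qed auto
    then have "measure lebesgue ?X = measure lebesgue (box l u)"
      using measure_shear[OF idplus lm] by simp
    then have "emeasure lborel ?X = ennreal (measure lborel (box l u))"
      using emeasure_eq_measure2[OF lm] bor by simp
    then show "emeasure (distr lborel borel ?f) (box l u) = ennreal (\<Prod>b\<in>Basis. (u - l) \<bullet> b)"
      using lu by (simp add: emeasure_distr)
  qed simp
  ultimately show "det (matrix ?f) \<noteq> 0 \<longrightarrow> lborel = density (distr lborel borel ?f) (\<lambda>_. ennreal \<bar>det (matrix ?f)\<bar>)"
    by (simp add: density_1)
qed

lemma lborel_matrix: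
  fixes M :: "real^'n^'n"
  assumes "invertible M"
  shows "lborel = density (distr lborel borel (\<lambda>x. M *v x)) (\<lambda>_. ennreal \<bar>det M\<bar>)"
  using lborel_linear[of "\<lambda>x. M *v x"] assms by (simp add: invertible_det_nz)

lemma measurable_matrix_vector [measurable]: "(\<lambda>x. (M :: real^'n^'m) *v x) \<in> borel_measurable borel"
  by (intro borel_measurable_continuous_onI continuous_intros)

lemma nn_integral_lborel_matrix:
  fixes M :: "real^'n^'n" and f :: "real^'n \<Rightarrow> ennreal"
  assumes M: "invertible M" and f: "f \<in> borel_measurable borel"
  shows "ennreal \<bar>det M\<bar> * (\<integral>\<^sup>+x. f (M *v x) \<partial>lborel) = (\<integral>\<^sup>+x. f x \<partial>lborel)"
proof -
  have "(\<integral>\<^sup>+x. f x \<partial>lborel) = (\<integral>\<^sup>+x. f x \<partial>density (distr lborel borel (\<lambda>x. M *v x)) (\<lambda>_. ennreal \<bar>det M\<bar>))"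
    using lborel_matrix[OF M] by simp
  also have "\<dots> = ennreal \<bar>det M\<bar> * (\<integral>\<^sup>+x. f (M *v x) \<partial>lborel)"
    using f by (simp add: nn_integral_density nn_integral_distr nn_integral_cmult)
  finally show ?thesis ..
qed

section \<open>Closed linear groups\<close>

locale linear_group =
  fixes H :: "(real^'n^'n) set"
  assumes closed_subgroup: "closed_subgroup_of_GL H"
begin

lemma sub: "subgroup H GL_group"
  using closed_subgroup by (simp add: closed_subgroup_of_GL_def)

lemma invertible_H: "h \<in> H \<Longrightarrow> invertible h"
  using subgroup.subset[OF sub] by (auto simp: GL_group_def)

lemma det_nz: "h \<in> H \<Longrightarrow> det h \<noteq> 0"
  using invertible_H by (simp add: invertible_det_nz)

lemma one_H: "mat 1 \<in> H"
  using subgroup.one_closed[OF sub] by (simp add: GL_group_def)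

lemma mult_H: "g \<in> H \<Longrightarrow> h \<in> H \<Longrightarrow> g ** h \<in> H"
  using subgroup.m_closed[OF sub, of g h] by (simp add: GL_group_def)

lemma inv_H: 
  assumes "h \<in> H" 
  shows "matrix_inv h \<in> H"
proof -
  have "inv\<^bsub>GL_group\<^esub> h = matrix_inv h"
    unfolding m_inv_def
  proof (rule the_equality)
    show "matrix_inv h \<in> carrier GL_group \<and> h \<otimes>\<^bsub>GL_group\<^esub> matrix_inv h = \<one>\<^bsub>GL_group\<^esub> \<and>
        matrix_inv h \<otimes>\<^bsub>GL_group\<^esub> h = \<one>\<^bsub>GL_group\<^esub>"
      using matrix_inv_inverse[OF invertible_H[OF assms]] by (auto simp: GL_group_def invertible_def)
  next
    fix y assume "y \<in> carrier GL_group \<and> h \<otimes>\<^bsub>GL_group\<^esub> y = \<one>\<^bsub>GL_group\<^esub> \<and>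
        y \<otimes>\<^bsub>GL_group\<^esub> h = \<one>\<^bsub>GL_group\<^esub>"
    then show "y = matrix_inv h"
      using matrix_inv_eqI[of h y] by (simp add: GL_group_def)
  qed
  then show ?thesis
    using subgroup.m_inv_closed[OF sub assms] by simp
qed

lemma inv_right: "h \<in> H \<Longrightarrow> h ** matrix_inv h = mat 1"
  and inv_left: "h \<in> H \<Longrightarrow> matrix_inv h ** h = mat 1"
  using matrix_inv_inverse[OF invertible_H] by auto

lemma inv_inv: "h \<in> H \<Longrightarrow> matrix_inv (matrix_inv h) = h"
  by (rule matrix_inv_eqI) (rule inv_left)

lemma inv_mult:
  assumes "g \<in> H" "h \<in> H"
  shows "matrix_inv (g ** h) = matrix_inv h ** matrix_inv g"
proof (rule matrix_inv_eqI)
  have "g ** h ** (matrix_inv h ** matrix_inv g) = g ** (h ** matrix_inv h) ** matrix_inv g"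
    by (simp only: matrix_mul_assoc)
  then show "g ** h ** (matrix_inv h ** matrix_inv g) = mat 1"
    using assms by (simp add: inv_right)
qed

lemma det_inv:
  assumes "h \<in> H" 
  shows "det (matrix_inv h) = 1 / det h"
proof -
  have "det (matrix_inv h) * det h = 1"
    by (simp add: det_mul[symmetric] inv_left assms)
  then show ?thesis
    using det_nz[OF assms] by (simp add: field_simps)
qed

lemma act_inv: "h \<in> H \<Longrightarrow> transpose h *v (transpose (matrix_inv h) *v x) = x"
  and act_inv': "h \<in> H \<Longrightarrow> transpose (matrix_inv h) *v (transpose h *v x) = x"
  by (simp_all add: matrix_vector_mul_assoc matrix_transpose_mul[symmetric] inv_left inv_right)

lemma act_mult: "transpose (g ** h :: real^'n^'n) *v x = transpose h *v (transpose g *v x)"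
  by (simp only: matrix_vector_mul_assoc matrix_transpose_mul)

lemma closed_H:
  assumes "\<And>n. f n \<in> H" "f \<longlonglongrightarrow> h" "invertible h"
  shows "h \<in> H"
proof -
  obtain T where T: "closed T" "H = {A. invertible A} \<inter> T"
    using closed_subgroup unfolding closed_subgroup_of_GL_def closedin_closed GL_group_def by auto
  then have "h \<in> T"
    using assms closed_sequentially[of T f h] by auto
  then show ?thesis
    using T assms by auto
qed

text \<open>Compact pieces: a lower bound on the determinant keeps limits inside the general linear
  group, relative to which the group is closed.\<close>

definition exhaust :: "nat \<Rightarrow> (real^'n^'n) set" where
  "exhaust n = {h \<in> H. norm h \<le> real n \<and> 1 / (1 + real n) \<le> \<bar>det h\<bar>}"

lemma compact_exhaust: "compact (exhaust n)"
proof -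
  obtain T where T: "closed T" "H = {A. invertible A} \<inter> T"
    using closed_subgroup unfolding closed_subgroup_of_GL_def closedin_closed GL_group_def by auto
  have "invertible h" if "1 / (1 + real n) \<le> \<bar>det h\<bar>" for h :: "real^'n^'n"
    using that by (auto simp: invertible_det_nz field_simps)
  then have "exhaust n = T \<inter> {h. norm h \<le> real n} \<inter> {h. 1 / (1 + real n) \<le> \<bar>det h\<bar>}"
    using T(2) unfolding exhaust_def by blast
  moreover have "closed {h::real^'n^'n. norm h \<le> real n}" "closed {h::real^'n^'n. 1 / (1 + real n) \<le> \<bar>det h\<bar>}"
    by (intro closed_Collect_le continuous_intros)+
  moreover have "bounded (exhaust n)"
    by (auto simp: exhaust_def bounded_iff)
  ultimately show ?thesis
    using T(1) by (auto simp: compact_eq_bounded_closed)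
qed

lemma exhaust_subset: "exhaust n \<subseteq> H"
  by (auto simp: exhaust_def)

lemma Union_exhaust: "(\<Union>n. exhaust n) = H"
proof
  show "H \<subseteq> (\<Union>n. exhaust n)"
  proof
    fix h assume h: "h \<in> H"
    obtain n1 where n1: "norm h \<le> real n1"
      using real_arch_simple by blast
    obtain n2 where n2: "1 / \<bar>det h\<bar> \<le> real n2"
      using real_arch_simple by blast
    have "1 / \<bar>det h\<bar> \<le> 1 + real (max n1 n2)"
      using n2 by (auto simp: max_def)
    then have "1 / (1 + real (max n1 n2)) \<le> \<bar>det h\<bar>"
      using det_nz[OF h] by (simp add: field_simps)
    with n1 h have "h \<in> exhaust (max n1 n2)"
      by (auto simp: exhaust_def max_def)
    then show "h \<in> (\<Union>n. exhaust n)" by auto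
  qed
qed (auto simp: exhaust_def)

lemma borel_H: "H \<in> sets borel"
proof -
  have "(\<Union>n. exhaust n) \<in> sets borel"
    using compact_exhaust by (intro sets.countable_UN) (auto intro: borel_compact)
  then show ?thesis
    by (simp add: Union_exhaust)
qed

lemma continuous_on_inv: "continuous_on H matrix_inv"
  by (rule continuous_on_subset[OF continuous_on_matrix_inv]) (auto simp: invertible_H)

end

lemma borel_measurable_act [measurable (raw)]:
  fixes f :: "'a \<Rightarrow> real^'n^'m" and g :: "'a \<Rightarrow> real^'m"
  assumes "f \<in> borel_measurable M" "g \<in> borel_measurable M"
  shows "(\<lambda>x. transpose (f x) *v g x) \<in> borel_measurable M"
  by (rule borel_measurable_continuous_Pair[OF assms]) (intro continuous_intros)

lemma borel_measurable_det [measurable (raw)]: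
  fixes f :: "'a \<Rightarrow> real^'n^'n"
  assumes "f \<in> borel_measurable M"
  shows "(\<lambda>x. det (f x)) \<in> borel_measurable M"
  by (rule borel_measurable_continuous_on[OF _ assms]) (intro continuous_intros)

section \<open>Haar measure and the open orbit\<close>

locale haar_group = linear_group H for H :: "(real^'n^'n) set" +
  fixes \<mu> :: "(real^'n^'n) measure"
  assumes haar: "left_haar_measure (dilation_group H) \<mu>"
begin

lemma sets_mu [measurable_cong]: "sets \<mu> = sets (restrict_space borel H)"
  using haar by (simp add: left_haar_measure_def)

lemma space_mu: "space \<mu> = H"
  using sets_eq_imp_space_eq[OF sets_mu] by (simp add: space_restrict_space)

lemma sets_mu_iff: "A \<in> sets \<mu> \<longleftrightarrow> A \<subseteq> H \<and> A \<in> sets borel"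
  unfolding sets_mu using borel_H by (auto simp: sets_restrict_space_iff)

lemma compact_finite: "compact C \<Longrightarrow> C \<subseteq> H \<Longrightarrow> emeasure \<mu> C < \<infinity>"
  using haar by (simp add: left_haar_measure_def)

lemma measurable_borel_mu: "f \<in> borel_measurable borel \<Longrightarrow> f \<in> borel_measurable \<mu>"
  unfolding measurable_cong_sets[OF sets_mu refl] by (rule measurable_restrict_space1)

lemma continuous_borel_mu:
  fixes f :: "_ \<Rightarrow> 'b::topological_space"
  shows "continuous_on H f \<Longrightarrow> f \<in> borel_measurable \<mu>"
  unfolding measurable_cong_sets[OF sets_mu refl] by (rule borel_measurable_continuous_on_restrict)

lemma ident_mu [measurable]: "(\<lambda>h. h) \<in> borel_measurable \<mu>"
  by (rule measurable_borel_mu) simp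

lemma inv_mu [measurable]: "matrix_inv \<in> borel_measurable \<mu>"
  by (rule continuous_borel_mu) (rule continuous_on_inv)

lemma mult_mu: 
  assumes "g \<in> H"
  shows "(\<lambda>h. g ** h) \<in> measurable \<mu> \<mu>"
proof -
  have "(\<lambda>h. g ** h) \<in> borel_measurable \<mu>"
    by (rule continuous_borel_mu) (intro continuous_intros)
  then show ?thesis
    unfolding measurable_cong_sets[OF refl sets_mu] using assms
    by (auto intro!: measurable_restrict_space2 mult_H simp: space_mu)
qed

lemma nn_integral_left_invariant:
  assumes g: "g \<in> H" and F: "F \<in> borel_measurable \<mu>"
  shows "(\<integral>\<^sup>+h. F (g ** h) \<partial>\<mu>) = (\<integral>\<^sup>+h. F h \<partial>\<mu>)"
proof -
  have "distr \<mu> \<mu> (\<lambda>h. g ** h) = \<mu>"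
  proof (rule measure_eqI)
    fix A assume "A \<in> sets (distr \<mu> \<mu> (\<lambda>h. g ** h))"
    then have A: "A \<in> sets \<mu>" by simp
    have "(\<lambda>h. g ** h) -` A \<inter> space \<mu> = (\<lambda>h. matrix_inv g ** h) ` A"
    proof (intro Set.set_eqI iffI)
      fix h assume "h \<in> (\<lambda>h. g ** h) -` A \<inter> space \<mu>"
      then show "h \<in> (\<lambda>h. matrix_inv g ** h) ` A"
        by (intro image_eqI[of _ _ "g ** h"]) (simp_all add: matrix_mul_assoc inv_left g)
    next
      fix h assume "h \<in> (\<lambda>h. matrix_inv g ** h) ` A"
      then show "h \<in> (\<lambda>h. g ** h) -` A \<inter> space \<mu>"
        using A by (auto simp: matrix_mul_assoc inv_right g space_mu sets_mu_iff intro!: mult_H inv_H)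
    qed
    moreover have "emeasure \<mu> ((\<lambda>h. matrix_inv g ** h) ` A) = emeasure \<mu> A"
      using haar A inv_H[OF g] by (simp add: left_haar_measure_def GL_group_def)
    ultimately show "emeasure (distr \<mu> \<mu> (\<lambda>h. g ** h)) A = emeasure \<mu> A"
      using A mult_mu[OF g] by (simp add: emeasure_distr)
  qed simp
  then have "(\<integral>\<^sup>+h. F h \<partial>\<mu>) = (\<integral>\<^sup>+h. F h \<partial>distr \<mu> \<mu> (\<lambda>h. g ** h))"
    by simp
  also have "\<dots> = (\<integral>\<^sup>+h. F (g ** h) \<partial>\<mu>)"
    by (rule nn_integral_distr[OF mult_mu[OF g]]) (use F in simp)
  finally show ?thesis ..
qed

lemma exhaust_sets: "exhaust n \<in> sets \<mu>"
  using exhaust_subset compact_exhaust by (auto simp: sets_mu_iff intro: borel_compact)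

sublocale mu: sigma_finite_measure \<mu>
proof
  show "\<exists>A. countable A \<and> A \<subseteq> sets \<mu> \<and> \<Union>A = space \<mu> \<and> (\<forall>a\<in>A. emeasure \<mu> a \<noteq> \<infinity>)"
    using exhaust_sets Union_exhaust compact_finite[OF compact_exhaust exhaust_subset]
    by (intro exI[of _ "range exhaust"]) (auto simp: space_mu less_top)
qed

text \<open>Countably many translates of a nonempty open set cover the group.\<close>

lemma emeasure_open_pos:
  assumes "open V" "k \<in> V" "k \<in> H"
  shows "emeasure \<mu> (V \<inter> H) > 0"
proof (rule ccontr)
  assume "\<not> ?thesis"
  then have 0: "emeasure \<mu> (V \<inter> H) = 0" by simp
  define W where "W g = {h. (k ** matrix_inv g) ** h \<in> V}" for g :: "real^'n^'n"
  have open_W: "open (W g)" for g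
    unfolding W_def using \<open>open V\<close>
    by (intro open_vimage[of V, unfolded vimage_def]) (auto intro!: continuous_intros)
  have "g \<in> W g" if "g \<in> H" for g
    using assms that by (simp add: W_def matrix_mul_assoc[symmetric] inv_left)
  then have "H \<subseteq> \<Union>(W ` H)" by auto
  moreover obtain F' where F': "F' \<subseteq> W ` H" "countable F'" "\<Union>F' = \<Union>(W ` H)"
    using Lindelof[of "W ` H"] open_W by (metis imageE)
  ultimately have cov: "H \<subseteq> \<Union>F'" by simp
  have "W g \<inter> H \<in> null_sets \<mu>" if g: "g \<in> H" for g
  proof -
    have sets: "W g \<inter> H \<in> sets \<mu>" "V \<inter> H \<in> sets \<mu>"
      using open_W \<open>open V\<close> borel_H by (auto simp: sets_mu_iff intro!: sets.Int borel_open)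
    have kg: "k ** matrix_inv g \<in> H"
      using g assms by (intro mult_H inv_H)
    have "emeasure \<mu> (V \<inter> H) = (\<integral>\<^sup>+h. indicator (V \<inter> H) h \<partial>\<mu>)"
      using sets by simp
    also have "\<dots> = (\<integral>\<^sup>+h. indicator (V \<inter> H) ((k ** matrix_inv g) ** h) \<partial>\<mu>)"
      using nn_integral_left_invariant[OF kg, of "indicator (V \<inter> H)"] sets by simp
    also have "\<dots> = (\<integral>\<^sup>+h. indicator (W g \<inter> H) h \<partial>\<mu>)"
      using kg mult_H by (intro nn_integral_cong) (auto simp: indicator_def W_def space_mu)
    also have "\<dots> = emeasure \<mu> (W g \<inter> H)"
      using sets by simp
    finally show ?thesis
      using 0 sets by (simp add: null_sets_def)
  qed
  then have "(\<Union>X\<in>F'. X \<inter> H) \<in> null_sets \<mu>"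
    using F' by (intro null_sets_UN') auto
  moreover have "(\<Union>X\<in>F'. X \<inter> H) = H"
    using cov by auto
  ultimately have "emeasure \<mu> H = 0"
    by auto
  then show False
    using haar by (simp add: left_haar_measure_def)
qed

end

locale orbit_group = haar_group H \<mu> for H :: "(real^'n^'n) set" and \<mu> +
  fixes \<O> :: "(real^'n) set"
  assumes orbit: "open_dual_orbit H \<O>"
begin

lemma open_O: "open \<O>" and negligible_compl: "negligible (- \<O>)"
  using orbit by (auto simp: open_dual_orbit_def)

lemma orbit_eq:
  assumes "\<xi> \<in> \<O>"
  shows "\<O> = (\<lambda>h. transpose h *v \<xi>) ` H"
proof -
  obtain \<xi>1 where O: "\<O> = {transpose h *v \<xi>1 | h. h \<in> H}"
    using orbit by (auto simp: open_dual_orbit_def dual_orbit_def)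
  then obtain g where g: "g \<in> H" "\<xi> = transpose g *v \<xi>1"
    using assms by auto
  show ?thesis
  proof (intro Set.set_eqI iffI)
    fix x assume "x \<in> \<O>"
    then obtain h where h: "h \<in> H" "x = transpose h *v \<xi>1"
      using O by auto
    have "x = transpose (matrix_inv g ** h) *v \<xi>"
      using g h by (simp add: act_mult act_inv')
    then show "x \<in> (\<lambda>h. transpose h *v \<xi>) ` H"
      using g h mult_H inv_H by blast
  next
    fix x assume "x \<in> (\<lambda>h. transpose h *v \<xi>) ` H"
    then show "x \<in> \<O>"
      unfolding O using g mult_H by (auto simp: act_mult[symmetric])
  qed
qed

lemma act_O: "\<xi> \<in> \<O> \<Longrightarrow> h \<in> H \<Longrightarrow> transpose h *v \<xi> \<in> \<O>"
  using orbit_eq by blast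

lemma act_not_O: "\<xi> \<notin> \<O> \<Longrightarrow> h \<in> H \<Longrightarrow> transpose h *v \<xi> \<notin> \<O>"
  using act_O[of "transpose h *v \<xi>" "matrix_inv h"] by (auto simp: act_inv' inv_H)

text \<open>A nonempty open set is not negligible, so that it meets the orbit.\<close>

lemma open_meets_O: "open V \<Longrightarrow> V \<noteq> {} \<Longrightarrow> V \<inter> \<O> \<noteq> {}"
  using open_not_negligible[of V] negligible_subset[OF negligible_compl] by blast

lemma O_nonempty: "\<O> \<noteq> {}"
  using open_meets_O[of UNIV] by auto

text \<open>By Baire's theorem the image of some compact part of the group has interior points;
  compactness of the stabiliser then makes the orbit map proper over these points.\<close>

lemma proper_over_open_set:
  assumes "\<xi> \<in> \<O>"
  obtains U C where "open U" "U \<noteq> {}" "U \<subseteq> \<O>" "bounded U" "compact C" "C \<subseteq> H"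
    "\<And>h. h \<in> H \<Longrightarrow> transpose h *v \<xi> \<in> U \<Longrightarrow> h \<in> C"
proof -
  define K where "K n = (\<lambda>h. transpose h *v \<xi>) ` exhaust n" for n
  have compact_K: "compact (K n)" for n
    unfolding K_def by (intro compact_continuous_image compact_exhaust continuous_intros)
  have "(\<Union>n. K n) = (\<lambda>h. transpose h *v \<xi>) ` (\<Union>n. exhaust n)"
    by (auto simp: K_def)
  then have O_K: "\<O> = (\<Union>n. K n)"
    by (simp only: Union_exhaust orbit_eq[OF assms, symmetric])
  have "\<exists>n. interior (K n) \<noteq> {}"
  proof (rule ccontr)
    assume "\<not> ?thesis"
    then have "closure (- K n) = UNIV" for n
      by (simp add: closure_complement)
    then have "UNIV \<subseteq> closure (\<Inter>(range (\<lambda>n. - K n)))"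
      using compact_K by (intro Baire) (auto simp: open_Compl compact_imp_closed)
    moreover have "\<Inter>(range (\<lambda>n. - K n)) = - \<O>"
      using O_K by auto
    ultimately show False
      using open_O O_nonempty by (auto simp: closure_complement interior_open)
  qed
  then obtain n where n: "interior (K n) \<noteq> {}" by auto
  define S where "S = dual_stabilizer H \<xi>"
  have "compact S"
    using orbit assms by (auto simp: S_def open_dual_orbit_def)
  define C where "C = (\<lambda>(s, c). s ** c) ` (S \<times> exhaust n)"
  have "compact C"
    unfolding C_def case_prod_unfold using \<open>compact S\<close> compact_exhaust
    by (intro compact_continuous_image continuous_intros compact_Times)
  moreover have "C \<subseteq> H"
    using exhaust_subset by (auto simp: C_def S_def dual_stabilizer_def intro!: mult_H)
  moreover have "h \<in> C" if h: "h \<in> H" "transpose h *v \<xi> \<in> interior (K n)" for h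
  proof -
    have "transpose h *v \<xi> \<in> K n"
      using h interior_subset by blast
    then obtain c where c: "c \<in> exhaust n" "transpose h *v \<xi> = transpose c *v \<xi>"
      by (auto simp: K_def)
    have cH: "c \<in> H"
      using c exhaust_subset by auto
    have "transpose (h ** matrix_inv c) *v \<xi> = \<xi>"
      using c cH by (simp add: act_mult act_inv')
    then have "h ** matrix_inv c \<in> S"
      using h cH by (auto simp: S_def dual_stabilizer_def intro: mult_H inv_H)
    moreover have "h = h ** matrix_inv c ** c"
      using cH by (simp add: matrix_mul_assoc[symmetric] inv_left)
    ultimately show ?thesis
      unfolding C_def using c by force
  qed
  moreover have "interior (K n) \<subseteq> \<O>"
    using interior_subset O_K by blast
  moreover have "bounded (interior (K n))"
    using compact_K by (meson bounded_subset compact_imp_bounded interior_subset)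
  ultimately show ?thesis
    using that[of "interior (K n)" C] n by auto
qed

text \<open>The uniqueness argument for Haar measures. Two measures on the orbit that are scaled in
  the same way by the group satisfy \<open>c \<phi> * \<kappa> U = \<integral> \<phi> * \<Psi> d\<kappa>\<close> with the same \<open>c\<close> and the
  same \<open>\<Psi>\<close>; dividing by \<open>\<Psi>\<close> shows that they are proportional.\<close>

lemma orbit_fubini:
  fixes T :: "'y \<Rightarrow> real^'n"
  assumes "sigma_finite_measure \<kappa>" and T [measurable]: "T \<in> borel_measurable \<kappa>"
    and scale: "\<And>f h. f \<in> borel_measurable borel \<Longrightarrow> h \<in> H \<Longrightarrow>
      (\<integral>\<^sup>+y. f (transpose (matrix_inv h) *v T y) \<partial>\<kappa>) = ennreal \<bar>det h\<bar> * (\<integral>\<^sup>+y. f (T y) \<partial>\<kappa>)"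
    and [measurable]: "U \<in> sets borel" and "U \<subseteq> \<O>" and \<xi>: "\<xi> \<in> \<O>"
    and [measurable]: "\<phi> \<in> borel_measurable borel"
  shows "(\<integral>\<^sup>+h. \<phi> (transpose h *v \<xi>) \<partial>\<mu>) * (\<integral>\<^sup>+y. indicator U (T y) \<partial>\<kappa>) =
    (\<integral>\<^sup>+y. \<phi> (T y) * (\<integral>\<^sup>+h. indicator U (transpose (matrix_inv h) *v T y) * ennreal (1 / \<bar>det h\<bar>) \<partial>\<mu>) \<partial>\<kappa>)"
proof -
  interpret \<kappa>: sigma_finite_measure \<kappa> by fact
  interpret P: pair_sigma_finite \<mu> \<kappa> ..
  have "(\<integral>\<^sup>+y. \<phi> (T y) * (\<integral>\<^sup>+h. indicator U (transpose (matrix_inv h) *v T y) * ennreal (1 / \<bar>det h\<bar>) \<partial>\<mu>) \<partial>\<kappa>)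
      = (\<integral>\<^sup>+y. (\<integral>\<^sup>+h. \<phi> (T y) * (indicator U (transpose (matrix_inv h) *v T y) * ennreal (1 / \<bar>det h\<bar>)) \<partial>\<mu>) \<partial>\<kappa>)"
    by (intro nn_integral_cong nn_integral_cmult[symmetric]) measurable
  also have "\<dots> = (\<integral>\<^sup>+h. (\<integral>\<^sup>+y. \<phi> (T y) * (indicator U (transpose (matrix_inv h) *v T y) * ennreal (1 / \<bar>det h\<bar>)) \<partial>\<kappa>) \<partial>\<mu>)"
    by (rule P.Fubini') measurable
  also have "\<dots> = (\<integral>\<^sup>+h. (\<integral>\<^sup>+y. \<phi> (transpose h *v T y) * indicator U (T y) \<partial>\<kappa>) \<partial>\<mu>)"
  proof (rule nn_integral_cong)
    fix h assume "h \<in> space \<mu>"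
    then have h: "h \<in> H" by (simp add: space_mu)
    have "(\<integral>\<^sup>+y. \<phi> (T y) * (indicator U (transpose (matrix_inv h) *v T y) * ennreal (1 / \<bar>det h\<bar>)) \<partial>\<kappa>)
       = (\<integral>\<^sup>+y. ennreal (1 / \<bar>det h\<bar>) * (\<phi> (T y) * indicator U (transpose (matrix_inv h) *v T y)) \<partial>\<kappa>)"
      by (simp add: mult_ac)
    also have "\<dots> = ennreal (1 / \<bar>det h\<bar>) * (\<integral>\<^sup>+y. \<phi> (T y) * indicator U (transpose (matrix_inv h) *v T y) \<partial>\<kappa>)"
      by (rule nn_integral_cmult) measurable
    also have "(\<integral>\<^sup>+y. \<phi> (T y) * indicator U (transpose (matrix_inv h) *v T y) \<partial>\<kappa>) =
       ennreal \<bar>det h\<bar> * (\<integral>\<^sup>+y. \<phi> (transpose h *v T y) * indicator U (T y) \<partial>\<kappa>)"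
      using scale[of "\<lambda>x. \<phi> (transpose h *v x) * indicator U x" h] h by (simp add: act_inv)
    finally show "(\<integral>\<^sup>+y. \<phi> (T y) * (indicator U (transpose (matrix_inv h) *v T y) * ennreal (1 / \<bar>det h\<bar>)) \<partial>\<kappa>)
      = (\<integral>\<^sup>+y. \<phi> (transpose h *v T y) * indicator U (T y) \<partial>\<kappa>)"
      using det_nz[OF h] by (simp add: mult.assoc[symmetric] ennreal_mult''[symmetric])
  qed
  also have "\<dots> = (\<integral>\<^sup>+y. (\<integral>\<^sup>+h. \<phi> (transpose h *v T y) * indicator U (T y) \<partial>\<mu>) \<partial>\<kappa>)"
    by (rule P.Fubini'[symmetric]) measurable
  also have "\<dots> = (\<integral>\<^sup>+y. (\<integral>\<^sup>+h. \<phi> (transpose h *v \<xi>) \<partial>\<mu>) * indicator U (T y) \<partial>\<kappa>)"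
  proof (rule nn_integral_cong)
    fix y
    have "(\<integral>\<^sup>+h. \<phi> (transpose h *v T y) \<partial>\<mu>) = (\<integral>\<^sup>+h. \<phi> (transpose h *v \<xi>) \<partial>\<mu>)" if "T y \<in> U"
    proof -
      have "T y \<in> (\<lambda>h. transpose h *v \<xi>) ` H"
        using that \<open>U \<subseteq> \<O>\<close> orbit_eq[OF \<xi>] by blast
      then obtain k where k: "k \<in> H" "T y = transpose k *v \<xi>"
        by auto
      show ?thesis
        using nn_integral_left_invariant[OF k(1), of "\<lambda>h. \<phi> (transpose h *v \<xi>)"]
        by (simp add: k(2) act_mult)
    qed
    then show "(\<integral>\<^sup>+h. \<phi> (transpose h *v T y) * indicator U (T y) \<partial>\<mu>) =
        (\<integral>\<^sup>+h. \<phi> (transpose h *v \<xi>) \<partial>\<mu>) * indicator U (T y)"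
      by (auto simp: indicator_def)
  qed
  also have "\<dots> = (\<integral>\<^sup>+h. \<phi> (transpose h *v \<xi>) \<partial>\<mu>) * (\<integral>\<^sup>+y. indicator U (T y) \<partial>\<kappa>)"
    by (rule nn_integral_cmult) measurable
  finally show ?thesis ..
qed

text \<open>Lebesgue measure on the orbit and the image of \<open>|det h|\<^bsup>-1\<^esup> dh\<close> under \<open>h \<mapsto> h\<^bsup>-T\<^esup> \<xi>\<close> are both scaled by
  \<open>|det h|\<close>, so that the previous identity compares them. Properness of the orbit map makes \<open>\<Psi>\<close>
  finite on the orbit; it is positive since nonempty open sets have positive Haar measure.\<close>

lemma orbit_integral:
  assumes \<xi>: "\<xi> \<in> \<O>"
  shows "\<exists>C < \<infinity>. \<forall>G \<in> borel_measurable borel.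
    (\<integral>\<^sup>+x. G x \<partial>lborel) = C * (\<integral>\<^sup>+h. G (transpose (matrix_inv h) *v \<xi>) * ennreal (1 / \<bar>det h\<bar>) \<partial>\<mu>)"
proof -
  obtain U C where U: "open U" "U \<noteq> {}" "U \<subseteq> \<O>" "bounded U" and C: "compact C" "C \<subseteq> H"
    and UC: "\<And>h. h \<in> H \<Longrightarrow> transpose h *v \<xi> \<in> U \<Longrightarrow> h \<in> C"
    using proper_over_open_set[OF \<xi>] by metis
  have U_borel [measurable]: "U \<in> sets borel"
    using U by simp
  define \<Psi> where "\<Psi> \<eta> = (\<integral>\<^sup>+h. indicator U (transpose (matrix_inv h) *v \<eta>) * ennreal (1 / \<bar>det h\<bar>) \<partial>\<mu>)" for \<eta>
  have [measurable]: "\<Psi> \<in> borel_measurable borel"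
    unfolding \<Psi>_def by measurable
  have fin: "\<Psi> \<eta> < \<infinity>" if \<eta>: "\<eta> \<in> \<O>" for \<eta>
  proof -
    obtain k where k: "k \<in> H" "\<eta> = transpose k *v \<xi>"
      using \<eta> orbit_eq[OF \<xi>] by auto
    define K where "K = (\<lambda>c. matrix_inv c ** k) ` C"
    have "compact K"
      unfolding K_def using C continuous_on_subset[OF continuous_on_inv]
      by (intro compact_continuous_image continuous_intros) auto
    have "K \<subseteq> H"
      using C k by (auto simp: K_def intro!: mult_H inv_H)
    have inK: "h \<in> K" if "h \<in> H" "transpose (matrix_inv h) *v \<eta> \<in> U" for h
    proof -
      have "k ** matrix_inv h \<in> C"
        using that k by (intro UC mult_H inv_H) (auto simp: act_mult)
      moreover have "h = matrix_inv (k ** matrix_inv h) ** k"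
        using that k by (simp add: inv_mult inv_H inv_inv matrix_mul_assoc[symmetric] inv_left)
      ultimately show ?thesis
        unfolding K_def by blast
    qed
    have "continuous_on K (\<lambda>h. 1 / \<bar>det h\<bar>)"
      using \<open>K \<subseteq> H\<close> det_nz by (intro continuous_intros) auto
    then obtain B where B: "\<And>h. h \<in> K \<Longrightarrow> 1 / \<bar>det h\<bar> \<le> B"
      using compact_imp_bounded[OF compact_continuous_image[OF _ \<open>compact K\<close>]]
      by (fastforce simp: bounded_iff)
    have "\<Psi> \<eta> \<le> (\<integral>\<^sup>+h. ennreal B * indicator K h \<partial>\<mu>)"
      unfolding \<Psi>_def using inK B
      by (intro nn_integral_mono) (auto simp: indicator_def space_mu intro: ennreal_leI)
    also have "\<dots> = ennreal B * emeasure \<mu> K"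
      using \<open>compact K\<close> \<open>K \<subseteq> H\<close> by (intro nn_integral_cmult_indicator) (auto simp: sets_mu_iff borel_compact)
    also have "\<dots> < \<infinity>"
      using compact_finite[OF \<open>compact K\<close> \<open>K \<subseteq> H\<close>] by (simp add: ennreal_mult_less_top)
    finally show ?thesis .
  qed
  have pos: "\<Psi> \<eta> \<noteq> 0" if \<eta>: "\<eta> \<in> \<O>" for \<eta>
  proof
    assume "\<Psi> \<eta> = 0"
    then have "AE h in \<mu>. indicator U (transpose (matrix_inv h) *v \<eta>) * ennreal (1 / \<bar>det h\<bar>) = 0"
      unfolding \<Psi>_def by (subst (asm) nn_integral_0_iff_AE) auto
    then have ae: "AE h in \<mu>. transpose (matrix_inv h) *v \<eta> \<notin> U"
      by (rule AE_mp) (rule AE_I2, use det_nz in \<open>auto simp: indicator_def space_mu ennreal_eq_0_iff split: if_splits\<close>)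
    have "continuous_on H (\<lambda>h. transpose (matrix_inv h) *v \<eta>)"
      by (intro continuous_intros continuous_on_inv)
    then obtain V where V: "open V" "V \<inter> H = (\<lambda>h. transpose (matrix_inv h) *v \<eta>) -` U \<inter> H"
      using U(1) unfolding continuous_on_open_invariant by metis
    obtain u where "u \<in> U" using U by auto
    then have "u \<in> \<O>" using U by auto
    then obtain h where h: "h \<in> H" "u = transpose h *v \<eta>"
      using orbit_eq[OF \<eta>] by auto
    have "matrix_inv h \<in> V"
      using h \<open>u \<in> U\<close> inv_H[OF h(1)] V(2) by (auto simp: inv_inv)
    then have "emeasure \<mu> (V \<inter> H) > 0"
      using emeasure_open_pos[OF V(1)] inv_H[OF h(1)] by auto
    have "AE h in \<mu>. h \<notin> V \<inter> H"
      using ae by eventually_elim (use V(2) in auto)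
    moreover have "V \<inter> H \<in> sets \<mu>"
      using V(1) borel_H by (auto simp: sets_mu_iff)
    ultimately have "V \<inter> H \<in> null_sets \<mu>"
      by (simp add: AE_iff_null_sets)
    with \<open>emeasure \<mu> (V \<inter> H) > 0\<close> show False
      by auto
  qed
  let ?\<nu> = "density \<mu> (\<lambda>h. ennreal (1 / \<bar>det h\<bar>))"
  have sf: "sigma_finite_measure ?\<nu>"
    by (subst mu.sigma_finite_iff_density_finite) auto
  have leb: "(\<integral>\<^sup>+h. \<phi> (transpose h *v \<xi>) \<partial>\<mu>) * emeasure lborel U = (\<integral>\<^sup>+x. \<phi> x * \<Psi> x \<partial>lborel)"
    if [measurable]: "\<phi> \<in> borel_measurable borel" for \<phi>
  proof -
    have "(\<integral>\<^sup>+x. f (transpose (matrix_inv h) *v x) \<partial>lborel) = ennreal \<bar>det h\<bar> * (\<integral>\<^sup>+x. f x \<partial>lborel)"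
      if f: "f \<in> borel_measurable borel" and h: "h \<in> H" for f h
    proof -
      have "invertible (transpose (matrix_inv h))"
        using invertible_H[OF inv_H[OF h]] by (simp add: invertible_det_nz)
      from nn_integral_lborel_matrix[OF this f]
      have "(\<integral>\<^sup>+x. f x \<partial>lborel) = ennreal (1 / \<bar>det h\<bar>) * (\<integral>\<^sup>+x. f (transpose (matrix_inv h) *v x) \<partial>lborel)"
        using h by (simp add: det_inv abs_divide)
      then show ?thesis
        using det_nz[OF h] by (simp add: mult.assoc[symmetric] ennreal_mult''[symmetric])
    qed
    then show ?thesis
      using orbit_fubini[where T = "\<lambda>x. x", OF sigma_finite_lborel _ _ U_borel \<open>U \<subseteq> \<O>\<close> \<xi> that]
      by (simp add: \<Psi>_def)
  qed
  have nu: "(\<integral>\<^sup>+h. \<phi> (transpose h *v \<xi>) \<partial>\<mu>) * \<Psi> \<xi> =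
      (\<integral>\<^sup>+h. \<phi> (transpose (matrix_inv h) *v \<xi>) * \<Psi> (transpose (matrix_inv h) *v \<xi>) * ennreal (1 / \<bar>det h\<bar>) \<partial>\<mu>)"
    if [measurable]: "\<phi> \<in> borel_measurable borel" for \<phi>
  proof -
    have scale: "(\<integral>\<^sup>+g. f (transpose (matrix_inv h) *v (transpose (matrix_inv g) *v \<xi>)) \<partial>?\<nu>) =
        ennreal \<bar>det h\<bar> * (\<integral>\<^sup>+g. f (transpose (matrix_inv g) *v \<xi>) \<partial>?\<nu>)"
      if [measurable]: "f \<in> borel_measurable borel" and h: "h \<in> H" for f h
    proof -
      define F where "F g = f (transpose (matrix_inv g) *v \<xi>) * ennreal (1 / \<bar>det g\<bar>)" for g
      have [measurable]: "F \<in> borel_measurable \<mu>"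
        unfolding F_def by measurable
      have "(\<integral>\<^sup>+g. f (transpose (matrix_inv h) *v (transpose (matrix_inv g) *v \<xi>)) \<partial>?\<nu>) =
          (\<integral>\<^sup>+g. ennreal (1 / \<bar>det g\<bar>) * f (transpose (matrix_inv h) *v (transpose (matrix_inv g) *v \<xi>)) \<partial>\<mu>)"
        by (rule nn_integral_density) measurable
      also have "\<dots> = (\<integral>\<^sup>+g. ennreal \<bar>det h\<bar> * F (h ** g) \<partial>\<mu>)"
      proof (rule nn_integral_cong)
        fix g assume "g \<in> space \<mu>"
        then have g: "g \<in> H" by (simp add: space_mu)
        have "ennreal (1 / \<bar>det g\<bar>) = ennreal \<bar>det h\<bar> * ennreal (1 / \<bar>det (h ** g)\<bar>)"
          using det_nz[OF h] det_nz[OF g] by (simp add: ennreal_mult''[symmetric] det_mul abs_mult)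
        then show "ennreal (1 / \<bar>det g\<bar>) * f (transpose (matrix_inv h) *v (transpose (matrix_inv g) *v \<xi>)) =
            ennreal \<bar>det h\<bar> * F (h ** g)"
          using g h by (simp add: F_def inv_mult act_mult mult_ac)
      qed
      also have "\<dots> = ennreal \<bar>det h\<bar> * (\<integral>\<^sup>+g. F (h ** g) \<partial>\<mu>)"
        by (intro nn_integral_cmult measurable_compose[OF mult_mu[OF h]]) measurable
      also have "(\<integral>\<^sup>+g. F (h ** g) \<partial>\<mu>) = (\<integral>\<^sup>+g. F g \<partial>\<mu>)"
        by (rule nn_integral_left_invariant[OF h]) measurable
      also have "\<dots> = (\<integral>\<^sup>+g. f (transpose (matrix_inv g) *v \<xi>) \<partial>?\<nu>)"
        unfolding F_def by (subst nn_integral_density) (auto simp: mult.commute)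
      finally show ?thesis .
    qed
    have T: "(\<lambda>g. transpose (matrix_inv g) *v \<xi>) \<in> borel_measurable ?\<nu>"
      by measurable
    have "(\<integral>\<^sup>+g. indicator U (transpose (matrix_inv g) *v \<xi>) \<partial>?\<nu>) = \<Psi> \<xi>"
      unfolding \<Psi>_def by (subst nn_integral_density) (auto simp: mult.commute)
    with orbit_fubini[where T = "\<lambda>g. transpose (matrix_inv g) *v \<xi>", OF sf T scale U_borel \<open>U \<subseteq> \<O>\<close> \<xi> that]
    have "(\<integral>\<^sup>+h. \<phi> (transpose h *v \<xi>) \<partial>\<mu>) * \<Psi> \<xi> =
        (\<integral>\<^sup>+h. \<phi> (transpose (matrix_inv h) *v \<xi>) * \<Psi> (transpose (matrix_inv h) *v \<xi>) \<partial>?\<nu>)"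
      unfolding \<Psi>_def[symmetric] by simp
    also have "\<dots> = (\<integral>\<^sup>+h. ennreal (1 / \<bar>det h\<bar>) *
        (\<phi> (transpose (matrix_inv h) *v \<xi>) * \<Psi> (transpose (matrix_inv h) *v \<xi>)) \<partial>\<mu>)"
      by (rule nn_integral_density) measurable
    finally show ?thesis
      by (simp only: mult.commute)
  qed
  have xi: "\<Psi> \<xi> \<noteq> 0" "\<Psi> \<xi> < \<infinity>"
    using pos[OF \<xi>] fin[OF \<xi>] by auto
  have "emeasure lborel U < \<infinity>"
    using emeasure_bounded_finite[OF U(4)] by simp
  then have "emeasure lborel U / \<Psi> \<xi> < \<infinity>"
    using xi by (auto simp: ennreal_divide_eq_top_iff less_top[symmetric])
  moreover have "(\<integral>\<^sup>+x. G x \<partial>lborel) = emeasure lborel U / \<Psi> \<xi> *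
      (\<integral>\<^sup>+h. G (transpose (matrix_inv h) *v \<xi>) * ennreal (1 / \<bar>det h\<bar>) \<partial>\<mu>)"
    if [measurable]: "G \<in> borel_measurable borel" for G
  proof -
    define \<phi> where "\<phi> x = G x / \<Psi> x" for x
    have [measurable]: "\<phi> \<in> borel_measurable borel"
      unfolding \<phi>_def by measurable
    have \<phi>: "\<phi> x * \<Psi> x = G x" if "x \<in> \<O>" for x
      using pos[OF that] fin[OF that] by (simp add: \<phi>_def ennreal_divide_times)
    have "- \<O> \<in> null_sets lebesgue"
      using negligible_compl by (simp add: negligible_iff_null_sets)
    then have "- \<O> \<in> null_sets lborel"
      using open_O by (auto simp: null_sets_def)
    then have "AE x in lborel. x \<in> \<O>"
      by (rule AE_I'[where N = "- \<O>"]) auto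
    then have "(\<integral>\<^sup>+x. G x \<partial>lborel) = (\<integral>\<^sup>+x. \<phi> x * \<Psi> x \<partial>lborel)"
      by (intro nn_integral_cong_AE) (auto elim!: AE_mp simp: \<phi>)
    also have "\<dots> = (\<integral>\<^sup>+h. \<phi> (transpose h *v \<xi>) \<partial>\<mu>) * emeasure lborel U"
      by (rule leb[symmetric]) measurable
    also have "\<dots> = (\<integral>\<^sup>+h. \<phi> (transpose h *v \<xi>) \<partial>\<mu>) * (emeasure lborel U / \<Psi> \<xi> * \<Psi> \<xi>)"
      using xi by (simp add: ennreal_divide_times)
    also have "\<dots> = emeasure lborel U / \<Psi> \<xi> * ((\<integral>\<^sup>+h. \<phi> (transpose h *v \<xi>) \<partial>\<mu>) * \<Psi> \<xi>)"
      by (simp only: mult_ac)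
    also have "(\<integral>\<^sup>+h. \<phi> (transpose h *v \<xi>) \<partial>\<mu>) * \<Psi> \<xi> =
        (\<integral>\<^sup>+h. G (transpose (matrix_inv h) *v \<xi>) * ennreal (1 / \<bar>det h\<bar>) \<partial>\<mu>)"
      unfolding nu[OF \<open>\<phi> \<in> borel_measurable borel\<close>]
      by (intro nn_integral_cong) (auto simp: \<phi> act_O \<xi> inv_H space_mu)
    finally show ?thesis .
  qed
  ultimately show ?thesis
    by blast
qed

text \<open>With \<open>x = g\<^bsup>-T\<^esup> \<xi>\<close> the integral over \<open>x\<close> becomes one over the group. Replacing \<open>h\<close> by \<open>g ** h\<close> turns
  \<open>h\<^sup>T x\<close> into \<open>h\<^sup>T \<xi>\<close>, and submultiplicativity separates the variables.\<close>

lemma convolution_bound: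
  assumes \<xi>: "\<xi> \<in> \<O>" and [measurable]: "F \<in> borel_measurable \<mu>" "a \<in> borel_measurable borel"
    and sub: "\<And>g h. g \<in> H \<Longrightarrow> h \<in> H \<Longrightarrow> F (g ** h) \<le> F g * F h"
    and 1: "(\<integral>\<^sup>+h. F h * a (transpose h *v \<xi>) \<partial>\<mu>) < \<infinity>"
    and 2: "(\<integral>\<^sup>+h. F h * a (transpose (matrix_inv h) *v \<xi>) * ennreal (1 / \<bar>det h\<bar>) \<partial>\<mu>) < \<infinity>"
  shows "(\<integral>\<^sup>+h. F h * (\<integral>\<^sup>+x. a x * a (transpose h *v x) \<partial>lborel) \<partial>\<mu>) < \<infinity>"
proof -
  interpret P: pair_sigma_finite \<mu> \<mu> ..
  obtain C where C: "C < \<infinity>" and leb: "\<forall>G \<in> borel_measurable borel.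
    (\<integral>\<^sup>+x. G x \<partial>lborel) = C * (\<integral>\<^sup>+h. G (transpose (matrix_inv h) *v \<xi>) * ennreal (1 / \<bar>det h\<bar>) \<partial>\<mu>)"
    using orbit_integral[OF \<xi>] by blast
  define b where "b g = a (transpose (matrix_inv g) *v \<xi>) * ennreal (1 / \<bar>det g\<bar>)" for g
  have [measurable]: "b \<in> borel_measurable \<mu>"
    unfolding b_def by measurable
  have "(\<integral>\<^sup>+h. F h * (\<integral>\<^sup>+x. a x * a (transpose h *v x) \<partial>lborel) \<partial>\<mu>) =
      (\<integral>\<^sup>+h. (\<integral>\<^sup>+g. C * (F h * (b g * a (transpose h *v (transpose (matrix_inv g) *v \<xi>)))) \<partial>\<mu>) \<partial>\<mu>)"
  proof (rule nn_integral_cong)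
    fix h :: "real^'n^'n"
    have m: "(\<lambda>x. a x * a (transpose h *v x)) \<in> borel_measurable borel"
      by measurable
    have "(\<integral>\<^sup>+x. a x * a (transpose h *v x) \<partial>lborel) =
        C * (\<integral>\<^sup>+g. b g * a (transpose h *v (transpose (matrix_inv g) *v \<xi>)) \<partial>\<mu>)"
      unfolding bspec[OF leb m] b_def
      by (intro arg_cong[where f = "\<lambda>x. C * x"] nn_integral_cong) (simp only: mult_ac)
    then have "F h * (\<integral>\<^sup>+x. a x * a (transpose h *v x) \<partial>lborel) =
        (C * F h) * (\<integral>\<^sup>+g. b g * a (transpose h *v (transpose (matrix_inv g) *v \<xi>)) \<partial>\<mu>)"
      by (simp add: mult_ac)
    also have "\<dots> = (\<integral>\<^sup>+g. (C * F h) * (b g * a (transpose h *v (transpose (matrix_inv g) *v \<xi>))) \<partial>\<mu>)"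
      by (rule nn_integral_cmult[symmetric]) measurable
    finally show "F h * (\<integral>\<^sup>+x. a x * a (transpose h *v x) \<partial>lborel) =
        (\<integral>\<^sup>+g. C * (F h * (b g * a (transpose h *v (transpose (matrix_inv g) *v \<xi>)))) \<partial>\<mu>)"
      by (simp add: mult.assoc)
  qed
  also have "\<dots> = (\<integral>\<^sup>+g. (\<integral>\<^sup>+h. C * (F h * (b g * a (transpose h *v (transpose (matrix_inv g) *v \<xi>)))) \<partial>\<mu>) \<partial>\<mu>)"
    by (rule P.Fubini'[symmetric]) measurable
  also have "\<dots> \<le> (\<integral>\<^sup>+g. C * (F g * b g) * (\<integral>\<^sup>+h. F h * a (transpose h *v \<xi>) \<partial>\<mu>) \<partial>\<mu>)"
  proof (rule nn_integral_mono)
    fix g assume "g \<in> space \<mu>"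
    then have g: "g \<in> H" by (simp add: space_mu)
    define E where "E h = C * (F h * (b g * a (transpose h *v (transpose (matrix_inv g) *v \<xi>))))" for h
    have [measurable]: "E \<in> borel_measurable \<mu>"
      unfolding E_def by measurable
    have "(\<integral>\<^sup>+h. E h \<partial>\<mu>) = (\<integral>\<^sup>+h. E (g ** h) \<partial>\<mu>)"
      by (rule nn_integral_left_invariant[OF g, symmetric]) measurable
    also have "\<dots> \<le> (\<integral>\<^sup>+h. C * (F g * b g) * (F h * a (transpose h *v \<xi>)) \<partial>\<mu>)"
    proof (rule nn_integral_mono)
      fix h assume "h \<in> space \<mu>"
      then have h: "h \<in> H" by (simp add: space_mu)
      have "E (g ** h) = C * (F (g ** h) * (b g * a (transpose h *v \<xi>)))"
        using g by (simp add: E_def act_mult act_inv)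
      also have "\<dots> \<le> C * ((F g * F h) * (b g * a (transpose h *v \<xi>)))"
        by (intro mult_left_mono mult_right_mono sub g h) auto
      finally show "E (g ** h) \<le> C * (F g * b g) * (F h * a (transpose h *v \<xi>))"
        by (simp add: mult_ac)
    qed
    also have "\<dots> = C * (F g * b g) * (\<integral>\<^sup>+h. F h * a (transpose h *v \<xi>) \<partial>\<mu>)"
      by (rule nn_integral_cmult) measurable
    finally show "(\<integral>\<^sup>+h. C * (F h * (b g * a (transpose h *v (transpose (matrix_inv g) *v \<xi>)))) \<partial>\<mu>)
      \<le> C * (F g * b g) * (\<integral>\<^sup>+h. F h * a (transpose h *v \<xi>) \<partial>\<mu>)"
      by (simp add: E_def)
  qed
  also have "\<dots> = C * (\<integral>\<^sup>+g. F g * b g \<partial>\<mu>) * (\<integral>\<^sup>+h. F h * a (transpose h *v \<xi>) \<partial>\<mu>)"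
    by (simp add: nn_integral_multc nn_integral_cmult)
  also have "\<dots> < \<infinity>"
    using C 1 2 by (auto simp: b_def ennreal_mult_less_top mult.assoc)
  finally show ?thesis .
qed

end

section \<open>Tangent directions and a polynomial vanishing off the orbit\<close>

lemma transpose_diff: "transpose (A - B) = transpose A - transpose (B :: real^'n^'m)"
  and transpose_scaleR: "transpose (c *\<^sub>R A) = c *\<^sub>R transpose (A :: real^'n^'m)"
  and transpose_uminus: "transpose (- A) = - transpose (A :: real^'n^'m)"
  by (simp_all add: transpose_def vec_eq_iff)

definition mpow :: "real^'n^'n \<Rightarrow> nat \<Rightarrow> real^'n^'n" where
  "mpow A n = ((**) A ^^ n) (mat 1)"

lemma mpow_0 [simp]: "mpow A 0 = mat 1"
  by (simp add: mpow_def)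

lemma mpow_Suc: "mpow A (Suc n) = A ** mpow A n"
  by (simp add: mpow_def)

text \<open>In the binomial expansion of \<open>(1 + (k - 1))\<^sup>p\<close> every term is dominated by the corresponding one
  of \<open>(1 + a)\<^sup>p\<close>.\<close>

lemma mpow_estimates:
  fixes k :: "real^'n^'n"
  defines "a \<equiv> norm (k - mat 1)"
  shows "norm (mpow k p - mat 1) \<le> (1 + a) ^ p - 1"
    and "norm (mpow k p - mat 1 - real p *\<^sub>R (k - mat 1)) \<le> (1 + a) ^ p - 1 - real p * a"
proof (induction p)
  case (Suc p)
  define B where "B = k - mat 1"
  define E where "E = mpow k p - mat 1"
  have k: "k = mat 1 + B" "mpow k p = mat 1 + E" and a: "a = norm B"
    by (simp_all add: B_def E_def a_def)
  have eq: "mpow k (Suc p) = mat 1 + B + E + B ** E"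
    by (simp add: mpow_Suc k(2)) (simp add: k(1) matrix_add_ldistrib bounded_bilinear.add_left[OF bounded_bilinear_matrix_mult])
  have E: "norm E \<le> (1 + a) ^ p - 1"
    using Suc(1) by (simp add: E_def)
  have BE: "norm (B ** E) \<le> a * ((1 + a) ^ p - 1)"
    using norm_matrix_mult_le[of B E] mult_left_mono[OF E, of a] a by simp
  {
    case 1
    have "norm (B + E + B ** E) \<le> a + ((1 + a) ^ p - 1) + a * ((1 + a) ^ p - 1)"
      using norm_triangle_mono[OF norm_triangle_mono[OF _ E] BE, of B a] a by simp
    then show ?case
      by (simp add: eq algebra_simps)
  next
    case 2
    have "norm ((E - real p *\<^sub>R B) + B ** E) \<le> ((1 + a) ^ p - 1 - real p * a) + a * ((1 + a) ^ p - 1)"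
      using Suc(2) BE by (intro norm_triangle_mono) (simp_all add: E_def B_def)
    then show ?case
      by (simp add: eq B_def[symmetric] algebra_simps)
  }
qed auto

lemma mpow_bounds:
  fixes k :: "real^'n^'n"
  assumes pt: "real p * norm (k - mat 1) \<le> t" and t: "t \<le> 1"
  shows "norm (mpow k p - mat 1) \<le> 2 * t"
    and "norm (mpow k p - mat 1 - real p *\<^sub>R (k - mat 1)) \<le> t\<^sup>2"
proof -
  define a where "a = norm (k - mat 1)"
  have a: "0 \<le> a" "real p * a \<le> t"
    using pt by (auto simp: a_def)
  then have t0: "0 \<le> t"
    by (meson mult_nonneg_nonneg of_nat_0_le_iff order_trans)
  have "(1 + a) ^ p \<le> exp a ^ p"
    using a by (intro power_mono exp_ge_add_one_self) auto
  also have "\<dots> = exp (real p * a)"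
    by (simp add: exp_of_nat_mult)
  finally have 1: "(1 + a) ^ p \<le> exp (real p * a)" .
  have 2: "exp (real p * a) \<le> 1 + real p * a + (real p * a)\<^sup>2"
    using a t by (intro exp_bound) auto
  have 3: "(real p * a)\<^sup>2 \<le> t\<^sup>2"
    using a by (intro power_mono) auto
  have 4: "t\<^sup>2 \<le> t"
    using t t0 by (simp add: power2_eq_square mult_left_le)
  show "norm (mpow k p - mat 1) \<le> 2 * t"
    using mpow_estimates(1)[of k p] 1 2 3 4 a(2) by (simp add: a_def)
  show "norm (mpow k p - mat 1 - real p *\<^sub>R (k - mat 1)) \<le> t\<^sup>2"
    using mpow_estimates(2)[of k p] 1 2 3 by (simp add: a_def)
qed

text \<open>Telescoping: as long as the powers of \<open>k\<close> stay bounded, each further factor displaces \<open>\<xi>\<close> by a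
  bounded multiple of the displacement by \<open>k\<close>.\<close>

lemma mpow_fixes_approximately:
  fixes k :: "real^'n^'n"
  assumes "real p * norm (k - mat 1) \<le> 1"
  shows "norm (transpose (mpow k p) *v \<xi> - \<xi>) \<le> 3 * real p * norm (transpose k *v \<xi> - \<xi>)"
  using assms
proof (induction p)
  case (Suc p)
  define \<delta> where "\<delta> = transpose k *v \<xi> - \<xi>"
  have p: "real p * norm (k - mat 1) \<le> 1"
    using Suc.prems by (simp add: algebra_simps) (smt (verit) norm_ge_zero)
  have "norm (transpose (mpow k p - mat 1) *v \<delta>) \<le> 2 * norm \<delta>"
    using norm_matrix_vector_mult_le[of "transpose (mpow k p - mat 1)" \<delta>] mult_right_mono[OF mpow_bounds(1)[OF p], of "norm \<delta>"] by simp
  moreover have "transpose (mpow k p) *v \<delta> = transpose (mpow k p - mat 1) *v \<delta> + \<delta>"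
    by (simp add: transpose_diff matrix_vector_mult_diff_rdistrib)
  ultimately have d: "norm (transpose (mpow k p) *v \<delta>) \<le> 3 * norm \<delta>"
    using norm_triangle_ineq[of "transpose (mpow k p - mat 1) *v \<delta>" \<delta>] by simp
  have "transpose (mpow k (Suc p)) *v \<xi> = transpose (mpow k p) *v (transpose k *v \<xi>)"
    by (simp add: mpow_Suc matrix_transpose_mul matrix_vector_mul_assoc)
  also have "transpose k *v \<xi> = \<delta> + \<xi>"
    by (simp add: \<delta>_def)
  finally have "transpose (mpow k (Suc p)) *v \<xi> - \<xi> =
      transpose (mpow k p) *v \<delta> + (transpose (mpow k p) *v \<xi> - \<xi>)"
    by (simp add: matrix_vector_right_distrib)
  also have "norm \<dots> \<le> 3 * norm \<delta> + 3 * real p * norm \<delta>"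
    using d Suc.IH[OF p] unfolding \<delta>_def[symmetric] by (intro norm_triangle_mono)
  finally show ?case
    by (simp add: \<delta>_def algebra_simps)
qed simp

lemma invertible_near_one:
  fixes s :: "real^'n^'n"
  assumes "norm (s - mat 1) < 1"
  shows "invertible s"
proof -
  have "x = 0" if "s *v x = 0" for x
  proof (rule ccontr)
    assume "x \<noteq> 0"
    have "norm ((s - mat 1) *v x) \<le> norm (s - mat 1) * norm x"
      by (rule norm_matrix_vector_mult_le)
    also have "(s - mat 1) *v x = - x"
      using that by (simp add: matrix_vector_mult_diff_rdistrib)
    finally show False
      using assms \<open>x \<noteq> 0\<close> by simp
  qed
  then show ?thesis
    by (simp add: invertible_left_inverse matrix_left_invertible_ker)
qed

context linear_group
begin

lemma mpow_H: "k \<in> H \<Longrightarrow> mpow k p \<in> H"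
  by (induction p) (auto simp: mpow_Suc one_H mult_H)

text \<open>Powers of group elements near the identity follow the one-parameter subgroup generated by
  a limit direction; since the group is closed, it contains points near that subgroup for
  all small parameters and not only for those of the given sequence.\<close>

lemma one_parameter_approximation:
  assumes k: "\<And>n. k n \<in> H" and a: "\<And>n. a n = norm (k n - mat 1)" "\<And>n. a n > 0" "a \<longlonglongrightarrow> 0"
    and X: "(\<lambda>n. (k n - mat 1) /\<^sub>R a n) \<longlonglongrightarrow> X"
    and fixed: "(\<lambda>n. (transpose (k n) *v \<xi> - \<xi>) /\<^sub>R a n) \<longlonglongrightarrow> 0"
    and t: "0 < t" "t \<le> 1/4"
  obtains s where "s \<in> H" "transpose s *v \<xi> = \<xi>" "norm (s - mat 1 - t *\<^sub>R X) \<le> t\<^sup>2"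
proof -
  \<comment> \<open>the number of steps of length \<open>a n\<close> that are needed to reach the parameter \<open>t\<close>\<close>
  define p where "p n = nat \<lfloor>t / a n\<rfloor>" for n
  have p: "real (p n) * a n \<le> t" "t - a n \<le> real (p n) * a n" for n
  proof -
    have "real (p n) \<le> t / a n" "t / a n - 1 \<le> real (p n)"
      using t a(2)[of n] unfolding p_def by (auto simp: of_nat_nat)
    then show "real (p n) * a n \<le> t" "t - a n \<le> real (p n) * a n"
      using a(2)[of n] by (simp_all add: field_simps)
  qed
  have pa: "(\<lambda>n. real (p n) * a n) \<longlonglongrightarrow> t"
  proof (rule tendsto_sandwich)
    show "(\<lambda>n. t - a n) \<longlonglongrightarrow> t"
      using tendsto_diff[OF tendsto_const a(3), of t] by simp
  qed (use p in auto)
  define m where "m n = mpow (k n) (p n)" for n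
  have b1: "norm (m n - mat 1) \<le> 2 * t"
    and b2: "norm (m n - mat 1 - real (p n) *\<^sub>R (k n - mat 1)) \<le> t\<^sup>2" for n
    using mpow_bounds[of "p n" "k n" t] p[of n] t by (simp_all add: m_def a(1))
  have "norm (m n) \<le> 2 * t + norm (mat 1 :: real^'n^'n)" for n
    using b1[of n] norm_triangle_sub[of "m n" "mat 1"] by simp
  then have "bounded (range m)"
    by (auto simp: bounded_iff)
  then obtain s r where r: "strict_mono r" and s: "(m \<circ> r) \<longlonglongrightarrow> s"
    using bounded_imp_convergent_subsequence[of m] by auto
  have sub: "f \<longlonglongrightarrow> l \<Longrightarrow> (\<lambda>n. f (r n)) \<longlonglongrightarrow> l" for f :: "nat \<Rightarrow> 'z::topological_space" and l
    using LIMSEQ_subseq_LIMSEQ[OF _ r] by (simp add: o_def)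
  have s: "(\<lambda>n. m (r n)) \<longlonglongrightarrow> s"
    using s by (simp add: o_def)
  have "norm (s - mat 1) \<le> 2 * t"
    using b1 by (intro tendsto_upperbound[OF tendsto_norm[OF tendsto_diff[OF s tendsto_const]]]) auto
  then have "invertible s"
    using t by (intro invertible_near_one) simp
  then have "s \<in> H"
    using closed_H[of "\<lambda>n. m (r n)" s] mpow_H k s by (simp add: m_def)
  moreover have "transpose s *v \<xi> = \<xi>"
  proof -
    have "(\<lambda>n. 3 * (real (p n) * a n) * norm ((transpose (k n) *v \<xi> - \<xi>) /\<^sub>R a n)) \<longlonglongrightarrow> 3 * t * norm (0::real^'n)"
      by (intro tendsto_intros pa fixed)
    moreover have "3 * (real (p n) * a n) * norm ((transpose (k n) *v \<xi> - \<xi>) /\<^sub>R a n) =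
        3 * real (p n) * norm (transpose (k n) *v \<xi> - \<xi>)" for n
      using a(2)[of n] by simp
    ultimately have lim: "(\<lambda>n. 3 * real (p n) * norm (transpose (k n) *v \<xi> - \<xi>)) \<longlonglongrightarrow> 0"
      by (simp only: norm_zero mult_zero_right)
    have "(\<lambda>n. transpose (m n) *v \<xi> - \<xi>) \<longlonglongrightarrow> 0"
    proof (rule Lim_null_comparison[OF _ lim])
      show "\<forall>\<^sub>F n in sequentially. norm (transpose (m n) *v \<xi> - \<xi>) \<le> 3 * real (p n) * norm (transpose (k n) *v \<xi> - \<xi>)"
      proof (rule always_eventually, rule allI)
        fix n
        have "real (p n) * norm (k n - mat 1) \<le> 1"
          using p(1)[of n] t by (simp add: a(1))
        then show "norm (transpose (m n) *v \<xi> - \<xi>) \<le> 3 * real (p n) * norm (transpose (k n) *v \<xi> - \<xi>)"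
          unfolding m_def by (rule mpow_fixes_approximately)
      qed
    qed
    then have "(\<lambda>n. transpose (m (r n)) *v \<xi> - \<xi>) \<longlonglongrightarrow> 0"
      by (rule sub)
    moreover have "(\<lambda>n. transpose (m (r n)) *v \<xi> - \<xi>) \<longlonglongrightarrow> transpose s *v \<xi> - \<xi>"
      by (intro tendsto_intros s)
    ultimately have "transpose s *v \<xi> - \<xi> = 0"
      by (rule LIMSEQ_unique[rotated])
    then show ?thesis by simp
  qed
  moreover have "norm (s - mat 1 - t *\<^sub>R X) \<le> t\<^sup>2"
  proof -
    have "(\<lambda>n. (real (p n) * a n) *\<^sub>R ((k n - mat 1) /\<^sub>R a n)) \<longlonglongrightarrow> t *\<^sub>R X"
      by (intro tendsto_intros pa X)
    moreover have "(real (p n) * a n) *\<^sub>R ((k n - mat 1) /\<^sub>R a n) = real (p n) *\<^sub>R (k n - mat 1)" for n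
      using a(2)[of n] by simp
    ultimately have "(\<lambda>n. real (p n) *\<^sub>R (k n - mat 1)) \<longlonglongrightarrow> t *\<^sub>R X"
      by (simp only:)
    from sub[OF this] have "(\<lambda>n. m (r n) - mat 1 - real (p (r n)) *\<^sub>R (k (r n) - mat 1)) \<longlonglongrightarrow> s - mat 1 - t *\<^sub>R X"
      by (intro tendsto_diff tendsto_const s)
    then show ?thesis
      using b2 by (intro tendsto_upperbound[OF tendsto_norm]) auto
  qed
  ultimately show ?thesis
    using that by blast
qed

text \<open>Limit directions of group elements at the identity; for a closed group these are the elements
  of its Lie algebra.\<close>

definition tangent :: "real^'n^'n \<Rightarrow> bool" where
  "tangent X \<longleftrightarrow> (\<exists>f e. (\<forall>n. f n \<in> H) \<and> (\<forall>n::nat. e n > (0::real)) \<and> e \<longlonglongrightarrow> 0 \<and>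
     (\<lambda>n. (f n - mat 1) /\<^sub>R e n) \<longlonglongrightarrow> X)"

lemma tendsto_one:
  assumes "\<And>n. e n > (0::real)" "e \<longlonglongrightarrow> 0" "(\<lambda>n. (f n - mat 1) /\<^sub>R e n) \<longlonglongrightarrow> (X::real^'n^'n)"
  shows "f \<longlonglongrightarrow> mat 1"
proof -
  have "(\<lambda>n. e n *\<^sub>R ((f n - mat 1) /\<^sub>R e n) + mat 1) \<longlonglongrightarrow> 0 *\<^sub>R X + mat 1"
    by (intro tendsto_intros assms)
  then show ?thesis
    using assms(1) by (simp add: less_imp_neq[symmetric])
qed

lemma tangent_uminus:
  assumes "tangent X"
  shows "tangent (- X)"
proof -
  obtain f e where fe: "(\<forall>n. f n \<in> H) \<and> (\<forall>n::nat. e n > (0::real)) \<and> e \<longlonglongrightarrow> 0 \<and>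
      (\<lambda>n. (f n - mat 1) /\<^sub>R e n) \<longlonglongrightarrow> X"
    using assms unfolding tangent_def by blast
  then have f: "f n \<in> H" and e: "e n > 0" "e \<longlonglongrightarrow> 0"
    and X: "(\<lambda>n. (f n - mat 1) /\<^sub>R e n) \<longlonglongrightarrow> X" for n
    by auto
  have f1: "f \<longlonglongrightarrow> mat 1"
    by (rule tendsto_one[OF e X])
  have "(\<lambda>n. matrix_inv (f n)) \<longlonglongrightarrow> matrix_inv (mat 1)"
    using continuous_on_tendsto_compose[OF continuous_on_inv f1 one_H] f by simp
  moreover have "matrix_inv (mat 1) = (mat 1 :: real^'n^'n)"
    by (rule matrix_inv_eqI) simp
  ultimately have inv: "(\<lambda>n. matrix_inv (f n)) \<longlonglongrightarrow> mat 1"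
    by simp
  have "(\<lambda>n. - (matrix_inv (f n) ** ((f n - mat 1) /\<^sub>R e n))) \<longlonglongrightarrow> - (mat 1 ** X)"
    by (intro tendsto_intros inv X)
  moreover have "- (matrix_inv (f n) ** ((f n - mat 1) /\<^sub>R e n)) = (matrix_inv (f n) - mat 1) /\<^sub>R e n" for n
    using inv_left[OF f[of n]]
    by (simp add: bounded_bilinear.scaleR_right[OF bounded_bilinear_matrix_mult]
       bounded_bilinear.diff_right[OF bounded_bilinear_matrix_mult] scaleR_diff_right)
  ultimately have "(\<lambda>n. (matrix_inv (f n) - mat 1) /\<^sub>R e n) \<longlonglongrightarrow> - X"
    by simp
  then show ?thesis
    unfolding tangent_def using inv_H[OF f] e by (intro exI[of _ "\<lambda>n. matrix_inv (f n)"] exI[of _ e]) auto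
qed

end

context orbit_group
begin

text \<open>Translation by a group element moves the open set of the previous properness statement to \<open>\<xi>\<close>.\<close>

lemma proper_at_point:
  assumes \<xi>: "\<xi> \<in> \<O>"
  obtains V C where "open V" "\<xi> \<in> V" "V \<subseteq> \<O>" "compact C" "C \<subseteq> H"
    "\<And>h. h \<in> H \<Longrightarrow> transpose h *v \<xi> \<in> V \<Longrightarrow> h \<in> C"
proof -
  obtain U C where U: "open U" "U \<noteq> {}" "U \<subseteq> \<O>" and C: "compact C" "C \<subseteq> H"
    and UC: "\<And>h. h \<in> H \<Longrightarrow> transpose h *v \<xi> \<in> U \<Longrightarrow> h \<in> C"
    using proper_over_open_set[OF \<xi>] by metis
  obtain k where k: "k \<in> H" "transpose k *v \<xi> \<in> U"
    using U orbit_eq[OF \<xi>] by blast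
  define V where "V = (\<lambda>x. transpose k *v x) -` U"
  have "open V"
    unfolding V_def using U by (intro open_vimage continuous_intros)
  moreover have "\<xi> \<in> V"
    using k by (simp add: V_def)
  moreover have "V \<subseteq> \<O>"
    using act_not_O k U by (auto simp: V_def)
  moreover have "compact ((\<lambda>c. c ** matrix_inv k) ` C)"
    by (intro compact_continuous_image C continuous_intros)
  moreover have "(\<lambda>c. c ** matrix_inv k) ` C \<subseteq> H"
    using C k by (auto intro!: mult_H inv_H)
  moreover have "h \<in> (\<lambda>c. c ** matrix_inv k) ` C" if "h \<in> H" "transpose h *v \<xi> \<in> V" for h
  proof (rule image_eqI)
    show "h = (h ** k) ** matrix_inv k"
      by (simp add: matrix_mul_assoc[symmetric] inv_right k)
    show "h ** k \<in> C"
      using that k by (intro UC) (auto simp: V_def act_mult mult_H)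
  qed
  ultimately show ?thesis
    using that by blast
qed

text \<open>Points \<open>\<xi> + u / n\<close> are reached from \<open>\<xi>\<close> by group elements; take those closest to the
  identity. A limit direction of these elements maps \<open>\<xi>\<close> to a multiple of \<open>u\<close>. If the multiple
  were zero, this direction would be tangent to the stabiliser, and elements of the
  stabiliser could be used to come closer to the identity.\<close>

lemma tangent_surj:
  assumes \<xi>: "\<xi> \<in> \<O>" and u: "u \<noteq> 0"
  shows "\<exists>X. tangent X \<and> transpose X *v \<xi> = u"
proof -
  obtain V C where V: "open V" "\<xi> \<in> V" "V \<subseteq> \<O>" and C: "compact C" "C \<subseteq> H"
    and VC: "\<And>h. h \<in> H \<Longrightarrow> transpose h *v \<xi> \<in> V \<Longrightarrow> h \<in> C"
    using proper_at_point[OF \<xi>] by metis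
  define \<epsilon> where "\<epsilon> n = 1 / real (Suc n)" for n
  have \<epsilon>: "\<epsilon> n > 0" "\<epsilon> \<longlonglongrightarrow> 0" for n
    using LIMSEQ_inverse_real_of_nat by (simp_all add: \<epsilon>_def[abs_def] inverse_eq_divide)
  have "(\<lambda>n. \<xi> + \<epsilon> n *\<^sub>R u) \<longlonglongrightarrow> \<xi> + 0 *\<^sub>R u"
    by (intro tendsto_intros \<epsilon>)
  then have "\<forall>\<^sub>F n in sequentially. \<xi> + \<epsilon> n *\<^sub>R u \<in> V"
    using V topological_tendstoD by fastforce
  then obtain N where N: "\<And>n. n \<ge> N \<Longrightarrow> \<xi> + \<epsilon> n *\<^sub>R u \<in> V"
    by (auto simp: eventually_sequentially)
  define x where "x n = \<xi> + \<epsilon> (n + N) *\<^sub>R u" for n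
  define T where "T n = {h \<in> H. transpose h *v \<xi> = x n}" for n
  have xV: "x n \<in> V" for n
    using N by (simp add: x_def)
  have "\<exists>h\<in>T n. \<forall>g\<in>T n. norm (h - mat 1) \<le> norm (g - mat 1)" for n
  proof (rule continuous_attains_inf)
    have "T n = C \<inter> {h. transpose h *v \<xi> = x n}"
      using C VC xV[of n] by (auto simp: T_def)
    moreover have "closed {h. transpose h *v \<xi> = x n}"
      by (intro closed_Collect_eq continuous_intros)
    ultimately show "compact (T n)"
      using C by auto
    show "T n \<noteq> {}"
    proof -
      have "x n \<in> (\<lambda>h. transpose h *v \<xi>) ` H"
        using xV[of n] V(3) orbit_eq[OF \<xi>] by blast
      then show ?thesis
        by (auto simp: T_def)
    qed
  qed (intro continuous_intros)
  then obtain h where hT: "\<And>n. h n \<in> T n" and hmin: "\<And>n g. g \<in> T n \<Longrightarrow> norm (h n - mat 1) \<le> norm (g - mat 1)"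
    by metis
  have hC: "h n \<in> C" for n
    using VC hT xV by (auto simp: T_def)
  obtain l r where l: "l \<in> C" and r: "strict_mono r" and hl: "(h \<circ> r) \<longlonglongrightarrow> l"
    using C(1) hC unfolding compact_eq_seq_compact_metric seq_compact_def by metis
  have lH: "l \<in> H" using l C by auto
  have \<epsilon>r: "(\<lambda>n. \<epsilon> (r n + N)) \<longlonglongrightarrow> 0"
    using LIMSEQ_subseq_LIMSEQ[OF LIMSEQ_ignore_initial_segment[OF \<epsilon>(2), of N] r] by (simp add: o_def)
  have hx: "transpose (h n) *v \<xi> = x n" "h n \<in> H" for n
    using hT[of n] by (auto simp: T_def)
  have "(\<lambda>n. transpose (h (r n)) *v \<xi>) \<longlonglongrightarrow> transpose l *v \<xi>"
    using hl by (intro tendsto_intros) (simp add: o_def)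
  moreover have "(\<lambda>n. transpose (h (r n)) *v \<xi>) \<longlonglongrightarrow> \<xi> + 0 *\<^sub>R u"
    unfolding hx x_def by (intro tendsto_intros \<epsilon>r)
  ultimately have lfix: "transpose l *v \<xi> = \<xi>"
    using LIMSEQ_unique by fastforce
  have near: "(\<lambda>n. norm (h (r n) - mat 1)) \<longlonglongrightarrow> 0"
  proof (rule Lim_null_comparison)
    have "(\<lambda>n. matrix_inv l ** h (r n) - mat 1) \<longlonglongrightarrow> matrix_inv l ** l - mat 1"
      using hl by (intro tendsto_intros) (simp add: o_def)
    then show "(\<lambda>n. norm (matrix_inv l ** h (r n) - mat 1)) \<longlonglongrightarrow> 0"
      by (simp add: inv_left lH tendsto_norm_zero)
    have "transpose (matrix_inv l) *v \<xi> = \<xi>"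
      using act_inv'[OF lH, of \<xi>] by (simp add: lfix)
    then have "matrix_inv l ** h n \<in> T n" for n
      using hT[of n] lH by (auto simp: T_def act_mult intro!: mult_H inv_H)
    then show "\<forall>\<^sub>F n in sequentially. norm (norm (h (r n) - mat 1)) \<le> norm (matrix_inv l ** h (r n) - mat 1)"
      using hmin by simp
  qed
  define Y where "Y n = (h (r n) - mat 1) /\<^sub>R norm (h (r n) - mat 1)" for n
  have "norm (Y n) \<le> 1" for n
    by (cases "h (r n) = mat 1") (simp_all add: Y_def)
  then have "bounded (range Y)"
    by (auto simp: bounded_iff)
  then obtain X q where q: "strict_mono q" and YX: "(Y \<circ> q) \<longlonglongrightarrow> X"
    using bounded_imp_convergent_subsequence[of Y] by auto
  define k where "k n = h (r (q n))" for n
  define a where "a n = norm (k n - mat 1)" for n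
  define e where "e n = \<epsilon> (r (q n) + N)" for n
  have kH: "k n \<in> H" for n
    by (simp add: k_def hx)
  have k\<xi>: "transpose (k n) *v \<xi> = \<xi> + e n *\<^sub>R u" for n
    by (simp add: k_def hx x_def e_def)
  have e0: "e n > 0" for n
    by (simp add: e_def \<epsilon>)
  have a0: "a n > 0" for n
    using k\<xi>[of n] e0[of n] u by (auto simp: a_def)
  have alim: "a \<longlonglongrightarrow> 0"
    using LIMSEQ_subseq_LIMSEQ[OF near q] by (simp add: o_def a_def[abs_def] k_def)
  have X: "(\<lambda>n. (k n - mat 1) /\<^sub>R a n) \<longlonglongrightarrow> X"
    using YX by (simp add: o_def Y_def k_def a_def)
  have kmin: "a n \<le> norm (g - mat 1)" if "g \<in> H" "transpose g *v \<xi> = transpose (k n) *v \<xi>" for g n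
    unfolding a_def k_def using that by (intro hmin) (simp add: T_def k_def hx)
  have quot: "transpose ((k n - mat 1) /\<^sub>R a n) *v \<xi> = (transpose (k n) *v \<xi> - \<xi>) /\<^sub>R a n" for n
    by (simp add: transpose_diff transpose_scaleR
       matrix_vector_mult_diff_rdistrib bounded_bilinear.scaleR_left[OF bounded_bilinear_matrix_vector])
  have Xlim: "(\<lambda>n. (transpose (k n) *v \<xi> - \<xi>) /\<^sub>R a n) \<longlonglongrightarrow> transpose X *v \<xi>"
    unfolding quot[symmetric] by (intro tendsto_intros X)
  have eq: "(transpose (k n) *v \<xi> - \<xi>) /\<^sub>R a n = (e n / a n) *\<^sub>R u" for n
    by (simp add: k\<xi> divide_inverse mult.commute)
  define c where "c = ((transpose X *v \<xi>) \<bullet> u) / (u \<bullet> u)"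
  have "(\<lambda>n. ((e n / a n) *\<^sub>R u) \<bullet> u / (u \<bullet> u)) \<longlonglongrightarrow> c"
    unfolding c_def using u Xlim by (intro tendsto_intros) (auto simp: eq)
  then have clim: "(\<lambda>n. e n / a n) \<longlonglongrightarrow> c"
    using u by simp
  then have c0: "c \<ge> 0"
    using e0 a0 by (intro LIMSEQ_le_const[OF clim]) (auto simp: less_imp_le)
  have "(\<lambda>n. (e n / a n) *\<^sub>R u) \<longlonglongrightarrow> c *\<^sub>R u"
    by (intro tendsto_intros clim)
  then have Xc: "transpose X *v \<xi> = c *\<^sub>R u"
    using LIMSEQ_unique[OF Xlim] by (simp add: eq)
  \<comment> \<open>otherwise some \<open>s\<close> in the stabiliser agrees with \<open>k n\<close> to first order, and \<open>matrix_inv s ** k n\<close> is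
    an element with the same value at \<open>\<xi>\<close> that is closer to the identity\<close>
  have "c \<noteq> 0"
  proof
    assume "c = 0"
    then have fixed: "(\<lambda>n. (transpose (k n) *v \<xi> - \<xi>) /\<^sub>R a n) \<longlonglongrightarrow> 0"
      using Xlim Xc by simp
    define S where "S = dual_stabilizer H \<xi>"
    have "compact S" "S \<subseteq> H"
      using orbit \<xi> by (auto simp: S_def open_dual_orbit_def dual_stabilizer_def)
    then have "compact (matrix_inv ` S)"
      by (intro compact_continuous_image continuous_on_subset[OF continuous_on_inv])
    then obtain M where M: "\<And>s. s \<in> S \<Longrightarrow> norm (matrix_inv s) \<le> M"
      using compact_imp_bounded bounded_iff by (metis imageI)
    have "1 \<le> M * (norm ((k n - mat 1) /\<^sub>R a n - X) + a n)" if small: "a n \<le> 1/4" for n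
    proof -
      obtain s where s: "s \<in> H" "transpose s *v \<xi> = \<xi>" "norm (s - mat 1 - a n *\<^sub>R X) \<le> (a n)\<^sup>2"
        using one_parameter_approximation[OF kH a_def a0 alim X fixed a0 small] by metis
      then have "s \<in> S" by (simp add: S_def dual_stabilizer_def)
      have "transpose (matrix_inv s) *v \<xi> = \<xi>"
        using act_inv'[OF s(1), of \<xi>] by (simp add: s)
      then have "a n \<le> norm (matrix_inv s ** k n - mat 1)"
        using s kH by (intro kmin) (auto simp: act_mult intro!: mult_H inv_H)
      also have "matrix_inv s ** k n - mat 1 = matrix_inv s ** (k n - s)"
        using s by (simp add: bounded_bilinear.diff_right[OF bounded_bilinear_matrix_mult] inv_left)
      also have "norm \<dots> \<le> norm (matrix_inv s) * norm (k n - s)"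
        by (rule norm_matrix_mult_le)
      also have "\<dots> \<le> M * norm (k n - s)"
        by (intro mult_right_mono M \<open>s \<in> S\<close>) auto
      also have "norm (k n - s) \<le> a n * norm ((k n - mat 1) /\<^sub>R a n - X) + (a n)\<^sup>2"
      proof -
        have "k n - s = a n *\<^sub>R ((k n - mat 1) /\<^sub>R a n - X) - (s - mat 1 - a n *\<^sub>R X)"
          using a0[of n] by (simp add: scaleR_diff_right)
        then have "norm (k n - s) \<le> norm (a n *\<^sub>R ((k n - mat 1) /\<^sub>R a n - X)) + norm (s - mat 1 - a n *\<^sub>R X)"
          using norm_triangle_ineq4 by metis
        also have "norm (a n *\<^sub>R ((k n - mat 1) /\<^sub>R a n - X)) = a n * norm ((k n - mat 1) /\<^sub>R a n - X)"
          using a0[of n] by simp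
        finally show ?thesis
          using s(3) by linarith
      qed
      finally have "a n \<le> M * (a n * norm ((k n - mat 1) /\<^sub>R a n - X) + (a n)\<^sup>2)"
        using M[OF \<open>s \<in> S\<close>] by (smt (verit) mult_left_mono norm_ge_zero)
      also have "\<dots> = a n * (M * (norm ((k n - mat 1) /\<^sub>R a n - X) + a n))"
        by (simp add: algebra_simps power2_eq_square)
      finally show ?thesis
        using a0[of n] by simp
    qed
    note ge1 = this
    have "(\<lambda>n. M * (norm ((k n - mat 1) /\<^sub>R a n - X) + a n)) \<longlonglongrightarrow> M * (norm (X - X) + 0)"
      by (intro tendsto_intros X alim)
    then have "\<forall>\<^sub>F n in sequentially. M * (norm ((k n - mat 1) /\<^sub>R a n - X) + a n) < 1"
      by (rule order_tendstoD) simp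
    moreover have "\<forall>\<^sub>F n in sequentially. a n < 1/4"
      by (rule order_tendstoD[OF alim]) simp
    ultimately have "\<forall>\<^sub>F n in sequentially. False"
    proof eventually_elim
      case (elim n)
      then show False
        using ge1[of n] by linarith
    qed
    then show False
      by simp
  qed
  then have "c > 0" using c0 by simp
  have "tangent (X /\<^sub>R c)"
    unfolding tangent_def
  proof (intro exI conjI allI)
    show "k n \<in> H" for n by (rule kH)
    show "a n * c > 0" for n using a0 \<open>c > 0\<close> by simp
    show "(\<lambda>n. a n * c) \<longlonglongrightarrow> 0"
      using tendsto_mult_right[OF alim, of c] by simp
    have "(\<lambda>n. ((k n - mat 1) /\<^sub>R a n) /\<^sub>R c) \<longlonglongrightarrow> X /\<^sub>R c"
      by (intro tendsto_intros X)
    then show "(\<lambda>n. (k n - mat 1) /\<^sub>R (a n * c)) \<longlonglongrightarrow> X /\<^sub>R c"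
      by (simp add: mult.commute)
  qed
  moreover have "transpose (X /\<^sub>R c) *v \<xi> = u"
    using \<open>c > 0\<close> Xc by (simp add: transpose_scaleR
      bounded_bilinear.scaleR_left[OF bounded_bilinear_matrix_vector])
  ultimately show ?thesis by blast
qed

text \<open>The complement of the orbit is closed and invariant. Its distance to a point is
  attained in a direction that is orthogonal to all tangent vectors; near a point where the
  tangent vectors span, it would have to be a neighbourhood.\<close>

lemma tangent_det_zero:
  assumes X: "\<And>i. tangent (X i)" and z0: "z0 \<notin> \<O>"
  shows "det (\<chi> i. transpose (X i) *v z0) = 0"
proof (rule ccontr)
  define D where "D z = det (\<chi> i. transpose (X i) *v z)" for z
  assume "det (\<chi> i. transpose (X i) *v z0) \<noteq> 0"
  then have "z0 \<in> D -` (- {0})"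
    by (simp add: D_def)
  moreover have "continuous_on UNIV D"
    unfolding D_def by (intro continuous_intros)
  then have "open (D -` (- {0}))"
    by (intro open_vimage) auto
  ultimately obtain \<delta> where \<delta>: "\<delta> > 0" "ball z0 \<delta> \<subseteq> D -` (- {0})"
    using open_contains_ball by metis
  obtain y where y: "y \<in> ball z0 (\<delta> / 2)" "y \<in> \<O>"
    using open_meets_O[of "ball z0 (\<delta> / 2)"] \<delta>(1) by auto
  have Z: "closed (- \<O>)" "- \<O> \<noteq> {}"
    using open_O z0 by auto
  define z where "z = closest_point (- \<O>) y"
  have zZ: "z \<in> - \<O>"
    unfolding z_def by (rule closest_point_in_set[OF Z])
  have zmin: "dist y z \<le> dist y x" if "x \<in> - \<O>" for x
    unfolding z_def by (rule closest_point_le[OF Z(1) that])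
  have "dist y z < \<delta> / 2"
    using zmin[of z0] z0 y by (auto simp: dist_commute)
  then have "z \<in> ball z0 \<delta>"
    using y dist_triangle_half_r[of y z0 \<delta> z] by (auto simp: dist_commute)
  then have Dz: "D z \<noteq> 0"
    using \<delta> by auto
  have le: "(y - z) \<bullet> (transpose B *v z) \<le> 0" if tB: "tangent B" for B
  proof -
    obtain f e where fe: "(\<forall>n. f n \<in> H) \<and> (\<forall>n::nat. e n > (0::real)) \<and> e \<longlonglongrightarrow> 0 \<and>
        (\<lambda>n. (f n - mat 1) /\<^sub>R e n) \<longlonglongrightarrow> B"
      using tB unfolding tangent_def by blast
    then have f: "f n \<in> H" and e: "e n > 0" "e \<longlonglongrightarrow> 0"
      and B: "(\<lambda>n. (f n - mat 1) /\<^sub>R e n) \<longlonglongrightarrow> B" for n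
      by auto
    define w where "w n = transpose ((f n - mat 1) /\<^sub>R e n) *v z" for n
    have w: "transpose (f n) *v z = z + e n *\<^sub>R w n" for n
      using e(1)[of n] by (simp add: w_def transpose_diff transpose_scaleR
         matrix_vector_mult_diff_rdistrib bounded_bilinear.scaleR_left[OF bounded_bilinear_matrix_vector])
    have wl: "w \<longlonglongrightarrow> transpose B *v z"
      unfolding w_def by (intro tendsto_intros B)
    have "2 * ((y - z) \<bullet> w n) \<le> e n * (w n \<bullet> w n)" for n
    proof -
      have "norm (y - z) \<le> norm (y - (z + e n *\<^sub>R w n))"
        using zmin[of "transpose (f n) *v z"] act_not_O[OF _ f[of n], of z] zZ by (simp add: dist_norm w)
      then have "(y - z) \<bullet> (y - z) \<le> (y - (z + e n *\<^sub>R w n)) \<bullet> (y - (z + e n *\<^sub>R w n))"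
        by (simp add: norm_le)
      then have "e n * (2 * ((y - z) \<bullet> w n)) \<le> e n * (e n * (w n \<bullet> w n))"
        by (simp add: inner_diff_left inner_diff_right inner_add_left inner_add_right inner_commute algebra_simps)
      then show ?thesis
        using e(1)[of n] by simp
    qed
    moreover have 1: "(\<lambda>n. e n * (w n \<bullet> w n)) \<longlonglongrightarrow> 0 * ((transpose B *v z) \<bullet> (transpose B *v z))"
      by (intro tendsto_intros e wl)
    moreover have 2: "(\<lambda>n. 2 * ((y - z) \<bullet> w n)) \<longlonglongrightarrow> 2 * ((y - z) \<bullet> (transpose B *v z))"
      by (intro tendsto_intros wl)
    ultimately have "2 * ((y - z) \<bullet> (transpose B *v z)) \<le> 0 * ((transpose B *v z) \<bullet> (transpose B *v z))"
      by (intro LIMSEQ_le[OF 2 1]) blast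
    then show ?thesis
      by simp
  qed
  have "(y - z) \<bullet> (transpose (X i) *v z) = 0" for i
  proof -
    have "transpose (- X i) *v z = - (transpose (X i) *v z)"
      by (simp add: transpose_uminus
         bounded_bilinear.minus_left[OF bounded_bilinear_matrix_vector])
    then show ?thesis
      using le[OF X[of i]] le[OF tangent_uminus[OF X[of i]]] by simp
  qed
  then have "(\<chi> i. transpose (X i) *v z) *v (y - z) = 0"
    by (simp add: vec_eq_iff matrix_vector_mul_component inner_commute)
  moreover have "invertible (\<chi> i. transpose (X i) *v z)"
    using Dz by (simp add: D_def invertible_det_nz)
  ultimately have "y - z = 0"
    by (metis invertible_left_inverse matrix_left_invertible_ker)
  then show False
    using y zZ by simp
qed

text \<open>The tangent vectors at \<open>z\<close> depend linearly on \<open>z\<close>, so that the determinant of \<open>d\<close> of them is a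
  polynomial, homogeneous of degree \<open>d\<close>. At \<open>\<xi>\<close> tangent vectors with every value exist, and the
  standard basis can be prescribed.\<close>

lemma vanishing_polynomial:
  assumes \<xi>: "\<xi> \<in> \<O>"
  obtains P :: "real^'n \<Rightarrow> real" where "real_polynomial_function P" "\<And>z. z \<notin> \<O> \<Longrightarrow> P z = 0"
    "\<And>c. c \<noteq> 0 \<Longrightarrow> P (c *\<^sub>R \<xi>) \<noteq> 0"
proof -
  have "\<exists>X. tangent X \<and> transpose X *v \<xi> = axis i 1" for i
    by (rule tangent_surj[OF \<xi>]) (simp add: axis_eq_0_iff)
  then obtain X where X: "\<And>i. tangent (X i)" "\<And>i. transpose (X i) *v \<xi> = axis i 1"
    by metis
  define P where "P z = det (\<chi> i. transpose (X i) *v z)" for z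
  have "real_polynomial_function P"
  proof -
    have "bounded_linear (\<lambda>z. (transpose (X i) *v z) $ j)" for i j
      by (intro bounded_linear_compose[OF bounded_linear_vec_nth]
            bounded_bilinear.bounded_linear_right[OF bounded_bilinear_matrix_vector])
    then have "real_polynomial_function (\<lambda>z. (transpose (X i) *v z) $ j)" for i j
      by (rule real_polynomial_function.intros(1))
    then show ?thesis
      unfolding P_def det_def
      by (intro real_polynomial_function_sum real_polynomial_function_prod
          real_polynomial_function.intros(2,4)) (simp_all add: finite_permutations)
  qed
  moreover have "P z = 0" if "z \<notin> \<O>" for z
    unfolding P_def by (rule tangent_det_zero[OF X(1) that])
  moreover have "P (c *\<^sub>R \<xi>) \<noteq> 0" if "c \<noteq> 0" for c
  proof -
    have "(\<chi> i. transpose (X i) *v (c *\<^sub>R \<xi>)) = (\<chi> i. c *s axis i 1)"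
      by (simp add: X(2) matrix_vector_mult_scaleR scalar_mult_eq_scaleR)
    moreover have "(\<chi> i. axis i 1) = (mat 1 :: real^'n^'n)"
      by (simp add: vec_eq_iff axis_def mat_def)
    ultimately show ?thesis
      using that det_rows_mul[of "\<lambda>_. c" "\<lambda>i. axis i 1 :: real^'n"] by (simp add: P_def)
  qed
  ultimately show ?thesis
    using that by blast
qed

end

section \<open>The Fourier transform and decay at infinity\<close>

definition wave :: "real \<Rightarrow> complex" where
  "wave \<theta> = exp (- 2 * complex_of_real pi * \<i> * complex_of_real \<theta>)"

lemma wave_cis: "wave \<theta> = cis (- 2 * pi * \<theta>)"
  by (simp add: wave_def cis_conv_exp mult_ac)

lemma norm_wave [simp]: "cmod (wave \<theta>) = 1"
  by (simp add: wave_cis)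

lemma wave_0 [simp]: "wave 0 = 1"
  by (simp add: wave_def)

lemma wave_add: "wave (a + b) = wave a * wave b"
  by (simp add: wave_def exp_add[symmetric] algebra_simps)

lemma cnj_wave: "cnj (wave a) = wave (- a)"
  by (simp add: wave_cis cis_cnj)

lemma continuous_on_wave [continuous_intros]:
  "continuous_on S f \<Longrightarrow> continuous_on S (\<lambda>x. wave (f x))"
  unfolding wave_def by (intro continuous_intros)

lemma tendsto_wave [tendsto_intros]: "(f \<longlongrightarrow> l) F \<Longrightarrow> ((\<lambda>x. wave (f x)) \<longlongrightarrow> wave l) F"
  unfolding wave_def by (intro tendsto_intros)

lemma borel_measurable_wave [measurable]: "wave \<in> borel_measurable borel"
  by (intro borel_measurable_continuous_onI continuous_intros)

lemma fourier_wave: "fourier f \<xi> = (LINT x|lebesgue. f x * wave (x \<bullet> \<xi>))"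
  by (simp add: fourier_def wave_def)

lemma integrable_times_bounded:
  fixes f g :: "'a \<Rightarrow> complex"
  assumes f: "integrable M f" and g: "g \<in> borel_measurable M" and "\<And>x. cmod (g x) \<le> B"
  shows "integrable M (\<lambda>x. f x * g x)"
proof (rule Bochner_Integration.integrable_bound)
  show "integrable M (\<lambda>x. B * norm (f x))"
    using f by simp
  show "AE x in M. norm (f x * g x) \<le> norm (B * norm (f x))"
  proof (rule AE_I2)
    fix x
    have "0 \<le> B" using assms(3)[of x] norm_ge_zero order_trans by blast
    then show "norm (f x * g x) \<le> norm (B * norm (f x))"
      using mult_left_mono[OF assms(3)[of x], of "norm (f x)"] by (simp add: norm_mult mult.commute)
  qed
qed (use f g in measurable)

lemma norm_fourier_le:
  assumes "integrable lebesgue f"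
  shows "cmod (fourier f \<xi>) \<le> (LINT x|lebesgue. cmod (f x))"
  unfolding fourier_wave
  by (rule order_trans[OF integral_norm_bound]) (simp add: norm_mult)

lemma continuous_fourier:
  fixes f :: "real^'n \<Rightarrow> complex"
  assumes f: "integrable lebesgue f"
  shows "continuous_on UNIV (fourier f)"
  unfolding continuous_on_sequentially
proof (intro ballI allI impI)
  fix u :: "nat \<Rightarrow> real^'n" and a
  assume "(\<forall>n. u n \<in> UNIV) \<and> u \<longlonglongrightarrow> a"
  then have u: "u \<longlonglongrightarrow> a" by simp
  have "(\<lambda>n. LINT x|lebesgue. f x * wave (x \<bullet> u n)) \<longlonglongrightarrow> (LINT x|lebesgue. f x * wave (x \<bullet> a))"
  proof (rule integral_dominated_convergence[where w = "\<lambda>x. norm (f x)"])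
    have [measurable]: "f \<in> borel_measurable lebesgue"
      using f by simp
    have "(\<lambda>x. wave (x \<bullet> b)) \<in> borel_measurable lebesgue" for b :: "real^'n"
      by (rule measurable_completion) simp
    then show "(\<lambda>x. f x * wave (x \<bullet> a)) \<in> borel_measurable lebesgue"
      "\<And>n. (\<lambda>x. f x * wave (x \<bullet> u n)) \<in> borel_measurable lebesgue"
      by measurable
    show "AE x in lebesgue. (\<lambda>n. f x * wave (x \<bullet> u n)) \<longlonglongrightarrow> f x * wave (x \<bullet> a)"
      by (intro AE_I2 tendsto_intros u)
  qed (use f in \<open>auto simp: norm_mult\<close>)
  then show "(fourier f \<circ> u) \<longlonglongrightarrow> fourier f a"
    by (simp add: o_def fourier_wave)
qed

text \<open>Sum over the dyadic shells \<open>2\<^sup>k \<le> 1 + |x| < 2\<^bsup>k+1\<^esup>\<close>.\<close>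

lemma integrable_decay:
  fixes p :: real
  assumes p: "p > CARD('n)"
  shows "integrable lborel (\<lambda>x::real^'n. (1 + norm x) powr - p)"
proof (rule integrableI_bounded)
  let ?d = "CARD('n)"
  define V where "V = unit_ball_vol (real ?d)"
  define q where "q = 2 powr (real ?d - p)"
  have q: "0 \<le> q" "q < 1"
    using p by (auto simp: q_def powr_less_one)
  have shell: "\<exists>k. ennreal ((1 + norm x) powr - p) \<le> ennreal ((2 powr real k) powr - p) * indicator (ball 0 (2 powr (real k + 1))) x" for x :: "real^'n"
  proof -
    define k where "k = nat \<lfloor>log 2 (1 + norm x)\<rfloor>"
    have "0 \<le> log 2 (1 + norm x)" by (subst zero_le_log_cancel_iff) (auto simp: add_pos_nonneg)
    then have "real k \<le> log 2 (1 + norm x)" "log 2 (1 + norm x) < real k + 1"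
      unfolding k_def by (auto simp: of_nat_nat)
    then have k: "2 powr real k \<le> 1 + norm x" "1 + norm x < 2 powr (real k + 1)"
      by (auto simp: le_log_iff log_less_iff add_pos_nonneg)
    have "(1 + norm x) powr - p \<le> (2 powr real k) powr - p"
      using k(1) p by (intro powr_mono2') auto
    then show ?thesis
      using k(2) by (intro exI[of _ k]) (auto intro: ennreal_leI)
  qed
  define r c where "r k = 2 powr (real k + 1)" and "c k = ennreal ((2 powr real k) powr - p)" for k
  have "(\<integral>\<^sup>+(x::real^'n). ennreal (norm ((1 + norm x) powr - p)) \<partial>lborel) \<le>
      (\<integral>\<^sup>+(x::real^'n). (\<Sum>k. c k * indicator (ball 0 (r k)) x) \<partial>lborel)"
  proof (rule nn_integral_mono)
    fix x :: "real^'n"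
    obtain k where "ennreal ((1 + norm x) powr - p) \<le> c k * indicator (ball 0 (r k)) x"
      using shell unfolding r_def c_def by blast
    also have "\<dots> \<le> (\<Sum>k. c k * indicator (ball 0 (r k)) x)"
    proof -
      define u where "u k = c k * indicator (ball 0 (r k)) x" for k
      have "u k \<le> (\<Sum>k. u k)"
        using sum_le_suminf[OF summableI, of "{k}" u] by simp
      then show ?thesis
        by (simp only: u_def)
    qed
    finally show "ennreal (norm ((1 + norm x) powr - p)) \<le> (\<Sum>k. c k * indicator (ball 0 (r k)) x)"
      by simp
  qed
  also have "\<dots> = (\<Sum>k. \<integral>\<^sup>+(x::real^'n). c k * indicator (ball 0 (r k)) x \<partial>lborel)"
    by (rule nn_integral_suminf) (rule borel_measurable_times_ennreal[OF borel_measurable_const borel_measurable_indicator], simp)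
  also have "\<dots> = (\<Sum>k. c k * emeasure lborel (ball (0::real^'n) (r k)))"
    by (intro suminf_cong nn_integral_cmult_indicator) simp
  also have "\<dots> = (\<Sum>k. ennreal (V * 2 ^ ?d * q ^ k))"
  proof (rule suminf_cong)
    fix k
    have "(2 powr real k) powr - p * (2 powr (real k + 1)) ^ ?d = 2 ^ ?d * q ^ k"
    proof -
      have pow: "(2 powr a) ^ n = 2 powr (a * real n)" for a :: real and n
      proof -
        have "(2 powr a) ^ n = (2 powr a) powr real n"
          by (rule powr_realpow[symmetric]) simp
        then show ?thesis
          unfolding powr_powr .
      qed
      have 1: "(2 powr (real k + 1)) ^ ?d = 2 powr ((real k + 1) * real ?d)"
        by (rule pow)
      have 2: "q ^ k = 2 powr ((real ?d - p) * real k)"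
        unfolding q_def by (rule pow)
      have 3: "(2::real) ^ ?d = 2 powr real ?d"
        by (simp add: powr_realpow)
      have 4: "real k * - p + (real k + 1) * real ?d = real ?d + (real ?d - p) * real k"
        by (simp add: algebra_simps)
      show ?thesis
        unfolding 1 2 3 powr_powr powr_add[symmetric] 4 ..
    qed
    then have "V * ((2 powr real k) powr - p * r k ^ ?d) = V * 2 ^ ?d * q ^ k"
      by (simp only: r_def mult.assoc)
    moreover have "c k * emeasure lborel (ball (0::real^'n) (r k)) = ennreal (V * ((2 powr real k) powr - p * r k ^ ?d))"
      by (simp add: emeasure_ball r_def V_def c_def ennreal_mult[symmetric] mult_ac)
    ultimately show "c k * emeasure lborel (ball (0::real^'n) (r k)) = ennreal (V * 2 ^ ?d * q ^ k)"
      by (simp only:)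
  qed
  also have "\<dots> < \<infinity>"
  proof -
    have "summable (\<lambda>k. V * 2 ^ ?d * q ^ k)"
      using q by (intro summable_mult summable_geometric) simp
    moreover have "0 \<le> V"
      unfolding V_def by (rule unit_ball_vol_nonneg) simp
    ultimately have "(\<Sum>k. ennreal (V * 2 ^ ?d * q ^ k)) \<noteq> \<infinity>"
      using q unfolding infinity_ennreal_def by (intro ennreal_suminf_neq_top) auto
    then show ?thesis
      by (auto simp: less_top[symmetric])
  qed
  finally show "(\<integral>\<^sup>+(x::real^'n). ennreal (norm ((1 + norm x) powr - p)) \<partial>lborel) < \<infinity>" .
qed simp

lemma integrable_decay_nat:
  assumes "p > CARD('n)"
  shows "integrable lborel (\<lambda>x::real^'n. 1 / (1 + norm x) ^ p)"
proof -
  have "(1 + norm x) powr - real p = 1 / (1 + norm x) ^ p" for x :: "real^'n"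
    by (simp add: powr_minus powr_realpow add_pos_nonneg inverse_eq_divide)
  then show ?thesis
    using integrable_decay[where ?'n = 'n and p = "real p"] assms by simp
qed

lemma continuous_decay_integrable:
  fixes v :: "real^'n \<Rightarrow> complex"
  assumes "continuous_on UNIV v" "\<And>x. cmod (v x) \<le> K / (1 + norm x) ^ p" "p > CARD('n)"
  shows "integrable lborel v"
proof (rule Bochner_Integration.integrable_bound)
  show "integrable lborel (\<lambda>x::real^'n. K * (1 / (1 + norm x) ^ p))"
    by (intro integrable_mult_right integrable_decay_nat assms)
  show "AE x in lborel. norm (v x) \<le> norm (K * (1 / (1 + norm x) ^ p))"
  proof (rule AE_I2)
    fix x
    show "norm (v x) \<le> norm (K * (1 / (1 + norm x) ^ p))"
      using order_trans[OF assms(2)[of x], of "\<bar>K\<bar> / (1 + norm x) ^ p"] by (simp add: divide_right_mono)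
  qed
  show "v \<in> borel_measurable lborel"
    using borel_measurable_continuous_onI[OF assms(1)] by simp
qed

lemma integral_lborel_translation:
  fixes g :: "'a::euclidean_space \<Rightarrow> 'b::{banach, second_countable_topology}"
  assumes [measurable]: "g \<in> borel_measurable borel"
  shows "(LINT x|lborel. g (x + c)) = (LINT x|lborel. g x)"
proof -
  have "(LINT x|lborel. g x) = (LINT x|distr lborel borel ((+) c). g x)"
    by (simp add: lborel_distr_plus)
  also have "\<dots> = (LINT x|lborel. g (c + x))"
    by (rule integral_distr) measurable
  finally show ?thesis
    by (simp add: add.commute)
qed

lemma integral_lborel_scale:
  fixes g :: "real^'n \<Rightarrow> 'b::{banach, second_countable_topology}"
  assumes c: "c > 0" and [measurable]: "g \<in> borel_measurable borel"
  shows "(LINT x|lborel. g (t + c *\<^sub>R x)) = (1 / c ^ CARD('n)) *\<^sub>R (LINT x|lborel. g x)"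
proof -
  have "(LINT x|lborel. g x) = (LINT x|density (distr lborel borel (\<lambda>x. t + c *\<^sub>R x)) (\<lambda>_. \<bar>c\<bar> ^ DIM(real^'n)). g x)"
    using c lborel_affine[of c t] by simp
  also have "\<dots> = (LINT x|distr lborel borel (\<lambda>x. t + c *\<^sub>R x). (c ^ CARD('n)) *\<^sub>R g x)"
    using c by (subst integral_density) auto
  also have "\<dots> = (LINT x|lborel. (c ^ CARD('n)) *\<^sub>R g (t + c *\<^sub>R x))"
    by (rule integral_distr) measurable
  also have "\<dots> = (c ^ CARD('n)) *\<^sub>R (LINT x|lborel. g (t + c *\<^sub>R x))"
    by (rule integral_scaleR_right)
  finally show ?thesis
    using c by simp
qed

section \<open>Fourier transforms of derivatives\<close>

lemma decay_shift:
  fixes x e :: "'a::real_normed_vector"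
  assumes "norm e \<le> 1" "0 \<le> K"
  shows "K / (1 + norm (x + e)) ^ p \<le> 2 ^ p * K / (1 + norm x) ^ p"
proof -
  have "norm x \<le> norm (x + e) + norm e"
    using norm_triangle_ineq4[of "x + e" e] by simp
  moreover have aux: "1 + a \<le> 2 * (1 + b)" if "a \<le> b + c" "c \<le> 1" "0 \<le> b" for a b c :: real
    using that by simp
  ultimately have "1 + norm x \<le> 2 * (1 + norm (x + e))"
    by (intro aux[OF _ assms(1) norm_ge_zero])
  then have "(1 + norm x) ^ p \<le> (2 * (1 + norm (x + e))) ^ p"
    by (intro power_mono) auto
  then have "(1 + norm x) ^ p \<le> 2 ^ p * (1 + norm (x + e)) ^ p"
    by (simp only: power_mult_distrib)
  then have "K * (1 + norm x) ^ p \<le> K * (2 ^ p * (1 + norm (x + e)) ^ p)"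
    using assms(2) by (intro mult_left_mono)
  then show ?thesis
    by (simp add: divide_le_eq pos_le_divide_eq add_pos_nonneg mult_ac)
qed

lemma difference_quotient_LIMSEQ:
  fixes f :: "real \<Rightarrow> 'a::real_normed_vector"
  assumes f: "(f has_vector_derivative D) (at 0)" and t: "t \<longlonglongrightarrow> 0" "\<And>n. t n \<noteq> 0"
  shows "(\<lambda>n. (f (t n) - f 0) /\<^sub>R t n) \<longlonglongrightarrow> D"
proof -
  have "((\<lambda>h. norm (f (0 + h) - f 0 - h *\<^sub>R D) / norm h) \<longlongrightarrow> 0) (at 0)"
    using f unfolding has_vector_derivative_def has_derivative_at by blast
  moreover have "filterlim t (at 0) sequentially"
    using t by (simp add: filterlim_at)
  ultimately have "(\<lambda>n. norm (f (0 + t n) - f 0 - t n *\<^sub>R D) / norm (t n)) \<longlonglongrightarrow> 0"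
    by (rule filterlim_compose)
  moreover have "norm (f (0 + t n) - f 0 - t n *\<^sub>R D) / norm (t n) = norm ((f (t n) - f 0) /\<^sub>R t n - D)" for n
  proof -
    have "f (0 + t n) - f 0 - t n *\<^sub>R D = t n *\<^sub>R ((f (t n) - f 0) /\<^sub>R t n - D)"
      using t(2)[of n] by (simp add: scaleR_diff_right)
    then show ?thesis
      using t(2)[of n] by simp
  qed
  ultimately have "(\<lambda>n. norm ((f (t n) - f 0) /\<^sub>R t n - D)) \<longlonglongrightarrow> 0"
    by (simp only:)
  then show ?thesis
    by (rule LIM_zero_cancel[OF tendsto_norm_zero_cancel])
qed

text \<open>Integration by parts without Fubini's theorem: the integral of a translate differs only by a
  phase, so that the difference quotients of the two sides can be compared.\<close>

lemma integral_deriv_wave: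
  fixes v :: "real^'n \<Rightarrow> complex"
  assumes der: "\<And>\<xi>. (v has_derivative V \<xi>) (at \<xi>)" and dv: "continuous_on UNIV (\<lambda>\<xi>. V \<xi> (axis i 1))"
    and bv: "\<And>\<xi>. cmod (v \<xi>) \<le> K / (1 + norm \<xi>) ^ p" and bdv: "\<And>\<xi>. cmod (V \<xi> (axis i 1)) \<le> K / (1 + norm \<xi>) ^ p"
    and p: "p > CARD('n)"
  shows "(LINT \<xi>|lborel. V \<xi> (axis i 1) * wave (x \<bullet> \<xi>)) =
    2 * complex_of_real pi * \<i> * complex_of_real (x $ i) * (LINT \<xi>|lborel. v \<xi> * wave (x \<bullet> \<xi>))"
proof -
  define e :: "real^'n" where "e = axis i 1"
  define dv where "dv \<xi> = V \<xi> e" for \<xi>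
  define J where "J = (LINT \<xi>|lborel. v \<xi> * wave (x \<bullet> \<xi>))"
  have K: "0 \<le> K"
    using order_trans[OF norm_ge_zero bv[of 0]] by simp
  have v: "continuous_on UNIV v"
    using der by (auto intro: has_derivative_continuous simp: continuous_on_eq_continuous_at)
  have [measurable]: "v \<in> borel_measurable borel" "dv \<in> borel_measurable borel"
    using v dv by (auto intro: borel_measurable_continuous_onI simp: dv_def[abs_def] e_def)
  have ne: "norm e = 1" by (simp add: e_def)
  have der': "((\<lambda>s. v (\<xi> + s *\<^sub>R e)) has_vector_derivative dv (\<xi> + s *\<^sub>R e)) (at s)" for \<xi> s
  proof -
    have "((\<lambda>s. \<xi> + s *\<^sub>R e) has_derivative (\<lambda>r. r *\<^sub>R e)) (at s)"
      by (auto intro!: derivative_eq_intros)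
    from has_derivative_compose[OF this der]
    have "((\<lambda>s. v (\<xi> + s *\<^sub>R e)) has_derivative (\<lambda>r. V (\<xi> + s *\<^sub>R e) (r *\<^sub>R e))) (at s)" .
    then show ?thesis
      by (simp add: has_vector_derivative_def dv_def linear_cmul[OF has_derivative_linear[OF der]])
  qed
  define t where "t n = 1 / real (Suc n)" for n
  have t: "t n > 0" "t n \<le> 1" for n
    by (auto simp: t_def)
  have tlim: "t \<longlonglongrightarrow> 0"
    using LIMSEQ_inverse_real_of_nat by (simp add: t_def[abs_def] inverse_eq_divide)
  have tnz: "t n \<noteq> 0" for n
    using t(1)[of n] by simp
  have int_v: "integrable lborel (\<lambda>\<xi>. v \<xi> * wave (x \<bullet> \<xi>))"
    using continuous_decay_integrable[OF v bv p] by (rule integrable_times_bounded[where B = 1]) auto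
  have bshift: "cmod (v (\<xi> + e')) \<le> 2 ^ p * K / (1 + norm \<xi>) ^ p"
     "cmod (dv (\<xi> + e')) \<le> 2 ^ p * K / (1 + norm \<xi>) ^ p" if "norm e' \<le> 1" for \<xi> e'
    using order_trans[OF bv decay_shift[OF that K]] order_trans[OF bdv decay_shift[OF that K]]
    by (auto simp: dv_def e_def)
  define Q where "Q n \<xi> = ((v (\<xi> + t n *\<^sub>R e) - v \<xi>) /\<^sub>R t n) * wave (x \<bullet> \<xi>)" for n \<xi>
  have "(\<lambda>n. LINT \<xi>|lborel. Q n \<xi>) \<longlonglongrightarrow> (LINT \<xi>|lborel. dv \<xi> * wave (x \<bullet> \<xi>))"
  proof (rule integral_dominated_convergence[where w = "\<lambda>\<xi>. 2 ^ p * K * (1 / (1 + norm \<xi>) ^ p)"])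
    show "integrable lborel (\<lambda>\<xi>::real^'n. 2 ^ p * K * (1 / (1 + norm \<xi>) ^ p))"
      by (intro integrable_mult_right integrable_decay_nat p)
    show "AE \<xi> in lborel. (\<lambda>n. Q n \<xi>) \<longlonglongrightarrow> dv \<xi> * wave (x \<bullet> \<xi>)"
    proof (rule AE_I2)
      fix \<xi>
      have "(\<lambda>n. (v (\<xi> + t n *\<^sub>R e) - v \<xi>) /\<^sub>R t n) \<longlonglongrightarrow> dv \<xi>"
        using difference_quotient_LIMSEQ[OF _ tlim tnz, of "\<lambda>s. v (\<xi> + s *\<^sub>R e)" "dv \<xi>"] der'[of \<xi> 0] by simp
      then show "(\<lambda>n. Q n \<xi>) \<longlonglongrightarrow> dv \<xi> * wave (x \<bullet> \<xi>)"
        unfolding Q_def by (intro tendsto_intros)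
    qed
    show "AE \<xi> in lborel. norm (Q n \<xi>) \<le> 2 ^ p * K * (1 / (1 + norm \<xi>) ^ p)" for n
    proof (rule AE_I2)
      fix \<xi> :: "real^'n"
      define B where "B = 2 ^ p * K / (1 + norm \<xi>) ^ p"
      have "norm (v (\<xi> + t n *\<^sub>R e) - v (\<xi> + 0 *\<^sub>R e)) \<le> B * t n - B * 0"
      proof (rule differentiable_bound_general[where f = "\<lambda>s. v (\<xi> + s *\<^sub>R e)" and \<phi> = "\<lambda>s. B * s"
            and f' = "\<lambda>s. dv (\<xi> + s *\<^sub>R e)" and \<phi>' = "\<lambda>_. B"])
        show "continuous_on {0..t n} (\<lambda>s. v (\<xi> + s *\<^sub>R e))"
          by (intro continuous_on_compose2[OF v] continuous_intros) auto
        show "((\<lambda>s. B * s) has_vector_derivative B) (at s)" for s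
          by (auto intro!: derivative_eq_intros simp: has_real_derivative_iff_has_vector_derivative[symmetric])
        show "norm (dv (\<xi> + s *\<^sub>R e)) \<le> B" if "0 < s" "s < t n" for s
          unfolding B_def using that t(2)[of n] by (intro bshift) (simp add: ne)
      qed (use t der' in \<open>auto intro!: continuous_intros\<close>)
      then have "norm (v (\<xi> + t n *\<^sub>R e) - v \<xi>) / t n \<le> B"
        using t(1)[of n] by (simp add: divide_le_eq)
      then show "norm (Q n \<xi>) \<le> 2 ^ p * K * (1 / (1 + norm \<xi>) ^ p)"
        using t(1)[of n] by (simp add: Q_def norm_mult B_def divide_inverse mult.commute)
    qed
  qed (auto simp: Q_def)
  moreover have "(LINT \<xi>|lborel. Q n \<xi>) = ((wave (- (t n * x $ i)) - wave (- (0 * x $ i))) /\<^sub>R t n) * J" for n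
  proof -
    have shift: "v (\<xi> + t n *\<^sub>R e) * wave (x \<bullet> \<xi>) =
        (v (\<xi> + t n *\<^sub>R e) * wave (x \<bullet> (\<xi> + t n *\<^sub>R e))) * wave (- (t n * x $ i))" for \<xi>
    proof -
      have "x \<bullet> \<xi> = x \<bullet> (\<xi> + t n *\<^sub>R e) + - (t n * x $ i)"
        by (simp add: inner_add_right e_def inner_axis)
      then show ?thesis
        by (metis mult.assoc wave_add)
    qed
    have 1: "(LINT \<xi>|lborel. v (\<xi> + t n *\<^sub>R e) * wave (x \<bullet> \<xi>)) = J * wave (- (t n * x $ i))"
      unfolding shift J_def using integral_lborel_translation[of "\<lambda>\<xi>. v \<xi> * wave (x \<bullet> \<xi>)" "t n *\<^sub>R e"]
      by (simp only: integral_mult_left_zero) simp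
    have "integrable lborel (\<lambda>\<xi>. v (\<xi> + t n *\<^sub>R e))"
    proof (rule continuous_decay_integrable[OF _ _ p])
      show "continuous_on UNIV (\<lambda>\<xi>. v (\<xi> + t n *\<^sub>R e))"
        by (intro continuous_on_compose2[OF v] continuous_intros) auto
      show "cmod (v (\<xi> + t n *\<^sub>R e)) \<le> (2 ^ p * K) / (1 + norm \<xi>) ^ p" for \<xi>
        using t[of n] by (intro bshift) (simp add: ne)
    qed
    then have int: "integrable lborel (\<lambda>\<xi>. v (\<xi> + t n *\<^sub>R e) * wave (x \<bullet> \<xi>))"
      by (rule integrable_times_bounded[where B = 1]) auto
    have "(LINT \<xi>|lborel. Q n \<xi>) = (LINT \<xi>|lborel. (v (\<xi> + t n *\<^sub>R e) * wave (x \<bullet> \<xi>) - v \<xi> * wave (x \<bullet> \<xi>)) /\<^sub>R t n)"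
      by (simp add: Q_def algebra_simps)
    also have "\<dots> = (J * wave (- (t n * x $ i)) - J) /\<^sub>R t n"
      by (simp add: Bochner_Integration.integral_diff[OF int int_v] 1 J_def)
    finally show ?thesis
      by (simp add: algebra_simps)
  qed
  moreover have "(\<lambda>n. ((wave (- (t n * x $ i)) - wave (- (0 * x $ i))) /\<^sub>R t n) * J) \<longlonglongrightarrow>
      2 * complex_of_real pi * \<i> * complex_of_real (x $ i) * J"
  proof -
    define c where "c = 2 * complex_of_real pi * \<i> * complex_of_real (x $ i)"
    have "((\<lambda>z. exp (z * c)) has_field_derivative c) (at (complex_of_real 0))"
      by (auto intro!: derivative_eq_intros)
    from has_vector_derivative_real_field[OF this]
    have "((\<lambda>s. wave (- (s * x $ i))) has_vector_derivative c) (at 0)"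
      by (simp add: wave_def c_def mult_ac)
    from difference_quotient_LIMSEQ[OF this tlim tnz]
    show ?thesis
      unfolding c_def[symmetric] by (intro tendsto_intros)
  qed
  ultimately show ?thesis
    unfolding J_def using LIMSEQ_unique by (fastforce simp: dv_def e_def)
qed

section \<open>Fourier inversion and the identity of Parseval\<close>

lemma integrable_lborel_scale:
  fixes g :: "'a::euclidean_space \<Rightarrow> 'b::{banach, second_countable_topology}"
  assumes c: "c \<noteq> 0" and g: "integrable lborel g"
  shows "integrable lborel (\<lambda>x. g (t + c *\<^sub>R x))"
proof -
  have [measurable]: "g \<in> borel_measurable borel"
    using g by (auto dest: borel_measurable_integrable)
  have "integrable (density (distr lborel borel (\<lambda>x. t + c *\<^sub>R x)) (\<lambda>_. \<bar>c\<bar> ^ DIM('a))) g"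
    using g c by (simp add: lborel_affine[of c t, symmetric])
  then have "integrable (distr lborel borel (\<lambda>x. t + c *\<^sub>R x)) (\<lambda>x. \<bar>c\<bar> ^ DIM('a) *\<^sub>R g x)"
    by (subst (asm) integrable_density) auto
  then have "integrable lborel (\<lambda>x. \<bar>c\<bar> ^ DIM('a) *\<^sub>R g (t + c *\<^sub>R x))"
    by (subst (asm) integrable_distr_eq) auto
  then have "integrable lborel (\<lambda>x. (1 / \<bar>c\<bar> ^ DIM('a)) *\<^sub>R (\<bar>c\<bar> ^ DIM('a) *\<^sub>R g (t + c *\<^sub>R x)))"
    by (rule integrable_scaleR_right)
  then show ?thesis
    using c by simp
qed

lemma borel_measurable_cnj [measurable]: "cnj \<in> borel_measurable borel"
  by (intro borel_measurable_continuous_onI continuous_intros)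

definition gauss :: "real^'n \<Rightarrow> real" where
  "gauss x = exp (- (x \<bullet> x) / 2)"

lemma gauss_measurable [measurable]: "gauss \<in> borel_measurable borel"
  unfolding gauss_def[abs_def] by measurable

lemma gauss_nonneg [simp]: "0 \<le> gauss x"
  by (simp add: gauss_def)

lemma gauss_le_1: "gauss x \<le> 1"
  by (simp add: gauss_def)

lemma gauss_integral_1d:
  shows "integrable lborel (\<lambda>t::real. complex_of_real (exp (- (t\<^sup>2) / 2)) * iexp (a * t))"
    and "(LINT t|lborel. complex_of_real (exp (- (t\<^sup>2) / 2)) * iexp (a * t)) = complex_of_real (sqrt (2 * pi) * exp (- (a\<^sup>2) / 2))"
proof -
  have dens: "std_normal_density t *\<^sub>R iexp (a * t) = complex_of_real (exp (- (t\<^sup>2) / 2)) * iexp (a * t) / complex_of_real (sqrt (2 * pi))" for t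
    by (simp add: std_normal_density_def scaleR_conv_of_real)
  have "integrable lborel std_normal_density"
    using integrable_std_normal_moment[of 0] by simp
  then have "integrable lborel (\<lambda>t. complex_of_real (std_normal_density t) * iexp (a * t))"
    by (intro integrable_times_bounded[where B = 1] integrable_of_real) auto
  then have "integrable lborel (\<lambda>t. complex_of_real (sqrt (2 * pi)) * (std_normal_density t *\<^sub>R iexp (a * t)))"
    by (intro integrable_mult_right) (simp add: scaleR_conv_of_real)
  then show "integrable lborel (\<lambda>t::real. complex_of_real (exp (- (t\<^sup>2) / 2)) * iexp (a * t))"
    unfolding dens by simp
  have "char std_normal_distribution a = (LINT t|lborel. std_normal_density t *\<^sub>R iexp (a * t))"
    unfolding char_def by (rule integral_density) auto
  also have "\<dots> = (LINT t|lborel. complex_of_real (exp (- (t\<^sup>2) / 2)) * iexp (a * t)) / complex_of_real (sqrt (2 * pi))"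
    unfolding dens by simp
  finally show "(LINT t|lborel. complex_of_real (exp (- (t\<^sup>2) / 2)) * iexp (a * t)) = complex_of_real (sqrt (2 * pi) * exp (- (a\<^sup>2) / 2))"
    by (simp add: char_std_normal_distribution field_simps)
qed

lemma gauss_integral:
  fixes a :: "real^'n"
  shows "integrable lborel (\<lambda>x. complex_of_real (gauss x) * iexp (a \<bullet> x))"
    and "(LINT x|lborel. complex_of_real (gauss x) * iexp (a \<bullet> x)) = complex_of_real (sqrt (2 * pi) ^ CARD('n) * gauss a)"
proof -
  interpret product_sigma_finite "\<lambda>_::real^'n. lborel :: real measure" ..
  let ?P = "Pi\<^sub>M (Basis :: (real^'n) set) (\<lambda>_. lborel :: real measure)"
  let ?T = "\<lambda>f. \<Sum>b\<in>(Basis :: (real^'n) set). f b *\<^sub>R b"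
  define g where "g x = complex_of_real (gauss x) * iexp (a \<bullet> x)" for x :: "real^'n"
  define h where "h b t = complex_of_real (exp (- (t\<^sup>2) / 2)) * iexp ((a \<bullet> b) * t)" for b :: "real^'n" and t :: real
  have [measurable]: "g \<in> borel_measurable borel"
    unfolding g_def by measurable
  have T [measurable]: "?T \<in> measurable ?P borel"
    by measurable
  have gh: "g (?T f) = (\<Prod>b\<in>Basis. h b (f b))" for f
  proof -
    have 1: "?T f \<bullet> ?T f = (\<Sum>b\<in>Basis. (f b)\<^sup>2)"
      by (subst euclidean_inner) (simp add: inner_sum_left_Basis power2_eq_square)
    have 2: "a \<bullet> ?T f = (\<Sum>b\<in>Basis. (a \<bullet> b) * f b)"
      by (simp add: inner_sum_right mult.commute)
    have "complex_of_real (gauss (?T f)) = (\<Prod>b\<in>Basis. complex_of_real (exp (- ((f b)\<^sup>2) / 2)))"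
      unfolding gauss_def 1 of_real_prod[symmetric] exp_sum[OF finite_Basis, symmetric]
      by (simp add: sum_negf sum_divide_distrib)
    moreover have "iexp (a \<bullet> ?T f) = (\<Prod>b\<in>Basis. iexp ((a \<bullet> b) * f b))"
      unfolding 2 exp_sum[OF finite_Basis, symmetric] by (simp add: sum_distrib_left)
    ultimately show ?thesis
      by (simp add: g_def h_def prod.distrib)
  qed
  have hi: "integrable lborel (h b)" for b
    unfolding h_def by (rule gauss_integral_1d)
  have "integrable ?P (\<lambda>f. g (?T f))"
    unfolding gh using hi by (intro product_integrable_prod) auto
  then have "integrable (distr ?P borel ?T) g"
    by (subst integrable_distr_eq) auto
  then show "integrable lborel (\<lambda>x. complex_of_real (gauss x) * iexp (a \<bullet> x))"
    unfolding g_def[symmetric] lborel_eq[symmetric] .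
  have "(LINT x|lborel. g x) = (LINT x|distr ?P borel ?T. g x)"
    by (simp only: lborel_eq[symmetric])
  also have "\<dots> = (LINT f|?P. g (?T f))"
    by (rule integral_distr) measurable
  also have "\<dots> = (\<Prod>b\<in>Basis. LINT t|lborel. h b t)"
    unfolding gh using hi by (intro product_integral_prod) auto
  also have "\<dots> = (\<Prod>b\<in>(Basis :: (real^'n) set). complex_of_real (sqrt (2 * pi)) * complex_of_real (exp (- ((a \<bullet> b)\<^sup>2) / 2)))"
    unfolding h_def gauss_integral_1d(2) by simp
  also have "\<dots> = complex_of_real (sqrt (2 * pi) ^ CARD('n) * gauss a)"
  proof -
    have "(\<Prod>b\<in>Basis. exp (- ((a \<bullet> b)\<^sup>2) / 2)) = gauss a"
      unfolding gauss_def exp_sum[OF finite_Basis, symmetric] euclidean_inner[of a a]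
      by (simp add: sum_negf sum_divide_distrib power2_eq_square)
    then show ?thesis
      by (simp add: prod.distrib flip: of_real_prod)
  qed
  finally show "(LINT x|lborel. complex_of_real (gauss x) * iexp (a \<bullet> x)) = complex_of_real (sqrt (2 * pi) ^ CARD('n) * gauss a)"
    by (simp add: g_def)
qed

lemma gauss_integrable: "integrable lborel (gauss :: real^'n \<Rightarrow> real)"
  and integral_gauss: "(LINT x|lborel. gauss (x :: real^'n)) = sqrt (2 * pi) ^ CARD('n)"
proof -
  have "integrable lborel (\<lambda>x::real^'n. complex_of_real (gauss x))"
    using gauss_integral(1)[of 0] by simp
  then show 1: "integrable lborel (gauss :: real^'n \<Rightarrow> real)"
    using integrable_Re by fastforce
  have "complex_of_real (LINT x|lborel. gauss (x :: real^'n)) = (LINT x|lborel. complex_of_real (gauss (x :: real^'n)))"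
    by (rule integral_complex_of_real[symmetric])
  also have "\<dots> = complex_of_real (sqrt (2 * pi) ^ CARD('n))"
    using gauss_integral(2)[of "0 :: real^'n"] by (simp add: gauss_def[of 0])
  finally show "(LINT x|lborel. gauss (x :: real^'n)) = sqrt (2 * pi) ^ CARD('n)"
    by (simp only: of_real_eq_iff)
qed

definition gauss_kernel :: "real \<Rightarrow> real^'n \<Rightarrow> real" where
  "gauss_kernel \<epsilon> z = gauss (z /\<^sub>R \<epsilon>) / (\<epsilon> * sqrt (2 * pi)) ^ CARD('n)"

lemma gauss_kernel_measurable [measurable]: "gauss_kernel \<epsilon> \<in> borel_measurable borel"
  unfolding gauss_kernel_def[abs_def] by measurable

text \<open>The normalisation of the kernel is the one that occurs for the transform with
  \<open>exp (- 2 \<pi> i \<langle>x, \<xi>\<rangle>)\<close>: damping by a Gaussian of width \<open>1 / (2 \<pi> \<epsilon>)\<close> is averaging with width \<open>\<epsilon>\<close>.\<close>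

lemma gauss_kernel_fourier:
  fixes z :: "real^'n"
  assumes "\<epsilon> > 0"
  shows "(LINT \<xi>|lborel. complex_of_real (gauss ((2 * pi * \<epsilon>) *\<^sub>R \<xi>)) * wave (- (z \<bullet> \<xi>))) = complex_of_real (gauss_kernel \<epsilon> z)"
proof -
  define g where "g \<eta> = complex_of_real (gauss \<eta>) * iexp ((z /\<^sub>R \<epsilon>) \<bullet> \<eta>)" for \<eta> :: "real^'n"
  have [measurable]: "g \<in> borel_measurable borel"
    unfolding g_def by measurable
  have "complex_of_real (gauss ((2 * pi * \<epsilon>) *\<^sub>R \<xi>)) * wave (- (z \<bullet> \<xi>)) = g (0 + (2 * pi * \<epsilon>) *\<^sub>R \<xi>)" for \<xi>
  proof -
    have eq: "(z /\<^sub>R \<epsilon>) \<bullet> ((2 * pi * \<epsilon>) *\<^sub>R \<xi>) = 2 * pi * (z \<bullet> \<xi>)"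
      using assms by simp
    show ?thesis
      unfolding g_def add_0 eq by (simp add: wave_def mult_ac)
  qed
  then have "(LINT \<xi>|lborel. complex_of_real (gauss ((2 * pi * \<epsilon>) *\<^sub>R \<xi>)) * wave (- (z \<bullet> \<xi>))) =
      (1 / (2 * pi * \<epsilon>) ^ CARD('n)) *\<^sub>R (LINT \<xi>|lborel. g \<xi>)"
    using assms integral_lborel_scale[of "2 * pi * \<epsilon>" g 0] by simp
  also have "(LINT \<xi>|lborel. g \<xi>) = complex_of_real (sqrt (2 * pi) ^ CARD('n) * gauss (z /\<^sub>R \<epsilon>))"
    unfolding g_def by (rule gauss_integral(2))
  also have "(1 / (2 * pi * \<epsilon>) ^ CARD('n)) *\<^sub>R complex_of_real (sqrt (2 * pi) ^ CARD('n) * gauss (z /\<^sub>R \<epsilon>)) =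
      complex_of_real (gauss_kernel \<epsilon> z)"
  proof -
    have "2 * pi * \<epsilon> = (\<epsilon> * sqrt (2 * pi)) * sqrt (2 * pi)"
      by simp
    then have "(2 * pi * \<epsilon>) ^ CARD('n) = (\<epsilon> * sqrt (2 * pi)) ^ CARD('n) * sqrt (2 * pi) ^ CARD('n)"
      by (metis power_mult_distrib)
    then have "1 / (2 * pi * \<epsilon>) ^ CARD('n) * (sqrt (2 * pi) ^ CARD('n) * gauss (z /\<^sub>R \<epsilon>)) = gauss_kernel \<epsilon> z"
      by (simp add: gauss_kernel_def)
    then show ?thesis
      unfolding scaleR_conv_of_real of_real_mult[symmetric] by (simp only:)
  qed
  finally show ?thesis .
qed

text \<open>Damped by a Gaussian, the inverse transform is a convolution of \<open>f\<close> with a Gaussian kernel.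
  Integrated over a box, the kernel can be moved to the indicator of the box, which is
  recovered in the limit outside the boundary of the box.\<close>

lemma inversion_on_boxes:
  fixes f :: "real^'n \<Rightarrow> complex"
  assumes f: "integrable lborel f"
  defines "F \<equiv> \<lambda>\<xi>. LINT x|lborel. f x * wave (x \<bullet> \<xi>)"
  assumes F: "integrable lborel F"
  defines "G \<equiv> \<lambda>y. LINT \<xi>|lborel. F \<xi> * wave (- (y \<bullet> \<xi>))"
  shows "(LINT y|lborel. indicator (cbox a b) y *\<^sub>R G y) = (LINT y|lborel. indicator (cbox a b) y *\<^sub>R f y)"
proof -
  have [measurable]: "f \<in> borel_measurable borel" "F \<in> borel_measurable borel"
    using f F by (auto dest: borel_measurable_integrable)
  have [measurable]: "G \<in> borel_measurable borel"
    unfolding G_def by measurable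
  define B where "B = cbox a b"
  have [measurable]: "B \<in> sets borel" by (simp add: B_def)
  have Bfin: "emeasure lborel B < \<infinity>" unfolding B_def infinity_ennreal_def[symmetric] by (rule emeasure_bounded_finite) simp
  have indB: "integrable lborel (\<lambda>y. indicator B y :: real)"
    using Bfin by simp
  define \<epsilon> where "\<epsilon> n = 1 / real (Suc n)" for n
  have \<epsilon>: "\<epsilon> n > 0" for n by (simp add: \<epsilon>_def)
  have \<epsilon>lim: "\<epsilon> \<longlonglongrightarrow> 0"
    using LIMSEQ_inverse_real_of_nat by (simp add: \<epsilon>_def[abs_def] inverse_eq_divide)
  define w where "w n \<xi> = complex_of_real (gauss ((2 * pi * \<epsilon> n) *\<^sub>R \<xi>))" for n and \<xi> :: "real^'n"
  have [measurable]: "w n \<in> borel_measurable borel" for n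
    unfolding w_def by measurable
  have w1: "cmod (w n \<xi>) \<le> 1" for n \<xi>
    by (simp add: w_def gauss_le_1)
  have w_int: "integrable lborel (w n)" for n
  proof -
    have "integrable lborel (\<lambda>\<xi>::real^'n. gauss ((2 * pi * \<epsilon> n) *\<^sub>R \<xi>))"
      using integrable_lborel_scale[OF _ gauss_integrable, of "2 * pi * \<epsilon> n" 0] \<epsilon>[of n] by simp
    then show ?thesis
      unfolding w_def by simp
  qed
  have wlim: "(\<lambda>n. w n \<xi>) \<longlonglongrightarrow> 1" for \<xi>
  proof -
    have "(\<lambda>n. complex_of_real (exp (- (((2 * pi * \<epsilon> n) *\<^sub>R \<xi>) \<bullet> ((2 * pi * \<epsilon> n) *\<^sub>R \<xi>)) / 2))) \<longlonglongrightarrow>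
        complex_of_real (exp (- (((2 * pi * 0) *\<^sub>R \<xi>) \<bullet> ((2 * pi * 0) *\<^sub>R \<xi>)) / 2))"
      by (intro tendsto_intros \<epsilon>lim) simp
    then show ?thesis
      by (simp add: w_def gauss_def)
  qed
  define A where "A n y = (LINT \<xi>|lborel. F \<xi> * wave (- (y \<bullet> \<xi>)) * w n \<xi>)" for n y
  have [measurable]: "A n \<in> borel_measurable borel" for n
    unfolding A_def by measurable
  define M where "M = (LINT \<xi>|lborel. norm (F \<xi>))"
  have AM: "norm (A n y) \<le> M" for n y
    unfolding A_def M_def
  proof (rule order_trans[OF integral_norm_bound integral_mono])
    show "norm (F \<xi> * wave (- (y \<bullet> \<xi>)) * w n \<xi>) \<le> norm (F \<xi>)" for \<xi>
      using w1[of n \<xi>] by (simp add: norm_mult mult_left_le)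
    show "integrable lborel (\<lambda>\<xi>. norm (F \<xi>))"
      using F by simp
    have "integrable lborel (\<lambda>\<xi>. F \<xi> * (wave (- (y \<bullet> \<xi>)) * w n \<xi>))"
      using w1 by (intro integrable_times_bounded[OF F, where B = 1]) (auto simp: norm_mult)
    then show "integrable lborel (\<lambda>\<xi>. norm (F \<xi> * wave (- (y \<bullet> \<xi>)) * w n \<xi>))"
      by (simp add: mult.assoc)
  qed
  have AG: "(\<lambda>n. A n y) \<longlonglongrightarrow> G y" for y
    unfolding A_def G_def
  proof (rule integral_dominated_convergence[where w = "\<lambda>\<xi>. norm (F \<xi>)"])
    show "AE \<xi> in lborel. (\<lambda>n. F \<xi> * wave (- (y \<bullet> \<xi>)) * w n \<xi>) \<longlonglongrightarrow> F \<xi> * wave (- (y \<bullet> \<xi>))"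
    proof (rule AE_I2)
      fix \<xi>
      have "(\<lambda>n. F \<xi> * wave (- (y \<bullet> \<xi>)) * w n \<xi>) \<longlonglongrightarrow> F \<xi> * wave (- (y \<bullet> \<xi>)) * 1"
        by (intro tendsto_intros wlim)
      then show "(\<lambda>n. F \<xi> * wave (- (y \<bullet> \<xi>)) * w n \<xi>) \<longlonglongrightarrow> F \<xi> * wave (- (y \<bullet> \<xi>))" by simp
    qed
    show "AE \<xi> in lborel. norm (F \<xi> * wave (- (y \<bullet> \<xi>)) * w n \<xi>) \<le> norm (F \<xi>)" for n
      using w1 by (intro AE_I2) (simp add: norm_mult mult_left_le)
  qed (use F in auto)
  have limG: "(\<lambda>n. LINT y|lborel. indicator B y *\<^sub>R A n y) \<longlonglongrightarrow> (LINT y|lborel. indicator B y *\<^sub>R G y)"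
  proof (rule integral_dominated_convergence[where w = "\<lambda>y. M * indicator B y"])
    show "integrable lborel (\<lambda>y. M * indicator B y)"
      using indB by simp
    show "AE y in lborel. (\<lambda>n. indicator B y *\<^sub>R A n y) \<longlonglongrightarrow> indicator B y *\<^sub>R G y"
      by (intro AE_I2 tendsto_intros AG)
    show "AE y in lborel. norm (indicator B y *\<^sub>R A n y) \<le> M * indicator B y" for n
      using AM by (intro AE_I2) (auto simp: indicator_def)
  qed auto
  have Ak: "A n y = (LINT x|lborel. f x * complex_of_real (gauss_kernel (\<epsilon> n) (y - x)))" for n y
  proof -
      let ?h = "\<lambda>x \<xi>. f x * wave (x \<bullet> \<xi>) * (wave (- (y \<bullet> \<xi>)) * w n \<xi>)"
    have "integrable (lborel \<Otimes>\<^sub>M lborel) (case_prod ?h)"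
    proof (rule lborel_pair.Fubini_integrable)
      have "(LINT \<xi>|lborel. norm (case_prod ?h (x, \<xi>))) = norm (f x) * (LINT \<xi>|lborel. norm (w n \<xi>))" for x
        by (simp add: norm_mult)
      then show "integrable lborel (\<lambda>x. LINT \<xi>|lborel. norm (case_prod ?h (x, \<xi>)))"
        using f by simp
      have "integrable lborel (\<lambda>\<xi>. w n \<xi> * (f x * wave (x \<bullet> \<xi>) * wave (- (y \<bullet> \<xi>))))" for x
        by (rule integrable_times_bounded[OF w_int, where B = "norm (f x)"]) (auto simp: norm_mult)
      then show "AE x in lborel. integrable lborel (\<lambda>\<xi>. case_prod ?h (x, \<xi>))"
        by (simp add: mult_ac)
    qed measurable
    from lborel_pair.Fubini_integral[OF this]
    have "(LINT \<xi>|lborel. LINT x|lborel. ?h x \<xi>) = (LINT x|lborel. LINT \<xi>|lborel. ?h x \<xi>)" .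
    moreover have "A n y = (LINT \<xi>|lborel. LINT x|lborel. ?h x \<xi>)"
      unfolding A_def F_def by (simp add: mult.assoc[symmetric])
    moreover have "(LINT \<xi>|lborel. ?h x \<xi>) = f x * complex_of_real (gauss_kernel (\<epsilon> n) (y - x))" for x
    proof -
      have eq: "?h x \<xi> = f x * (complex_of_real (gauss ((2 * pi * \<epsilon> n) *\<^sub>R \<xi>)) * wave (- ((y - x) \<bullet> \<xi>)))" for \<xi>
        by (simp add: w_def inner_diff_left wave_add[symmetric] mult_ac)
      show ?thesis
        unfolding eq integral_mult_right_zero gauss_kernel_fourier[OF \<epsilon>[of n], of "y - x"] ..
    qed
    ultimately show ?thesis by simp
  qed
  define m where "m n x = (LINT y|lborel. indicator B y * gauss_kernel (\<epsilon> n) (y - x))" for n x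
  have [measurable]: "m n \<in> borel_measurable borel" for n
    unfolding m_def by measurable
  define c where "c = sqrt (2 * pi) ^ CARD('n)"
  have c: "c > 0" by (simp add: c_def)
  have m_eq: "m n x = (LINT z|lborel. indicator B (x + \<epsilon> n *\<^sub>R z) * (gauss z / c))" for n x
  proof -
    have e1: "indicator B (x + \<epsilon> n *\<^sub>R z) * gauss_kernel (\<epsilon> n) ((x + \<epsilon> n *\<^sub>R z) - x) =
        (1 / \<epsilon> n ^ CARD('n)) * (indicator B (x + \<epsilon> n *\<^sub>R z) * (gauss z / c))" for z
      using \<epsilon>[of n] by (simp add: gauss_kernel_def c_def power_mult_distrib)
    have e2: "(LINT z|lborel. indicator B (x + \<epsilon> n *\<^sub>R z) * gauss_kernel (\<epsilon> n) ((x + \<epsilon> n *\<^sub>R z) - x)) =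
        (1 / \<epsilon> n ^ CARD('n)) *\<^sub>R m n x"
      unfolding m_def by (rule integral_lborel_scale[OF \<epsilon>]) measurable
    have "(1 / \<epsilon> n ^ CARD('n)) * (LINT z|lborel. indicator B (x + \<epsilon> n *\<^sub>R z) * (gauss z / c)) = (1 / \<epsilon> n ^ CARD('n)) * m n x"
      using e2 unfolding e1 integral_mult_right_zero real_scaleR_def .
    moreover have nz: "1 / \<epsilon> n ^ CARD('n) \<noteq> 0"
      using \<epsilon>[of n] by simp
    ultimately show ?thesis
      unfolding mult_left_cancel[OF nz] by simp
  qed
  have gc: "integrable lborel (\<lambda>z::real^'n. gauss z / c)" "(LINT z|lborel. gauss (z::real^'n) / c) = 1"
    using gauss_integrable[where 'n = 'n] c by (simp_all add: integral_gauss c_def)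
  have m01: "norm (m n x) \<le> 1" for n x
  proof -
    have "norm (m n x) \<le> (LINT z|lborel. norm (indicator B (x + \<epsilon> n *\<^sub>R z) * (gauss z / c)))"
      unfolding m_eq by (rule integral_norm_bound)
    also have "\<dots> \<le> (LINT z|lborel. gauss (z::real^'n) / c)"
    proof (rule integral_mono[OF _ gc(1)])
      show "norm (indicator B (x + \<epsilon> n *\<^sub>R z) * (gauss z / c)) \<le> gauss z / c" for z
        using c by (auto simp: indicator_def)
      show "integrable lborel (\<lambda>z. norm (indicator B (x + \<epsilon> n *\<^sub>R z) * (gauss z / c)))"
        by (rule Bochner_Integration.integrable_bound[OF gc(1)]) (use c in \<open>auto simp: indicator_def\<close>)
    qed
    finally show ?thesis
      by (simp only: gc(2))
  qed
  have mlim: "AE x in lborel. (\<lambda>n. m n x) \<longlonglongrightarrow> indicator B x"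
  proof -
    have "frontier B \<in> null_sets lborel"
    proof -
      have "negligible (frontier B)"
        unfolding B_def by (rule negligible_convex_frontier) simp
      then have "frontier B \<in> null_sets lebesgue"
        by (simp add: negligible_iff_null_sets)
      moreover have "frontier B \<in> sets borel"
        by (intro borel_closed frontier_closed)
      ultimately show ?thesis
        by (simp add: null_sets_completion_iff)
    qed
    then have "AE x in lborel. x \<notin> frontier B"
      by (rule AE_not_in)
    then show ?thesis
    proof eventually_elim
      case (elim x)
      have "(\<lambda>n. m n x) \<longlonglongrightarrow> (LINT z|lborel. indicator B x * (gauss (z::real^'n) / c))"
        unfolding m_eq
      proof (rule integral_dominated_convergence[where w = "\<lambda>z. gauss z / c"])
        show "AE z in lborel. (\<lambda>n. indicator B (x + \<epsilon> n *\<^sub>R z) * (gauss z / c)) \<longlonglongrightarrow> indicator B x * (gauss z / c)"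
        proof (rule AE_I2)
          fix z :: "real^'n"
          have "(\<lambda>n. x + \<epsilon> n *\<^sub>R z) \<longlonglongrightarrow> x + 0 *\<^sub>R z"
            by (intro tendsto_intros \<epsilon>lim)
          then have lim: "(\<lambda>n. x + \<epsilon> n *\<^sub>R z) \<longlonglongrightarrow> x" by simp
          have "\<forall>\<^sub>F n in sequentially. indicator B (x + \<epsilon> n *\<^sub>R z) = (indicator B x :: real)"
          proof (cases "x \<in> B")
            case True
            then have "x \<in> interior B"
              using elim by (auto simp: frontier_def B_def)
            then have "\<forall>\<^sub>F n in sequentially. x + \<epsilon> n *\<^sub>R z \<in> interior B"
              by (rule topological_tendstoD[OF lim open_interior])
            then show ?thesis
              by eventually_elim (use True interior_subset in \<open>auto simp: indicator_def\<close>)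
          next
            case False
            then have "\<forall>\<^sub>F n in sequentially. x + \<epsilon> n *\<^sub>R z \<in> - B"
              by (intro topological_tendstoD[OF lim]) (auto simp: B_def open_Compl)
            then show ?thesis
              by eventually_elim (use False in \<open>auto simp: indicator_def\<close>)
          qed
          then have "(\<lambda>n. indicator B (x + \<epsilon> n *\<^sub>R z) :: real) \<longlonglongrightarrow> indicator B x"
            by (rule tendsto_eventually)
          then show "(\<lambda>n. indicator B (x + \<epsilon> n *\<^sub>R z) * (gauss z / c)) \<longlonglongrightarrow> indicator B x * (gauss z / c)"
            by (intro tendsto_intros)
        qed
        show "AE z in lborel. norm (indicator B (x + \<epsilon> n *\<^sub>R z) * (gauss z / c)) \<le> gauss z / c" for n
          using c by (intro AE_I2) (auto simp: indicator_def)
      qed (use gc in auto)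
      then show ?case
        by (simp only: integral_mult_right_zero gc(2) mult_1_right)
    qed
  qed
  have "(LINT y|lborel. indicator B y *\<^sub>R A n y) = (LINT x|lborel. f x * complex_of_real (m n x))" for n
  proof -
      define k where "k y x = indicator B y * gauss_kernel (\<epsilon> n) (y - x)" for y x
    have k0: "0 \<le> k y x" for y x
      using \<epsilon>[of n] by (simp add: k_def gauss_kernel_def)
    have [measurable]: "(\<lambda>p. k (snd p) (fst p)) \<in> borel_measurable (borel \<Otimes>\<^sub>M borel)"
      unfolding k_def by measurable
    have [measurable]: "(\<lambda>y. k y x) \<in> borel_measurable borel" for x
      unfolding k_def by measurable
    have k_int: "integrable lborel (\<lambda>y. k y x)" for x
    proof (rule Bochner_Integration.integrable_bound)
      show "integrable lborel (\<lambda>y. indicator B y * (1 / (\<epsilon> n * sqrt (2 * pi)) ^ CARD('n)))"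
        using indB by (rule integrable_mult_left)
      have "gauss_kernel (\<epsilon> n) z \<le> 1 / (\<epsilon> n * sqrt (2 * pi)) ^ CARD('n)" for z :: "real^'n"
        using \<epsilon>[of n] unfolding gauss_kernel_def by (intro divide_right_mono gauss_le_1) simp
      then show "AE y in lborel. norm (k y x) \<le> norm (indicator B y * (1 / (\<epsilon> n * sqrt (2 * pi)) ^ CARD('n)))"
        using k0 \<epsilon>[of n] by (intro AE_I2) (auto simp: k_def indicator_def abs_of_nonneg)
    qed measurable
    let ?h = "\<lambda>x y. f x * complex_of_real (k y x)"
    have int: "integrable (lborel \<Otimes>\<^sub>M lborel) (case_prod ?h)"
    proof (rule lborel_pair.Fubini_integrable)
      have eq: "(LINT y|lborel. norm (case_prod ?h (x, y))) = norm (f x * complex_of_real (m n x))" for x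
      proof -
        have "(LINT y|lborel. norm (case_prod ?h (x, y))) = norm (f x) * (LINT y|lborel. k y x)"
          using k0 by (simp add: norm_mult)
        moreover have "0 \<le> m n x"
          unfolding m_def k_def[symmetric] by (intro Bochner_Integration.integral_nonneg k0)
        ultimately show ?thesis
          by (simp add: norm_mult m_def k_def)
      qed
      have "integrable lborel (\<lambda>x. f x * complex_of_real (m n x))"
        using m01 by (intro integrable_times_bounded[OF f, where B = 1]) auto
      then show "integrable lborel (\<lambda>x. LINT y|lborel. norm (case_prod ?h (x, y)))"
        unfolding eq by (rule integrable_norm)
      show "AE x in lborel. integrable lborel (\<lambda>y. case_prod ?h (x, y))"
        using k_int by (simp add: integrable_of_real)
      show "case_prod ?h \<in> borel_measurable (lborel \<Otimes>\<^sub>M lborel)"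
        unfolding case_prod_unfold by measurable
    qed
    have "(LINT y|lborel. indicator B y *\<^sub>R A n y) = (LINT y|lborel. LINT x|lborel. ?h x y)"
    proof (rule Bochner_Integration.integral_cong[OF refl])
      fix y
      have "indicator B y *\<^sub>R A n y = (LINT x|lborel. indicator B y *\<^sub>R (f x * complex_of_real (gauss_kernel (\<epsilon> n) (y - x))))"
        unfolding Ak by simp
      also have "\<dots> = (LINT x|lborel. ?h x y)"
        by (intro Bochner_Integration.integral_cong) (auto simp: k_def scaleR_conv_of_real)
      finally show "indicator B y *\<^sub>R A n y = (LINT x|lborel. ?h x y)" .
    qed
    also have "\<dots> = (LINT x|lborel. LINT y|lborel. ?h x y)"
      by (rule lborel_pair.Fubini_integral[OF int])
    also have "\<dots> = (LINT x|lborel. f x * complex_of_real (m n x))"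
      by (intro Bochner_Integration.integral_cong) (auto simp: m_def k_def integral_complex_of_real[symmetric])
    finally show ?thesis .
  qed
  moreover have "(\<lambda>n. LINT x|lborel. f x * complex_of_real (m n x)) \<longlonglongrightarrow> (LINT x|lborel. f x * complex_of_real (indicator B x))"
  proof (rule integral_dominated_convergence[where w = "\<lambda>x. norm (f x)"])
    show "AE x in lborel. (\<lambda>n. f x * complex_of_real (m n x)) \<longlonglongrightarrow> f x * complex_of_real (indicator B x)"
      using mlim by eventually_elim (intro tendsto_intros)
    show "AE x in lborel. norm (f x * complex_of_real (m n x)) \<le> norm (f x)" for n
      using m01 by (intro AE_I2) (simp add: norm_mult mult_left_le)
  qed (use f in auto)
  ultimately have "(LINT y|lborel. indicator B y *\<^sub>R G y) = (LINT x|lborel. f x * complex_of_real (indicator B x))"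
    using LIMSEQ_unique[OF limG] by simp
  then show ?thesis
    by (simp add: B_def scaleR_conv_of_real mult.commute)
qed

text \<open>Lebesgue's differentiation theorem recovers the functions from their integrals.\<close>

lemma AE_eq_if_box_integrals_eq:
  fixes f g :: "real^'n \<Rightarrow> complex"
  assumes f: "\<And>a b. integrable lborel (\<lambda>y. indicator (cbox a b) y *\<^sub>R f y)"
    and g: "\<And>a b. integrable lborel (\<lambda>y. indicator (cbox a b) y *\<^sub>R g y)"
    and eq: "\<And>a b. (LINT y|lborel. indicator (cbox a b) y *\<^sub>R f y) = (LINT y|lborel. indicator (cbox a b) y *\<^sub>R g y)"
  shows "AE y in lebesgue. f y = g y"
proof -
  define u where "u y = f y - g y" for y
  have u: "set_integrable lborel (cbox a b) u" for a b
    unfolding set_integrable_def u_def scaleR_diff_right by (intro Bochner_Integration.integrable_diff f g)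
  have 0: "integral (cbox a b) u = 0" for a b
  proof -
    have "integral (cbox a b) u = (LINT y:cbox a b|lborel. u y)"
      using set_borel_integral_eq_integral(2)[OF u] by simp
    also have "\<dots> = 0"
      unfolding set_lebesgue_integral_def u_def scaleR_diff_right
      by (subst Bochner_Integration.integral_diff[OF f g]) (simp add: eq)
    finally show ?thesis .
  qed
  have "u integrable_on cbox a b" for a b
    using set_borel_integral_eq_integral(1)[OF u] .
  from integrable_ccontinuous_explicit[OF this] obtain N where N: "negligible N"
    and lim: "\<And>x e. x \<notin> N \<Longrightarrow> 0 < e \<Longrightarrow> \<exists>d>0. \<forall>h. 0 < h \<and> h < d \<longrightarrow>
        norm (integral (cbox x (x + h *\<^sub>R One)) u /\<^sub>R h ^ DIM(real^'n) - u x) < e"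
    by blast
  have "u x = 0" if xN: "x \<notin> N" for x
  proof (rule ccontr)
    assume "u x \<noteq> 0"
    then obtain d where "d > 0" "\<And>h. 0 < h \<Longrightarrow> h < d \<Longrightarrow> norm (0 /\<^sub>R h ^ DIM(real^'n) - u x) < norm (u x)"
      using lim[OF xN, of "norm (u x)"] unfolding 0 by auto
    from this(2)[of "d / 2"] \<open>d > 0\<close> show False by simp
  qed
  moreover have "N \<in> null_sets lebesgue"
    using N by (simp add: negligible_iff_null_sets)
  ultimately show ?thesis
    by (intro AE_I'[of N]) (auto simp: u_def)
qed

text \<open>Fubini's theorem applies to Borel functions, whereas \<open>fourier\<close> and \<open>L2_inner\<close> are integrals over the
  completed measure.\<close>

lemma borel_representative:
  fixes f :: "'a::euclidean_space \<Rightarrow> complex"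
  assumes f: "integrable lebesgue f"
  obtains f' where "integrable lborel f'" "AE x in lebesgue. f x = f' x"
proof -
  have "(\<lambda>x. Re (f x)) \<in> borel_measurable lebesgue" "(\<lambda>x. Im (f x)) \<in> borel_measurable lebesgue"
    using f by auto
  then obtain r i where r: "r \<in> borel_measurable lborel" "AE x in lborel. Re (f x) = r x"
    and i: "i \<in> borel_measurable lborel" "AE x in lborel. Im (f x) = i x"
    using completion_ex_borel_measurable_real by metis
  define f' where "f' x = Complex (r x) (i x)" for x
  have [measurable]: "f' \<in> borel_measurable lborel"
    unfolding f'_def Complex_eq using r i by measurable
  have "AE x in lborel. f x = f' x"
    using r(2) i(2) by eventually_elim (simp add: f'_def complex_eq_iff)
  then have ae: "AE x in lebesgue. f x = f' x"
    by (rule AE_completion)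
  have "integrable lebesgue f'"
    by (rule integrable_cong_AE_imp[OF f _ ae]) (simp add: measurable_completion)
  then have "integrable lborel f'"
    by (subst (asm) integrable_completion) auto
  then show ?thesis
    using ae that by blast
qed

lemma measurable_wave_lebesgue: "(\<lambda>x. wave (x \<bullet> \<xi>)) \<in> borel_measurable lebesgue"
  by (rule measurable_completion) simp

lemma fourier_inversion:
  fixes f :: "real^'n \<Rightarrow> complex"
  assumes f: "integrable lebesgue f" and F: "integrable lborel (fourier f)"
  shows "AE y in lebesgue. f y = (LINT \<xi>|lborel. fourier f \<xi> * wave (- (y \<bullet> \<xi>)))"
proof -
  obtain f' where f': "integrable lborel f'" and ae: "AE x in lebesgue. f x = f' x"
    using borel_representative[OF f] by blast
  have [measurable]: "f' \<in> borel_measurable borel" "fourier f \<in> borel_measurable borel"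
    using f' F by (auto dest: borel_measurable_integrable)
  have FT: "fourier f = (\<lambda>\<xi>. LINT x|lborel. f' x * wave (x \<bullet> \<xi>))"
  proof
    fix \<xi>
    have "fourier f \<xi> = (LINT x|lebesgue. f' x * wave (x \<bullet> \<xi>))"
      unfolding fourier_wave
    proof (rule integral_cong_AE)
      show "(\<lambda>x. f x * wave (x \<bullet> \<xi>)) \<in> borel_measurable lebesgue"
        using f measurable_wave_lebesgue[of \<xi>] by measurable
      show "(\<lambda>x. f' x * wave (x \<bullet> \<xi>)) \<in> borel_measurable lebesgue"
        by (rule measurable_completion) simp
      show "AE x in lebesgue. f x * wave (x \<bullet> \<xi>) = f' x * wave (x \<bullet> \<xi>)"
        using ae by eventually_elim simp
    qed
    then show "fourier f \<xi> = (LINT x|lborel. f' x * wave (x \<bullet> \<xi>))"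
      by (simp add: integral_completion)
  qed
  define G where "G y = (LINT \<xi>|lborel. fourier f \<xi> * wave (- (y \<bullet> \<xi>)))" for y
  have [measurable]: "G \<in> borel_measurable borel"
    unfolding G_def by measurable
  have "AE y in lebesgue. f' y = G y"
  proof (rule AE_eq_if_box_integrals_eq)
    fix a b :: "real^'n"
    show "integrable lborel (\<lambda>y. indicator (cbox a b) y *\<^sub>R f' y)"
      using f' by (intro integrable_mult_indicator) auto
    have "norm (G y) \<le> (LINT \<xi>|lborel. norm (fourier f \<xi>))" for y
      unfolding G_def by (rule order_trans[OF integral_norm_bound]) (simp add: norm_mult)
    moreover have "integrable lborel (\<lambda>y::real^'n. complex_of_real (indicator (cbox a b) y))"
    proof (rule integrable_of_real)
      have "emeasure lborel (cbox a b) < \<infinity>"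
        unfolding infinity_ennreal_def[symmetric] by (rule emeasure_bounded_finite) simp
      then show "integrable lborel (indicator (cbox a b) :: real^'n \<Rightarrow> real)"
        by simp
    qed
    ultimately have "integrable lborel (\<lambda>y. complex_of_real (indicator (cbox a b) y) * G y)"
      by (intro integrable_times_bounded) auto
    then show "integrable lborel (\<lambda>y. indicator (cbox a b) y *\<^sub>R G y)"
      by (simp add: scaleR_conv_of_real)
    show "(LINT y|lborel. indicator (cbox a b) y *\<^sub>R f' y) = (LINT y|lborel. indicator (cbox a b) y *\<^sub>R G y)"
      using inversion_on_boxes[OF f' F[unfolded FT], of a b] by (simp add: G_def FT)
  qed
  then show ?thesis
    using ae by eventually_elim (simp add: G_def)
qed

text \<open>Inversion bounds \<open>f\<close> almost everywhere, and bounded integrable functions are square integrable.\<close>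

lemma L2_of_integrable_fourier:
  fixes f :: "real^'n \<Rightarrow> complex"
  assumes f: "integrable lebesgue f" and F: "integrable lborel (fourier f)"
  shows "f \<in> L2"
proof -
  define M where "M = (LINT \<xi>|lborel. norm (fourier f \<xi>))"
  have "AE y in lebesgue. norm (f y) \<le> M"
    using fourier_inversion[OF f F]
  proof eventually_elim
    case (elim y)
    then show ?case
      using integral_norm_bound[of lborel "\<lambda>\<xi>. fourier f \<xi> * wave (- (y \<bullet> \<xi>))"] by (simp add: norm_mult M_def)
  qed
  then have "AE y in lebesgue. norm (norm (f y) powr 2) \<le> norm (M * norm (f y))"
  proof eventually_elim
    case (elim y)
    then have "norm (f y) * norm (f y) \<le> M * norm (f y)" "0 \<le> M"
      by (auto intro: mult_right_mono order_trans[OF norm_ge_zero])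
    then show ?case
      by (simp add: power2_eq_square)
  qed
  moreover have "integrable lebesgue (\<lambda>y. M * norm (f y))"
    using f by simp
  moreover have "(\<lambda>y. norm (f y) powr 2) \<in> borel_measurable lebesgue"
    using f by measurable
  ultimately have "integrable lebesgue (\<lambda>y. norm (f y) powr 2)"
    using Bochner_Integration.integrable_bound by blast
  then show ?thesis
    using f by (simp add: Lp_def)
qed

text \<open>Insert the inversion formula for \<open>f\<close> and interchange the integrals.\<close>

lemma L2_inner_fourier:
  fixes f g :: "real^'n \<Rightarrow> complex"
  assumes f: "integrable lebesgue f" and F: "integrable lborel (fourier f)" and g: "integrable lebesgue g"
  shows "L2_inner f g = (LINT \<xi>|lborel. fourier f \<xi> * cnj (fourier g \<xi>))"
proof -
  obtain g' where g': "integrable lborel g'" and ae: "AE x in lebesgue. g x = g' x"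
    using borel_representative[OF g] by blast
  have [measurable]: "g' \<in> borel_measurable borel" "fourier f \<in> borel_measurable borel"
    using g' F by (auto dest: borel_measurable_integrable)
  define G where "G y = (LINT \<xi>|lborel. fourier f \<xi> * wave (- (y \<bullet> \<xi>)))" for y
  have [measurable]: "G \<in> borel_measurable borel"
    unfolding G_def by measurable
  have "L2_inner f g = (LINT y|lebesgue. G y * cnj (g' y))"
    unfolding L2_inner_def
  proof (rule integral_cong_AE)
    have [measurable]: "f \<in> borel_measurable lebesgue" "g \<in> borel_measurable lebesgue"
      using f g by auto
    show "(\<lambda>y. f y * cnj (g y)) \<in> borel_measurable lebesgue"
      by measurable
    show "(\<lambda>y. G y * cnj (g' y)) \<in> borel_measurable lebesgue"
      by (rule measurable_completion) simp
    show "AE y in lebesgue. f y * cnj (g y) = G y * cnj (g' y)"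
      using ae fourier_inversion[OF f F] by eventually_elim (simp add: G_def)
  qed
  also have "\<dots> = (LINT y|lborel. G y * cnj (g' y))"
    by (rule integral_completion) measurable
  also have "\<dots> = (LINT y|lborel. LINT \<xi>|lborel. fourier f \<xi> * wave (- (y \<bullet> \<xi>)) * cnj (g' y))"
    unfolding G_def by simp
  also have "\<dots> = (LINT \<xi>|lborel. LINT y|lborel. fourier f \<xi> * wave (- (y \<bullet> \<xi>)) * cnj (g' y))"
  proof (rule lborel_pair.Fubini_integral)
    show "integrable (lborel \<Otimes>\<^sub>M lborel) (\<lambda>(\<xi>, y). fourier f \<xi> * wave (- (y \<bullet> \<xi>)) * cnj (g' y))"
    proof (rule lborel_pair.Fubini_integrable)
      show "integrable lborel (\<lambda>\<xi>. LINT y|lborel. norm (case (\<xi>, y) of (\<xi>, y) \<Rightarrow> fourier f \<xi> * wave (- (y \<bullet> \<xi>)) * cnj (g' y)))"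
        using F by (simp add: norm_mult)
      have "integrable lborel (\<lambda>y. cnj (g' y) * (fourier f \<xi> * wave (- (y \<bullet> \<xi>))))" for \<xi>
        using g' by (intro integrable_times_bounded[where B = "norm (fourier f \<xi>)"]) (auto simp: norm_mult)
      then show "AE \<xi> in lborel. integrable lborel (\<lambda>y. case (\<xi>, y) of (\<xi>, y) \<Rightarrow> fourier f \<xi> * wave (- (y \<bullet> \<xi>)) * cnj (g' y))"
        by (simp add: mult_ac)
    qed measurable
  qed
  also have "\<dots> = (LINT \<xi>|lborel. fourier f \<xi> * cnj (fourier g \<xi>))"
  proof (rule Bochner_Integration.integral_cong[OF refl])
    fix \<xi>
    have "fourier g \<xi> = (LINT y|lebesgue. g' y * wave (y \<bullet> \<xi>))"
      unfolding fourier_wave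
    proof (rule integral_cong_AE)
      show "(\<lambda>x. g x * wave (x \<bullet> \<xi>)) \<in> borel_measurable lebesgue"
        using g measurable_wave_lebesgue[of \<xi>] by measurable
      show "(\<lambda>x. g' x * wave (x \<bullet> \<xi>)) \<in> borel_measurable lebesgue"
        by (rule measurable_completion) simp
      show "AE x in lebesgue. g x * wave (x \<bullet> \<xi>) = g' x * wave (x \<bullet> \<xi>)"
        using ae by eventually_elim simp
    qed
    also have "\<dots> = (LINT y|lborel. g' y * wave (y \<bullet> \<xi>))"
      by (rule integral_completion) simp
    finally have "cnj (fourier g \<xi>) = (LINT y|lborel. cnj (g' y * wave (y \<bullet> \<xi>)))"
      using integral_bounded_linear[OF bounded_linear_cnj integrable_times_bounded[OF g', of "\<lambda>y. wave (y \<bullet> \<xi>)" 1]]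
      by simp
    then have "cnj (fourier g \<xi>) = (LINT y|lborel. wave (- (y \<bullet> \<xi>)) * cnj (g' y))"
      by (simp add: cnj_wave mult.commute)
    then show "(LINT y|lborel. fourier f \<xi> * wave (- (y \<bullet> \<xi>)) * cnj (g' y)) = fourier f \<xi> * cnj (fourier g \<xi>)"
      by (simp add: mult.assoc)
  qed
  finally show ?thesis .
qed

section \<open>Smooth bump functions\<close>

text \<open>The functions \<open>exp (- 1 / u) / u\<^sup>k\<close>, extended by zero, span a space that is closed under
  differentiation.\<close>

definition exp_flat :: "nat \<Rightarrow> real \<Rightarrow> real" where
  "exp_flat k u = (if u > 0 then exp (- (1 / u)) / u ^ k else 0)"

lemma exp_flat_shift: "exp_flat k u = u * exp_flat (Suc k) u"
  by (simp add: exp_flat_def)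

lemma exp_flat_deriv:
  "(exp_flat k has_real_derivative exp_flat (k + 2) u - real k * exp_flat (k + 1) u) (at u)"
proof -
  consider "u > 0" | "u < 0" | "u = 0" by linarith
  then show ?thesis
  proof cases
    case 1
    have "((\<lambda>u. exp (- (1 / u)) / u ^ k) has_real_derivative
        exp (- (1 / u)) / u ^ (k + 2) - real k * (exp (- (1 / u)) / u ^ (k + 1))) (at u)"
    proof -
      have d1: "((\<lambda>u. exp (- (1 / u))) has_real_derivative exp (- (1 / u)) * inverse u ^ 2) (at u)"
        using 1 by (auto intro!: derivative_eq_intros simp: power2_eq_square field_simps)
      have "((\<lambda>u. inverse u ^ k) has_real_derivative real k * (- (inverse u ^ Suc (Suc 0)) * inverse u ^ (k - Suc 0))) (at u)"
        using 1 by (intro DERIV_power DERIV_inverse) simp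
      moreover have "real k * (- (inverse u ^ Suc (Suc 0)) * inverse u ^ (k - Suc 0)) = - real k * inverse u ^ (k + 1)"
        by (cases k) (simp_all add: algebra_simps)
      ultimately have d2: "((\<lambda>u. inverse u ^ k) has_real_derivative - real k * inverse u ^ (k + 1)) (at u)"
        by (simp only:)
      have eq: "exp (- (1 / u)) * inverse u ^ 2 * inverse u ^ k + - real k * inverse u ^ (k + 1) * exp (- (1 / u)) =
          exp (- (1 / u)) / u ^ (k + 2) - real k * (exp (- (1 / u)) / u ^ (k + 1))"
        by (simp add: divide_inverse power_inverse power_add power2_eq_square mult_ac)
      have fn: "(\<lambda>u::real. exp (- (1 / u)) / u ^ k) = (\<lambda>u. exp (- (1 / u)) * inverse u ^ k)"
        by (rule ext) (simp only: divide_inverse power_inverse)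
      show ?thesis
        unfolding fn eq[symmetric] by (rule DERIV_mult[OF d1 d2])
    qed
    moreover have "\<forall>\<^sub>F x in nhds u. exp_flat k x = exp (- (1 / x)) / x ^ k"
      using eventually_nhds_in_open[of "{0<..}" u] 1 by (auto elim!: eventually_mono simp: exp_flat_def)
    ultimately show ?thesis
      using 1 by (subst DERIV_cong_ev[OF refl _ refl]) (auto simp: exp_flat_def)
  next
    case 2
    have "\<forall>\<^sub>F x in nhds u. exp_flat k x = 0"
      using eventually_nhds_in_open[of "{..<0}" u] 2 by (auto elim!: eventually_mono simp: exp_flat_def)
    then show ?thesis
      using 2 by (subst DERIV_cong_ev[OF refl _ refl]) (auto simp: exp_flat_def)
  next
    case 3
    have "((\<lambda>h. exp_flat k h / h) \<longlongrightarrow> 0) (at 0)"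
    proof (rule filterlim_split_at)
      have "\<forall>\<^sub>F h::real in at_left 0. 0 = exp_flat k h / h"
        by (rule eventually_mono[OF eventually_at_left_real[of "-1" 0]]) (auto simp: exp_flat_def)
      then show "((\<lambda>h. exp_flat k h / h) \<longlongrightarrow> 0) (at_left 0)"
        by (rule Lim_transform_eventually[OF tendsto_const])
      have "((\<lambda>h::real. inverse h ^ Suc k / exp (inverse h)) \<longlongrightarrow> 0) (at_right 0)"
        by (rule filterlim_compose[OF tendsto_power_div_exp_0 filterlim_inverse_at_top_right])
      moreover have "\<forall>\<^sub>F h::real in at_right 0. inverse h ^ Suc k / exp (inverse h) = exp_flat k h / h"
        by (rule eventually_mono[OF eventually_at_right_real[of 0 1]])
          (auto simp: exp_flat_def exp_minus inverse_eq_divide field_simps)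
      ultimately show "((\<lambda>h. exp_flat k h / h) \<longlongrightarrow> 0) (at_right 0)"
        by (rule Lim_transform_eventually)
    qed
    then show ?thesis
      using 3 by (simp add: has_field_derivative_iff exp_flat_def)
  qed
qed

text \<open>The derivatives of \<open>exp (- 1 / (1 - t\<^sup>2))\<close> are polynomial multiples of
  \<open>exp_flat (2 * n) (1 - t\<^sup>2)\<close>; the recursion below is the product rule.\<close>

primrec bump_poly :: "nat \<Rightarrow> real poly" where
  "bump_poly 0 = 1"
| "bump_poly (Suc n) = pderiv (bump_poly n) * [:1, 0, -1:] ^ 2 -
     [:0, 2:] * bump_poly n * (1 - smult (real (2 * n)) [:1, 0, -1:])"

definition bump :: "nat \<Rightarrow> real \<Rightarrow> real" where
  "bump n t = poly (bump_poly n) t * exp_flat (2 * n) (1 - t\<^sup>2)"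

lemma bump_deriv: "(bump n has_real_derivative bump (Suc n) t) (at t)"
proof -
  define u where "u = 1 - t\<^sup>2"
  define k where "k = 2 * n"
  define q where "q = bump_poly n"
  have "((\<lambda>t. 1 - t\<^sup>2) has_real_derivative - (2 * t)) (at t)"
    by (auto intro!: derivative_eq_intros)
  from DERIV_chain2[OF exp_flat_deriv this, of k]
  have "((\<lambda>t. exp_flat k (1 - t\<^sup>2)) has_real_derivative (exp_flat (k + 2) u - real k * exp_flat (k + 1) u) * - (2 * t)) (at t)"
    by (simp add: u_def)
  from DERIV_mult[OF poly_DERIV[of q t] this]
  have "(bump n has_real_derivative poly (pderiv q) t * exp_flat k u +
      (exp_flat (k + 2) u - real k * exp_flat (k + 1) u) * - (2 * t) * poly q t) (at t)"
    unfolding bump_def[abs_def] u_def k_def q_def by (simp add: mult.commute)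
  moreover have "poly (pderiv q) t * exp_flat k u + (exp_flat (k + 2) u - real k * exp_flat (k + 1) u) * - (2 * t) * poly q t =
      bump (Suc n) t"
  proof -
    have 1: "exp_flat (k + 1) u = u * exp_flat (k + 2) u"
      using exp_flat_shift[of "k + 1" u] by simp
    have 2: "exp_flat k u = u * (u * exp_flat (k + 2) u)"
      using exp_flat_shift[of k u] 1 by simp
    have 3: "poly [:1, 0, -1:] t = u"
      by (simp add: u_def power2_eq_square)
    have 4: "bump (Suc n) t = (poly (pderiv q) t * u ^ 2 - 2 * t * poly q t * (1 - real k * u)) * exp_flat (k + 2) u"
      unfolding bump_def bump_poly.simps poly_diff poly_mult poly_power poly_smult 3 q_def[symmetric] k_def u_def[symmetric]
      by simp
    show ?thesis
      unfolding 1 2 4 by (simp add: power2_eq_square algebra_simps)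
  qed
  ultimately show ?thesis by simp
qed

lemma bump_outside: "1 \<le> \<bar>t\<bar> \<Longrightarrow> bump n t = 0"
  using power_mono[of 1 "\<bar>t\<bar>" 2] by (simp add: bump_def exp_flat_def)

lemma bump_0_nonneg: "0 \<le> bump 0 t"
  by (simp add: bump_def exp_flat_def)

lemma bump_0_pos: "0 < bump 0 0"
  by (simp add: bump_def exp_flat_def)

lemma continuous_on_bump [continuous_intros]: "continuous_on S f \<Longrightarrow> continuous_on S (\<lambda>x. bump n (f x))"
  by (rule continuous_on_compose2[of UNIV "bump n"])
    (auto intro: DERIV_isCont[OF bump_deriv] simp: continuous_on_eq_continuous_at)

text \<open>Products of bumps in the single coordinates: for these the partial derivatives commute
  visibly, whatever the order of differentiation that is chosen for a multiindex.\<close>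

definition box_bump :: "real^'n \<Rightarrow> real \<Rightarrow> ('n \<Rightarrow> nat) \<Rightarrow> real^'n \<Rightarrow> real" where
  "box_bump a \<epsilon> \<kappa> x = (\<Prod>i\<in>UNIV. bump (\<kappa> i) ((x $ i - a $ i) / \<epsilon>) / \<epsilon> ^ \<kappa> i)"

lemma box_bump_has_derivative:
  fixes a :: "real^'n"
  shows "(box_bump a \<epsilon> \<kappa> has_derivative (\<lambda>w. \<Sum>i\<in>UNIV. w $ i * box_bump a \<epsilon> (\<kappa>(i := Suc (\<kappa> i))) x)) (at x)"
proof -
  define f where "f i x = bump (\<kappa> i) ((x $ i - a $ i) / \<epsilon>) / \<epsilon> ^ \<kappa> i" for i and x :: "real^'n"
  define d where "d i = bump (Suc (\<kappa> i)) ((x $ i - a $ i) / \<epsilon>) / \<epsilon> ^ Suc (\<kappa> i)" for i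
  have f: "(f i has_derivative (\<lambda>w. w $ i * d i)) (at x)" for i
  proof -
    have "((\<lambda>x. (x $ i - a $ i) / \<epsilon>) has_derivative (\<lambda>w. w $ i / \<epsilon>)) (at x)"
      unfolding divide_inverse by (auto intro!: derivative_eq_intros bounded_linear_imp_has_derivative bounded_linear_vec_nth)
    from has_derivative_compose[OF this bump_deriv[unfolded has_field_derivative_def]]
    have "((\<lambda>x. bump (\<kappa> i) ((x $ i - a $ i) / \<epsilon>) / \<epsilon> ^ \<kappa> i) has_derivative
        (\<lambda>w. bump (Suc (\<kappa> i)) ((x $ i - a $ i) / \<epsilon>) * (w $ i / \<epsilon>) / \<epsilon> ^ \<kappa> i)) (at x)"
      unfolding divide_inverse by (auto intro!: derivative_eq_intros)
    then show ?thesis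
      by (simp add: f_def[abs_def] d_def mult_ac)
  qed
  have "((\<lambda>x. \<Prod>i\<in>UNIV. f i x) has_derivative (\<lambda>w. \<Sum>i\<in>UNIV. (w $ i * d i) * (\<Prod>j\<in>UNIV - {i}. f j x))) (at x)"
    by (rule has_derivative_prod) (rule f)
  moreover have "d i * (\<Prod>j\<in>UNIV - {i}. f j x) = box_bump a \<epsilon> (\<kappa>(i := Suc (\<kappa> i))) x" for i
    unfolding box_bump_def by (subst prod.remove[of UNIV i]) (auto simp: d_def f_def)
  ultimately show ?thesis
    by (simp add: box_bump_def[abs_def] f_def mult.assoc)
qed

lemma box_bump_outside:
  fixes a :: "real^'n"
  assumes "\<epsilon> > 0" "box_bump a \<epsilon> \<kappa> x \<noteq> 0"
  shows "\<bar>x $ i - a $ i\<bar> < \<epsilon>"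
proof (rule ccontr)
  assume "\<not> ?thesis"
  then have "1 \<le> \<bar>(x $ i - a $ i) / \<epsilon>\<bar>"
    using assms(1) by (simp add: abs_divide)
  then have "bump (\<kappa> i) ((x $ i - a $ i) / \<epsilon>) = 0"
    by (rule bump_outside)
  then have "box_bump a \<epsilon> \<kappa> x = 0"
    unfolding box_bump_def by (intro prod_zero) auto
  with assms show False by simp
qed

lemma continuous_on_box_bump [continuous_intros]:
  assumes "continuous_on S f" "continuous_on S g"
  shows "continuous_on S (\<lambda>p. box_bump (f p) \<epsilon> \<kappa> (g p))"
  unfolding box_bump_def divide_inverse by (intro continuous_intros assms)

lemma box_bump_translate: "box_bump a \<epsilon> \<kappa> x = box_bump 0 \<epsilon> \<kappa> (x - a)"
  by (simp add: box_bump_def)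

lemma partial_deriv_eq:
  assumes "(f has_derivative D) (at x)"
  shows "((\<lambda>t. f (x + t *\<^sub>R axis i 1)) has_vector_derivative D (axis i 1)) (at 0)"
    and "partial_deriv i f x = D (axis i 1)"
proof -
  have "((\<lambda>s. x + s *\<^sub>R axis i 1) has_derivative (\<lambda>r. r *\<^sub>R axis i 1)) (at 0)"
    by (auto intro!: derivative_eq_intros)
  from has_derivative_compose[OF this, of f D]
  have "((\<lambda>s. f (x + s *\<^sub>R axis i 1)) has_derivative (\<lambda>r. D (r *\<^sub>R axis i 1))) (at 0)"
    using assms by simp
  then show "((\<lambda>t. f (x + t *\<^sub>R axis i 1)) has_vector_derivative D (axis i 1)) (at 0)"
    by (simp add: has_vector_derivative_def linear_cmul[OF has_derivative_linear[OF assms]])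
  then show "partial_deriv i f x = D (axis i 1)"
    unfolding partial_deriv_def by (rule vector_derivative_at)
qed

lemma partials_Nil [simp]: "partials [] f = f"
  by (simp add: partials_def)

lemma partials_Cons: "partials (i # js) f = partial_deriv i (partials js f)"
  by (simp add: partials_def)

lemma sum_vec_axis:
  fixes F :: "'n::finite \<Rightarrow> 'b::real_vector"
  shows "(\<Sum>j\<in>UNIV. (axis i 1 :: real^'n) $ j *\<^sub>R F j) = F i"
proof -
  have "(axis i 1 :: real^'n) $ j *\<^sub>R F j = (if j = i then F j else 0)" for j
    by (simp add: axis_def)
  then show ?thesis by simp
qed

lemma complex_box_bump_has_derivative:
  "((\<lambda>x. complex_of_real (box_bump a \<epsilon> \<kappa> x)) has_derivative
     (\<lambda>w. \<Sum>i\<in>UNIV. w $ i *\<^sub>R complex_of_real (box_bump a \<epsilon> (\<kappa>(i := Suc (\<kappa> i))) x))) (at x)"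
  using bounded_linear.has_derivative[OF bounded_linear_of_real box_bump_has_derivative[of a \<epsilon> \<kappa> x]]
  by (simp add: scaleR_conv_of_real)

lemma partials_box_bump:
  "partials js (\<lambda>x. complex_of_real (box_bump a \<epsilon> \<kappa> x)) = (\<lambda>x. complex_of_real (box_bump a \<epsilon> (\<lambda>i. \<kappa> i + count_list js i) x))"
proof (induction js)
  case (Cons i js)
  have upd: "(\<lambda>j. \<kappa> j + count_list js j)(i := Suc (\<kappa> i + count_list js i)) = (\<lambda>j. \<kappa> j + count_list (i # js) j)"
    by auto
  show ?case
    unfolding partials_Cons Cons
    by (rule ext, subst partial_deriv_eq(2)[OF complex_box_bump_has_derivative]) (simp only: sum_vec_axis upd)
qed simp

lemma box_bump_support:
  fixes a :: "real^'n"
  assumes "\<epsilon> > 0" "box_bump a \<epsilon> \<kappa> x \<noteq> 0"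
  shows "norm (x - a) \<le> real CARD('n) * \<epsilon>"
proof -
  have "norm (x - a) \<le> (\<Sum>i\<in>UNIV. \<bar>(x - a) $ i\<bar>)"
    by (rule norm_le_l1_cart)
  also have "\<dots> \<le> (\<Sum>i\<in>(UNIV::'n set). \<epsilon>)"
    using box_bump_outside[OF assms] by (intro sum_mono) (simp add: less_imp_le)
  finally show ?thesis by simp
qed

lemma box_bump_test_function:
  fixes a :: "real^'n"
  assumes "\<epsilon> > 0"
  shows "(\<lambda>x. complex_of_real (box_bump a \<epsilon> \<kappa> x)) \<in> test_functions"
proof -
  have "closure {x. complex_of_real (box_bump a \<epsilon> \<kappa> x) \<noteq> 0} \<subseteq> cball a (real CARD('n) * \<epsilon>)"
    using box_bump_support[OF assms, of a \<kappa>] by (intro closure_minimal) (auto simp: dist_norm norm_minus_commute)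
  then have "compact (closure {x. complex_of_real (box_bump a \<epsilon> \<kappa> x) \<noteq> 0})"
    by (meson bounded_cball bounded_subset closed_closure compact_eq_bounded_closed)
  moreover have "smooth (\<lambda>x. complex_of_real (box_bump a \<epsilon> \<kappa> x))"
    unfolding smooth_def partials_box_bump
  proof (intro allI conjI)
    fix js i x
    show "continuous_on UNIV (\<lambda>x. complex_of_real (box_bump a \<epsilon> (\<lambda>i. \<kappa> i + count_list js i) x))"
      by (intro continuous_intros)
    show "(\<lambda>t. complex_of_real (box_bump a \<epsilon> (\<lambda>i. \<kappa> i + count_list js i) (x + t *\<^sub>R axis i 1))) differentiable at 0"
      by (rule differentiableI_vector[OF partial_deriv_eq(1)[OF complex_box_bump_has_derivative]])
  qed
  ultimately show ?thesis
    by (simp add: test_functions_def)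
qed

lemma ex_list_count: "\<exists>js. \<forall>i. count_list js i = (\<alpha> :: 'n::finite \<Rightarrow> nat) i"
proof -
  obtain js where "mset js = (\<Sum>i\<in>UNIV. replicate_mset (\<alpha> i) i)"
    using ex_mset by blast
  then have "count_list js i = \<alpha> i" for i
    by (simp add: count_mset[symmetric] count_sum if_distrib cong: if_cong)
  then show ?thesis by blast
qed

lemma mi_deriv_partials:
  obtains js where "\<And>i. count_list js i = \<alpha> i" "\<And>g. mi_deriv \<alpha> g = partials js g"
  using someI_ex[OF ex_list_count[of \<alpha>]] unfolding mi_deriv_def by blast

lemma mi_order_count: "mi_order (count_list js) = length (js :: 'n::finite list)"
proof (induction js)
  case (Cons i js)
  have "mi_order (count_list (i # js)) = (\<Sum>j\<in>UNIV. count_list js j + (if j = i then 1 else 0))"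
    unfolding mi_order_def by (intro sum.cong) auto
  also have "\<dots> = length (i # js)"
    using Cons by (simp add: sum.distrib mi_order_def)
  finally show ?case .
qed (simp add: mi_order_def)

lemma mi_deriv_box_bump:
  "mi_deriv \<alpha> (\<lambda>x. complex_of_real (box_bump a \<epsilon> \<kappa> x)) = (\<lambda>x. complex_of_real (box_bump a \<epsilon> (\<lambda>i. \<kappa> i + \<alpha> i) x))"
  by (rule mi_deriv_partials[of \<alpha>]) (simp add: partials_box_bump)

section \<open>Continuous weak derivatives are classical derivatives\<close>

lemma integral_lebesgue_cbox:
  fixes h :: "real^'n \<Rightarrow> 'b::euclidean_space"
  assumes h: "continuous_on UNIV h" and 0: "\<And>x. x \<notin> cbox a b \<Longrightarrow> h x = 0"
  shows "integrable lborel h" "(LINT x|lborel. h x) = integral (cbox a b) h" "(LINT x|lebesgue. h x) = (LINT x|lborel. h x)"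
proof -
  have "integrable lborel (\<lambda>x. indicat_real (cbox a b) x *\<^sub>R h x)"
    by (rule borel_integrable_compact) (auto intro: continuous_on_subset[OF h])
  then have set: "set_integrable lborel (cbox a b) h"
    by (simp add: set_integrable_def)
  have eq: "(\<lambda>x. indicat_real (cbox a b) x *\<^sub>R h x) = h"
    using 0 by (auto simp: indicator_def fun_eq_iff)
  show "integrable lborel h"
    using set unfolding set_integrable_def eq .
  show "(LINT x|lborel. h x) = integral (cbox a b) h"
    using set_borel_integral_eq_integral(2)[OF set] unfolding set_lebesgue_integral_def eq .
  show "(LINT x|lebesgue. h x) = (LINT x|lborel. h x)"
    using borel_measurable_continuous_onI[OF h] by (intro integral_completion) simp
qed

lemma box_bump_integrable:
  fixes a :: "real^'n" and u :: "real^'n \<Rightarrow> complex"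
  assumes u: "continuous_on UNIV u" and \<epsilon>: "\<epsilon> > 0"
  shows "integrable lborel (\<lambda>x. u x * complex_of_real (box_bump a \<epsilon> \<kappa> x))"
    and "(LINT x|lebesgue. u x * complex_of_real (box_bump a \<epsilon> \<kappa> x)) = (LINT x|lborel. u x * complex_of_real (box_bump a \<epsilon> \<kappa> x))"
    and "cball a (real CARD('n) * \<epsilon>) \<subseteq> cbox b c \<Longrightarrow>
      (LINT x|lborel. u x * complex_of_real (box_bump a \<epsilon> \<kappa> x)) = integral (cbox b c) (\<lambda>x. u x * complex_of_real (box_bump a \<epsilon> \<kappa> x))"
proof -
  let ?h = "\<lambda>x. u x * complex_of_real (box_bump a \<epsilon> \<kappa> x)"
  have cont: "continuous_on UNIV ?h"
    by (intro continuous_intros u)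
  have zero: "?h x = 0" if sub: "cball a (real CARD('n) * \<epsilon>) \<subseteq> cbox b c" and x: "x \<notin> cbox b c" for b c x
  proof -
    have "x \<notin> cball a (real CARD('n) * \<epsilon>)"
      using sub x by blast
    then have "box_bump a \<epsilon> \<kappa> x = 0"
      using box_bump_support[OF \<epsilon>, of a \<kappa> x] by (auto simp: dist_norm norm_minus_commute)
    then show ?thesis by simp
  qed
  obtain b' c' where "cball a (real CARD('n) * \<epsilon>) \<subseteq> cbox b' c'"
    using bounded_subset_cbox_symmetric[OF bounded_cball] by metis
  note zero' = zero[OF this]
  show "integrable lborel ?h"
    using integral_lebesgue_cbox(1)[OF cont zero'] by simp
  show "(LINT x|lebesgue. ?h x) = (LINT x|lborel. ?h x)"
    using integral_lebesgue_cbox(3)[OF cont zero'] by simp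
  show "cball a (real CARD('n) * \<epsilon>) \<subseteq> cbox b c \<Longrightarrow> (LINT x|lborel. ?h x) = integral (cbox b c) ?h"
    using integral_lebesgue_cbox(2)[OF cont zero] by simp
qed

text \<open>The index type is an argument because it is determined neither by the width nor by the value.\<close>

definition bump_mass :: "'n::finite itself \<Rightarrow> real \<Rightarrow> real" where
  "bump_mass _ \<epsilon> = (LINT x|lborel. box_bump (0::real^'n) \<epsilon> (\<lambda>_. 0) x)"

lemma box_bump_0_nonneg: "0 \<le> box_bump a \<epsilon> (\<lambda>_. 0) x"
  unfolding box_bump_def by (intro prod_nonneg) (simp add: bump_0_nonneg)

lemma box_bump_integrable_real:
  fixes a :: "real^'n"
  assumes "\<epsilon> > 0"
  shows "integrable lborel (box_bump a \<epsilon> \<kappa>)"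
proof -
  have "integrable lborel (\<lambda>x. 1 * complex_of_real (box_bump a \<epsilon> \<kappa> x))"
    by (rule box_bump_integrable(1)[OF _ assms]) (intro continuous_intros)
  then show ?thesis
    using integrable_Re by fastforce
qed

lemma box_bump_mass: "(LINT x|lborel. box_bump a \<epsilon> (\<lambda>_. 0) x) = bump_mass TYPE('n) \<epsilon>" for a :: "real^'n"
proof -
  have [measurable]: "box_bump 0 \<epsilon> (\<lambda>_. 0) \<in> borel_measurable (borel :: (real^'n) measure)"
    by (intro borel_measurable_continuous_onI continuous_intros)
  show ?thesis
    using integral_lborel_translation[of "box_bump (0::real^'n) \<epsilon> (\<lambda>_. 0)" "- a"]
    by (simp add: bump_mass_def box_bump_translate[of a])
qed

lemma bump_mass_pos:
  assumes "\<epsilon> > 0"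
  shows "bump_mass TYPE('n::finite) \<epsilon> > 0"
proof -
  let ?b = "box_bump (0::real^'n) \<epsilon> (\<lambda>_. 0)"
  have "bump_mass TYPE('n) \<epsilon> \<noteq> 0"
  proof
    assume "bump_mass TYPE('n) \<epsilon> = 0"
    then have "AE x in lborel. ?b x = 0"
      using integral_nonneg_eq_0_iff_AE[OF box_bump_integrable_real[OF assms, of "0::real^'n" "\<lambda>_. 0"]]
      by (simp add: bump_mass_def box_bump_0_nonneg)
    moreover have op: "open {x. ?b x \<noteq> 0}"
    proof -
      have "continuous_on UNIV ?b" by (intro continuous_intros)
      then have "open (?b -` (- {0}))" by (intro open_vimage) auto
      then show ?thesis by (simp add: vimage_def)
    qed
    ultimately have "{x. ?b x \<noteq> 0} \<in> null_sets lborel"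
      by (subst AE_iff_null_sets) auto
    then have "negligible {x. ?b x \<noteq> 0}"
      by (simp add: negligible_iff_null_sets null_sets_completionI)
    moreover have "0 \<in> {x. ?b x \<noteq> 0}"
      using bump_0_pos by (simp add: box_bump_def)
    ultimately show False
      using open_not_negligible[OF op] by blast
  qed
  moreover have "0 \<le> bump_mass TYPE('n) \<epsilon>"
    unfolding bump_mass_def by (intro Bochner_Integration.integral_nonneg box_bump_0_nonneg)
  ultimately show ?thesis by simp
qed

lemma box_bump_average:
  fixes u :: "real^'n \<Rightarrow> complex"
  assumes u: "continuous_on UNIV u" and \<epsilon>: "\<epsilon> > 0"
    and near: "\<And>x. norm (x - a) \<le> real CARD('n) * \<epsilon> \<Longrightarrow> cmod (u x - c) \<le> \<eta>"
  shows "cmod ((LINT x|lborel. u x * complex_of_real (box_bump a \<epsilon> (\<lambda>_. 0) x)) - bump_mass TYPE('n) \<epsilon> *\<^sub>R c) \<le> bump_mass TYPE('n) \<epsilon> * \<eta>"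
proof -
  let ?b = "box_bump a \<epsilon> (\<lambda>_. 0)"
  have b: "integrable lborel ?b" by (rule box_bump_integrable_real[OF \<epsilon>])
  have i1: "integrable lborel (\<lambda>x. u x * complex_of_real (?b x))"
    by (rule box_bump_integrable(1)[OF u \<epsilon>])
  have i2: "integrable lborel (\<lambda>x. c * complex_of_real (?b x))"
    by (rule box_bump_integrable(1)[OF _ \<epsilon>]) (intro continuous_intros)
  have "(LINT x|lborel. c * complex_of_real (?b x)) = bump_mass TYPE('n) \<epsilon> *\<^sub>R c"
    by (simp add: integral_complex_of_real box_bump_mass scaleR_conv_of_real mult.commute)
  then have "(LINT x|lborel. u x * complex_of_real (?b x)) - bump_mass TYPE('n) \<epsilon> *\<^sub>R c =
      (LINT x|lborel. u x * complex_of_real (?b x) - c * complex_of_real (?b x))"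
    using Bochner_Integration.integral_diff[OF i1 i2] by simp
  also have "cmod \<dots> \<le> (LINT x|lborel. cmod (u x * complex_of_real (?b x) - c * complex_of_real (?b x)))"
    by (rule integral_norm_bound)
  also have "\<dots> \<le> (LINT x|lborel. ?b x * \<eta>)"
  proof (rule integral_mono)
    show "integrable lborel (\<lambda>x. cmod (u x * complex_of_real (?b x) - c * complex_of_real (?b x)))"
      by (intro integrable_norm Bochner_Integration.integrable_diff i1 i2)
    show "integrable lborel (\<lambda>x. ?b x * \<eta>)"
      using b by simp
    fix x
    have "cmod (u x * complex_of_real (?b x) - c * complex_of_real (?b x)) = cmod (u x - c) * ?b x"
      by (simp add: left_diff_distrib[symmetric] norm_mult box_bump_0_nonneg)
    also have "\<dots> \<le> ?b x * \<eta>"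
    proof (cases "?b x = 0")
      case False
      then have "cmod (u x - c) \<le> \<eta>"
        by (intro near box_bump_support[OF \<epsilon>])
      then show ?thesis
        by (metis box_bump_0_nonneg mult.commute mult_right_mono)
    qed simp
    finally show "cmod (u x * complex_of_real (?b x) - c * complex_of_real (?b x)) \<le> ?b x * \<eta>" .
  qed
  also have "\<dots> = bump_mass TYPE('n) \<epsilon> * \<eta>"
    by (simp add: box_bump_mass)
  finally show ?thesis .
qed

text \<open>Averages of \<open>u\<close> over translated bumps have derivatives that are averages of the \<open>g i\<close>. The
  mean value inequality for these averages survives when the bumps shrink to a point.\<close>

lemma weak_derivative_is_derivative:
  fixes u :: "real^'n \<Rightarrow> complex" and g :: "'n \<Rightarrow> real^'n \<Rightarrow> complex"
  assumes u: "continuous_on UNIV u" and g: "\<And>i. continuous_on UNIV (g i)"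
    and weak: "\<And>a \<epsilon> i. \<epsilon> > 0 \<Longrightarrow> (LINT x|lebesgue. g i x * complex_of_real (box_bump a \<epsilon> (\<lambda>_. 0) x)) =
      - (LINT x|lebesgue. u x * complex_of_real (box_bump a \<epsilon> ((\<lambda>_. 0)(i := Suc 0)) x))"
  shows "(u has_derivative (\<lambda>w. \<Sum>i\<in>UNIV. w $ i *\<^sub>R g i x0)) (at x0)"
  unfolding has_derivative_at_alt
proof (intro conjI allI impI)
  define L where "L w = (\<Sum>i\<in>UNIV. w $ i *\<^sub>R g i x0)" for w :: "real^'n"
  show "bounded_linear (\<lambda>w. \<Sum>i\<in>UNIV. w $ i *\<^sub>R g i x0)"
    by (intro bounded_linear_sum bounded_linear_compose[OF bounded_linear_scaleR_left bounded_linear_vec_nth])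
  fix e :: real assume e: "e > 0"
  let ?n = "real CARD('n)"
  have n: "?n > 0" by simp
  have "\<forall>\<^sub>F x in nhds x0. \<forall>i. dist (g i x) (g i x0) < e / ?n"
  proof (rule eventually_all_finite)
    fix i
    have "isCont (g i) x0"
      using g[of i] by (simp add: continuous_on_eq_continuous_at)
    then have "(g i \<longlongrightarrow> g i x0) (nhds x0)"
      by (simp add: continuous_at tendsto_nhds_iff)
    then show "\<forall>\<^sub>F x in nhds x0. dist (g i x) (g i x0) < e / ?n"
      using e n by (intro tendstoD) auto
  qed
  then obtain \<delta> where \<delta>: "\<delta> > 0" "\<And>x i. dist x x0 < \<delta> \<Longrightarrow> dist (g i x) (g i x0) < e / ?n"
    unfolding eventually_nhds_metric by blast
  have main: "norm (u (x0 + w) - u x0 - L w) \<le> e * norm w" if w: "norm w < \<delta> / 2" for w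
  proof (rule field_le_epsilon)
    fix \<eta>' :: real assume "\<eta>' > 0"
    define \<eta> where "\<eta> = \<eta>' / 2"
    have \<eta>: "\<eta> > 0" using \<open>\<eta>' > 0\<close> by (simp add: \<eta>_def)
    have "\<exists>d>0. \<forall>x. dist x y < d \<longrightarrow> dist (u x) (u y) < \<eta>" for y
      using u \<eta> unfolding continuous_on_iff by (metis UNIV_I)
    then obtain d1 d2 where d1: "d1 > 0" "\<And>x. dist x (x0 + w) < d1 \<Longrightarrow> dist (u x) (u (x0 + w)) < \<eta>"
      and d2: "d2 > 0" "\<And>x. dist x x0 < d2 \<Longrightarrow> dist (u x) (u x0) < \<eta>"
      by metis
    define d where "d = min (min d1 d2) (\<delta> / 2)"
    have d: "d > 0" "d \<le> d1" "d \<le> d2" "d \<le> \<delta> / 2"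
      using d1 d2 \<delta> by (auto simp: d_def)
    define \<epsilon> where "\<epsilon> = d / (2 * ?n)"
    have \<epsilon>: "\<epsilon> > 0" and n\<epsilon>: "?n * \<epsilon> < d"
      using d n by (auto simp: \<epsilon>_def)
    define m where "m = bump_mass TYPE('n) \<epsilon>"
    have m: "m > 0" unfolding m_def by (rule bump_mass_pos[OF \<epsilon>])
    define R where "R = cball x0 \<delta>"
    obtain b c where bc: "R \<subseteq> cbox b c"
      unfolding R_def using bounded_subset_cbox_symmetric[OF bounded_cball] by metis
    define p where "p s = x0 + s *\<^sub>R w" for s
    define \<Theta> where "\<Theta> s = integral (cbox b c) (\<lambda>x. u x * complex_of_real (box_bump (p s) \<epsilon> (\<lambda>_. 0) x))" for s
    define f' where "f' s x = u x * complex_of_real (- (\<Sum>i\<in>UNIV. w $ i * box_bump (p s) \<epsilon> ((\<lambda>_. 0)(i := Suc 0)) x))" for s x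
    have ps: "norm (p s - x0) \<le> norm w" if "s \<in> {0..1}" for s
      using that by (simp add: p_def mult_left_le_one_le)
    have sub: "cball (p s) (?n * \<epsilon>) \<subseteq> cbox b c" if "s \<in> {0..1}" for s
    proof -
      have "cball (p s) (?n * \<epsilon>) \<subseteq> R"
      proof
        fix y assume "y \<in> cball (p s) (?n * \<epsilon>)"
        then have "norm (p s - y) \<le> ?n * \<epsilon>" by (simp add: dist_norm)
        then have "norm (x0 - y) \<le> norm w + ?n * \<epsilon>"
          using ps[OF that] norm_triangle_ineq[of "x0 - p s" "p s - y"] by (simp add: norm_minus_commute)
        then show "y \<in> R"
          using w n\<epsilon> d(4) by (simp add: R_def dist_norm)
      qed
      then show ?thesis using bc by blast
    qed
    have \<Theta>_deriv: "(\<Theta> has_vector_derivative integral (cbox b c) (f' s)) (at s)" for s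
    proof -
      have "(\<Theta> has_vector_derivative integral (cbox b c) (f' s)) (at s within UNIV)"
        unfolding \<Theta>_def[abs_def]
      proof (rule leibniz_rule_vector_derivative)
        fix s x
        have "((\<lambda>s. x - p s) has_derivative (\<lambda>r. - (r *\<^sub>R w))) (at s)"
          unfolding p_def by (auto intro!: derivative_eq_intros)
        from has_derivative_compose[OF this box_bump_has_derivative]
        have "((\<lambda>s. box_bump 0 \<epsilon> (\<lambda>_. 0) (x - p s)) has_derivative
            (\<lambda>r. \<Sum>i\<in>UNIV. (- (r *\<^sub>R w)) $ i * box_bump 0 \<epsilon> ((\<lambda>_. 0)(i := Suc 0)) (x - p s))) (at s)"
          by simp
        then have "((\<lambda>s. box_bump (p s) \<epsilon> (\<lambda>_. 0) x) has_real_derivative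
            - (\<Sum>i\<in>UNIV. w $ i * box_bump (p s) \<epsilon> ((\<lambda>_. 0)(i := Suc 0)) x)) (at s)"
          unfolding has_field_derivative_def box_bump_translate[of "p _"]
          by (rule has_derivative_eq_rhs) (simp add: fun_eq_iff sum_negf sum_distrib_left mult_ac)
        from has_vector_derivative_of_real[OF this]
        show "((\<lambda>s. u x * complex_of_real (box_bump (p s) \<epsilon> (\<lambda>_. 0) x)) has_vector_derivative f' s x) (at s within UNIV)"
          unfolding f'_def by (rule has_vector_derivative_mult_right)
      next
        show "(\<lambda>x. u x * complex_of_real (box_bump (p s) \<epsilon> (\<lambda>_. 0) x)) integrable_on cbox b c" for s
          by (intro integrable_continuous continuous_intros continuous_on_subset[OF u]) auto
        show "continuous_on (UNIV \<times> cbox b c) (\<lambda>(s, x). f' s x)"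
          unfolding f'_def case_prod_unfold p_def
          by (intro continuous_intros continuous_on_compose2[OF u]) auto
      qed auto
      then show ?thesis by simp
    qed
    have \<Theta>'_bound: "norm (integral (cbox b c) (f' s) - m *\<^sub>R L w) \<le> m * (e * norm w)" if s: "s \<in> {0..1}" for s
    proof -
      let ?I = "\<lambda>i. LINT x|lborel. g i x * complex_of_real (box_bump (p s) \<epsilon> (\<lambda>_. 0) x)"
      have int: "(\<lambda>x. u x * complex_of_real (box_bump (p s) \<epsilon> ((\<lambda>_. 0)(i := Suc 0)) x)) integrable_on cbox b c" for i
        by (intro integrable_continuous continuous_intros continuous_on_subset[OF u]) auto
      have "integral (cbox b c) (f' s) =
          integral (cbox b c) (\<lambda>x. \<Sum>i\<in>UNIV. (- (w $ i)) *\<^sub>R (u x * complex_of_real (box_bump (p s) \<epsilon> ((\<lambda>_. 0)(i := Suc 0)) x)))"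
        unfolding f'_def by (simp add: sum_distrib_left sum_negf scaleR_conv_of_real mult_ac)
      also have "\<dots> = (\<Sum>i\<in>UNIV. (- (w $ i)) *\<^sub>R integral (cbox b c) (\<lambda>x. u x * complex_of_real (box_bump (p s) \<epsilon> ((\<lambda>_. 0)(i := Suc 0)) x)))"
        unfolding Henstock_Kurzweil_Integration.integral_sum[OF finite integrable_cmul[OF int]] integral_cmul ..
      also have "\<dots> = (\<Sum>i\<in>UNIV. w $ i *\<^sub>R ?I i)"
      proof (rule sum.cong[OF refl])
        fix i
        have "integral (cbox b c) (\<lambda>x. u x * complex_of_real (box_bump (p s) \<epsilon> ((\<lambda>_. 0)(i := Suc 0)) x)) = - ?I i"
          using weak[OF \<epsilon>, of i "p s"] box_bump_integrable(2,3)[OF u \<epsilon>, where a = "p s" and \<kappa> = "(\<lambda>_. 0)(i := Suc 0)"]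
            box_bump_integrable(2)[OF g[of i] \<epsilon>, where a = "p s" and \<kappa> = "\<lambda>_. 0"] sub[OF s] by simp
        then show "(- (w $ i)) *\<^sub>R integral (cbox b c) (\<lambda>x. u x * complex_of_real (box_bump (p s) \<epsilon> ((\<lambda>_. 0)(i := Suc 0)) x)) = w $ i *\<^sub>R ?I i"
          by simp
      qed
      finally have eq: "integral (cbox b c) (f' s) - m *\<^sub>R L w = (\<Sum>i\<in>UNIV. w $ i *\<^sub>R (?I i - m *\<^sub>R g i x0))"
        by (simp add: L_def scaleR_diff_right sum_subtractf scaleR_sum_right mult.commute)
      have "norm (?I i - m *\<^sub>R g i x0) \<le> m * (e / ?n)" for i
        unfolding m_def
      proof (rule box_bump_average[OF g \<epsilon>])
        fix x assume "norm (x - p s) \<le> ?n * \<epsilon>"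
        then have "norm (x - x0) \<le> norm w + ?n * \<epsilon>"
          using ps[OF s] norm_triangle_ineq[of "x - p s" "p s - x0"] by simp
        then have "dist x x0 < \<delta>"
          using w n\<epsilon> d(4) by (simp add: dist_norm)
        from \<delta>(2)[OF this, of i] show "cmod (g i x - g i x0) \<le> e / ?n"
          by (simp add: dist_norm)
      qed
      then have "norm (w $ i *\<^sub>R (?I i - m *\<^sub>R g i x0)) \<le> norm w * (m * (e / ?n))" for i
        unfolding norm_scaleR using component_le_norm_cart[of w i] by (intro mult_mono) auto
      then have "norm (\<Sum>i\<in>UNIV. w $ i *\<^sub>R (?I i - m *\<^sub>R g i x0)) \<le> (\<Sum>i\<in>(UNIV::'n set). norm w * (m * (e / ?n)))"
        by (intro sum_norm_le)
      also have "\<dots> = m * (e * norm w)"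
        by simp
      finally show ?thesis
        unfolding eq .
    qed
    have t3: "norm ((\<Theta> 1 - 1 *\<^sub>R (m *\<^sub>R L w)) - (\<Theta> 0 - 0 *\<^sub>R (m *\<^sub>R L w))) \<le> m * (e * norm w) * 1 - m * (e * norm w) * 0"
    proof (rule differentiable_bound_general[where f = "\<lambda>s. \<Theta> s - s *\<^sub>R (m *\<^sub>R L w)" and \<phi> = "\<lambda>s. m * (e * norm w) * s"
          and f' = "\<lambda>s. integral (cbox b c) (f' s) - m *\<^sub>R L w" and \<phi>' = "\<lambda>_. m * (e * norm w)"])
      have der: "((\<lambda>s. \<Theta> s - s *\<^sub>R (m *\<^sub>R L w)) has_vector_derivative integral (cbox b c) (f' s) - m *\<^sub>R L w) (at s)" for s
        by (rule has_vector_derivative_diff[OF \<Theta>_deriv]) (auto intro!: derivative_eq_intros simp: has_vector_derivative_def)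
      then show "((\<lambda>s. \<Theta> s - s *\<^sub>R (m *\<^sub>R L w)) has_vector_derivative integral (cbox b c) (f' s) - m *\<^sub>R L w) (at s)" for s .
      show "continuous_on {0..1} (\<lambda>s. \<Theta> s - s *\<^sub>R (m *\<^sub>R L w))"
        using der by (meson continuous_at_imp_continuous_on has_vector_derivative_continuous)
      show "((\<lambda>s. m * (e * norm w) * s) has_vector_derivative m * (e * norm w)) (at s)" for s
        by (auto intro!: derivative_eq_intros simp: has_real_derivative_iff_has_vector_derivative[symmetric])
    qed (use \<Theta>'_bound in \<open>auto intro!: continuous_intros\<close>)
    have \<Theta>: "\<Theta> s = (LINT x|lborel. u x * complex_of_real (box_bump (p s) \<epsilon> (\<lambda>_. 0) x))" if "s \<in> {0..1}" for s
      unfolding \<Theta>_def using box_bump_integrable(3)[OF u \<epsilon> sub[OF that]] by simp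
    have t1: "norm (\<Theta> 1 - m *\<^sub>R u (x0 + w)) \<le> m * \<eta>"
      unfolding m_def \<Theta>[of 1, simplified]
    proof (rule box_bump_average[OF u \<epsilon>])
      fix x assume "norm (x - p 1) \<le> ?n * \<epsilon>"
      then have "dist x (x0 + w) < d1"
        using n\<epsilon> d by (simp add: p_def dist_norm)
      from d1(2)[OF this] show "cmod (u x - u (x0 + w)) \<le> \<eta>" by (simp add: dist_norm)
    qed
    have t0: "norm (\<Theta> 0 - m *\<^sub>R u x0) \<le> m * \<eta>"
      unfolding m_def \<Theta>[of 0, simplified]
    proof (rule box_bump_average[OF u \<epsilon>])
      fix x assume "norm (x - p 0) \<le> ?n * \<epsilon>"
      then have "dist x x0 < d2"
        using n\<epsilon> d by (simp add: p_def dist_norm)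
      from d2(2)[OF this] show "cmod (u x - u x0) \<le> \<eta>" by (simp add: dist_norm)
    qed
    have "m *\<^sub>R (u (x0 + w) - u x0 - L w) = (\<Theta> 1 - m *\<^sub>R L w - \<Theta> 0) - (\<Theta> 1 - m *\<^sub>R u (x0 + w)) + (\<Theta> 0 - m *\<^sub>R u x0)"
      by (simp add: scaleR_diff_right)
    also have "norm \<dots> \<le> m * (e * norm w) + m * \<eta> + m * \<eta>"
    proof -
      have "norm (\<Theta> 1 - m *\<^sub>R L w - \<Theta> 0) \<le> m * (e * norm w)"
        using t3 by simp
      then show ?thesis
        using t1 t0 norm_triangle_ineq4[of "\<Theta> 1 - m *\<^sub>R L w - \<Theta> 0" "\<Theta> 1 - m *\<^sub>R u (x0 + w)"]
          norm_triangle_ineq[of "(\<Theta> 1 - m *\<^sub>R L w - \<Theta> 0) - (\<Theta> 1 - m *\<^sub>R u (x0 + w))" "\<Theta> 0 - m *\<^sub>R u x0"]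
        by linarith
    qed
    also have "\<dots> = m * (e * norm w + \<eta>')"
      by (simp add: \<eta>_def algebra_simps)
    finally have "m * norm (u (x0 + w) - u x0 - L w) \<le> m * (e * norm w + \<eta>')"
      using m by simp
    then show "norm (u (x0 + w) - u x0 - L w) \<le> e * norm w + \<eta>'"
      using m by simp
  qed
  show "\<exists>d>0. \<forall>y. norm (y - x0) < d \<longrightarrow> norm (u y - u x0 - (\<Sum>i\<in>UNIV. (y - x0) $ i *\<^sub>R g i x0)) \<le> e * norm (y - x0)"
    using main[of "_ - x0"] \<delta>(1) by (intro exI[of _ "\<delta> / 2"]) (auto simp: L_def)
qed

lemma box_integrals_determine:
  fixes u v :: "real^'n \<Rightarrow> complex"
  assumes u: "continuous_on UNIV u" and v: "continuous_on UNIV v"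
    and eq: "\<And>a \<epsilon>. \<epsilon> > 0 \<Longrightarrow> (LINT x|lebesgue. u x * complex_of_real (box_bump a \<epsilon> (\<lambda>_. 0) x)) =
      (LINT x|lebesgue. v x * complex_of_real (box_bump a \<epsilon> (\<lambda>_. 0) x))"
  shows "u = v"
proof
  fix x0
  have "norm (u x0 - v x0) \<le> 0 + \<eta>'" if "\<eta>' > 0" for \<eta>'
  proof -
    define \<eta> where "\<eta> = \<eta>' / 2"
    have \<eta>: "\<eta> > 0" using \<open>\<eta>' > 0\<close> by (simp add: \<eta>_def)
    obtain d1 d2 where d1: "d1 > 0" "\<And>x. dist x x0 < d1 \<Longrightarrow> dist (u x) (u x0) < \<eta>"
      and d2: "d2 > 0" "\<And>x. dist x x0 < d2 \<Longrightarrow> dist (v x) (v x0) < \<eta>"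
      using u v \<eta> unfolding continuous_on_iff by (metis UNIV_I)
    define \<epsilon> where "\<epsilon> = min d1 d2 / (2 * real CARD('n))"
    have \<epsilon>: "\<epsilon> > 0" and n\<epsilon>: "real CARD('n) * \<epsilon> < min d1 d2"
      using d1 d2 by (auto simp: \<epsilon>_def)
    define m where "m = bump_mass TYPE('n) \<epsilon>"
    have m: "m > 0" unfolding m_def by (rule bump_mass_pos[OF \<epsilon>])
    have 1: "norm ((LINT x|lborel. u x * complex_of_real (box_bump x0 \<epsilon> (\<lambda>_. 0) x)) - m *\<^sub>R u x0) \<le> m * \<eta>"
      unfolding m_def
    proof (rule box_bump_average[OF u \<epsilon>])
      fix x assume "norm (x - x0) \<le> real CARD('n) * \<epsilon>"
      then have "dist x x0 < d1" using n\<epsilon> by (simp add: dist_norm)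
      from d1(2)[OF this] show "cmod (u x - u x0) \<le> \<eta>" by (simp add: dist_norm)
    qed
    have 2: "norm ((LINT x|lborel. v x * complex_of_real (box_bump x0 \<epsilon> (\<lambda>_. 0) x)) - m *\<^sub>R v x0) \<le> m * \<eta>"
      unfolding m_def
    proof (rule box_bump_average[OF v \<epsilon>])
      fix x assume "norm (x - x0) \<le> real CARD('n) * \<epsilon>"
      then have "dist x x0 < d2" using n\<epsilon> by (simp add: dist_norm)
      from d2(2)[OF this] show "cmod (v x - v x0) \<le> \<eta>" by (simp add: dist_norm)
    qed
    define J where "J = (LINT x|lborel. u x * complex_of_real (box_bump x0 \<epsilon> (\<lambda>_. 0) x))"
    have J: "(LINT x|lborel. v x * complex_of_real (box_bump x0 \<epsilon> (\<lambda>_. 0) x)) = J"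
      using eq[OF \<epsilon>, of x0] by (simp add: J_def box_bump_integrable(2)[OF u \<epsilon>] box_bump_integrable(2)[OF v \<epsilon>])
    have "m *\<^sub>R (u x0 - v x0) = (J - m *\<^sub>R v x0) - (J - m *\<^sub>R u x0)"
      by (simp add: scaleR_diff_right)
    also have "norm \<dots> \<le> m * \<eta> + m * \<eta>"
      using 1 2 norm_triangle_ineq4[of "J - m *\<^sub>R v x0" "J - m *\<^sub>R u x0"] unfolding J J_def[symmetric] by linarith
    finally have "m * norm (u x0 - v x0) \<le> m * \<eta>'"
      using m by (simp add: \<eta>_def)
    then show ?thesis
      using m by simp
  qed
  then have "norm (u x0 - v x0) \<le> 0"
    by (rule field_le_epsilon)
  then show "u x0 = v x0" by simp
qed

section \<open>Functions that are flat on a closed cone\<close>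

text \<open>The common content of the moment condition with the norm bound, and of multiplication by the
  power of a polynomial vanishing on \<open>Z\<close>: classical derivatives up to order \<open>t\<close> that decay of order
  \<open>t\<close> and, below order \<open>t\<close>, vanish on \<open>Z\<close>.\<close>

definition flat_on :: "(real^'n) set \<Rightarrow> nat \<Rightarrow> real \<Rightarrow> (real^'n \<Rightarrow> complex) \<Rightarrow> bool" where
  "flat_on Z t K f \<longleftrightarrow>
    (\<forall>js. length js \<le> t \<longrightarrow> continuous_on UNIV (partials js f) \<and>
       (\<forall>x. cmod (partials js f x) \<le> K / (1 + norm x) ^ t)) \<and>
    (\<forall>js. length js < t \<longrightarrow>
       (\<forall>x. (partials js f has_derivative (\<lambda>w. \<Sum>i\<in>UNIV. w $ i *\<^sub>R partials (i # js) f x)) (at x)) \<and>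
       (\<forall>z\<in>Z. partials js f z = 0))"

text \<open>Both distributional derivatives are tested against bumps; the derivative of a bump moves one
  order of differentiation from the function to the test function.\<close>

lemma distr_deriv_has_derivative:
  fixes u :: "real^'n \<Rightarrow> complex"
  assumes cont: "\<And>\<alpha>. mi_order \<alpha> \<le> t \<Longrightarrow> continuous_on UNIV (g \<alpha>)"
    and distr: "\<And>\<alpha>. mi_order \<alpha> \<le> t \<Longrightarrow> has_distr_deriv \<alpha> u (g \<alpha>)"
    and \<alpha>: "mi_order \<alpha> < t"
  shows "(g \<alpha> has_derivative (\<lambda>w. \<Sum>i\<in>UNIV. w $ i *\<^sub>R g (\<alpha>(i := Suc (\<alpha> i))) x)) (at x)"
proof (rule weak_derivative_is_derivative)
  have ord: "mi_order (\<alpha>(i := Suc (\<alpha> i))) = Suc (mi_order \<alpha>)" for i :: 'n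
  proof -
    have "mi_order (\<alpha>(i := Suc (\<alpha> i))) = (\<Sum>j\<in>UNIV. \<alpha> j + (if j = i then 1 else 0))"
      unfolding mi_order_def by (intro sum.cong) auto
    then show ?thesis by (simp add: sum.distrib mi_order_def)
  qed
  show "continuous_on UNIV (g \<alpha>)" using cont \<alpha> by simp
  show "continuous_on UNIV (g (\<alpha>(i := Suc (\<alpha> i))))" for i using cont \<alpha> by (simp add: ord)
  fix a :: "real^'n" and \<epsilon> :: real and i :: 'n assume \<epsilon>: "\<epsilon> > 0"
  let ?e = "(\<lambda>_. 0)(i := Suc 0)"
  have idx: "(\<lambda>j. 0 + (\<alpha>(i := Suc (\<alpha> i))) j) = (\<lambda>j. ?e j + \<alpha> j)"
    by auto
  have "(LINT x|lebesgue. g (\<alpha>(i := Suc (\<alpha> i))) x * complex_of_real (box_bump a \<epsilon> (\<lambda>_. 0) x)) =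
      (-1) ^ Suc (mi_order \<alpha>) * (LINT x|lebesgue. u x * complex_of_real (box_bump a \<epsilon> (\<lambda>j. ?e j + \<alpha> j) x))"
    using distr[of "\<alpha>(i := Suc (\<alpha> i))"] \<alpha> box_bump_test_function[OF \<epsilon>, of a "\<lambda>_. 0"]
    unfolding has_distr_deriv_def mi_deriv_box_bump ord[of i, symmetric] idx[symmetric] by (auto simp: ord mi_deriv_box_bump)
  moreover have "(LINT x|lebesgue. g \<alpha> x * complex_of_real (box_bump a \<epsilon> ?e x)) =
      (-1) ^ mi_order \<alpha> * (LINT x|lebesgue. u x * complex_of_real (box_bump a \<epsilon> (\<lambda>j. ?e j + \<alpha> j) x))"
    using distr[of \<alpha>] \<alpha> box_bump_test_function[OF \<epsilon>, of a ?e]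
    unfolding has_distr_deriv_def by (auto simp: mi_deriv_box_bump)
  ultimately show "(LINT x|lebesgue. g (\<alpha>(i := Suc (\<alpha> i))) x * complex_of_real (box_bump a \<epsilon> (\<lambda>_. 0) x)) =
      - (LINT x|lebesgue. g \<alpha> x * complex_of_real (box_bump a \<epsilon> ?e x))"
    by simp
qed

lemma distr_deriv_0_eq:
  fixes u :: "real^'n \<Rightarrow> complex"
  assumes "has_distr_deriv (\<lambda>_. 0) u g" "continuous_on UNIV u" "continuous_on UNIV g"
  shows "g = u"
proof (rule box_integrals_determine)
  fix a :: "real^'n" and \<epsilon> :: real assume \<epsilon>: "\<epsilon> > 0"
  show "(LINT x|lebesgue. g x * complex_of_real (box_bump a \<epsilon> (\<lambda>_. 0) x)) =
      (LINT x|lebesgue. u x * complex_of_real (box_bump a \<epsilon> (\<lambda>_. 0) x))"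
    using assms(1) box_bump_test_function[OF \<epsilon>, of a "\<lambda>_. 0"]
    unfolding has_distr_deriv_def by (auto simp: mi_deriv_box_bump mi_order_def)
qed (use assms in auto)

lemma schwartz_norm_bound:
  fixes f :: "real^'n \<Rightarrow> complex"
  assumes "schwartz_norm (real t) (real t) f < \<infinity>"
  obtains K where "\<And>\<alpha> x. mi_order \<alpha> \<le> t \<Longrightarrow> cmod (mi_deriv \<alpha> f x) \<le> K / (1 + norm x) ^ t"
proof
  fix \<alpha> :: "'n \<Rightarrow> nat" and x assume \<alpha>: "mi_order \<alpha> \<le> t"
  let ?S = "schwartz_norm (real t) (real t) f"
  have "ennreal ((1 + norm x) powr real t * cmod (mi_deriv \<alpha> f x)) \<le> ?S"
    unfolding schwartz_norm_def by (rule SUP_upper2[OF UNIV_I], rule SUP_upper2) (use \<alpha> in auto)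
  also have "?S = ennreal (enn2real ?S)"
    using assms by simp
  finally have "(1 + norm x) powr real t * cmod (mi_deriv \<alpha> f x) \<le> enn2real ?S"
    by (subst (asm) ennreal_le_iff) auto
  then show "cmod (mi_deriv \<alpha> f x) \<le> enn2real ?S / (1 + norm x) ^ t"
    by (simp add: powr_realpow add_pos_nonneg pos_le_divide_eq mult.commute)
qed

text \<open>The derivatives in the norm are classical ones, those in the moment condition are
  distributional; they agree since the latter are continuous.\<close>

lemma flat_on_fourier:
  fixes \<psi> :: "real^'n \<Rightarrow> complex"
  assumes \<psi>: "integrable lebesgue \<psi>" and van: "vanishing_moments Z t \<psi>"
    and fin: "schwartz_norm (real t) (real t) (fourier \<psi>) < \<infinity>"
  obtains K where "flat_on Z t K (fourier \<psi>)"
proof -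
  define f where "f = fourier \<psi>"
  have "\<forall>\<alpha>. \<exists>g. mi_order \<alpha> \<le> t \<longrightarrow> continuous_on UNIV g \<and> has_distr_deriv \<alpha> f g \<and> (mi_order \<alpha> < t \<longrightarrow> (\<forall>\<xi>\<in>Z. g \<xi> = 0))"
    using van unfolding vanishing_moments_def f_def by blast
  then obtain g where g: "\<And>\<alpha>. mi_order \<alpha> \<le> t \<Longrightarrow> continuous_on UNIV (g \<alpha>)"
    "\<And>\<alpha>. mi_order \<alpha> \<le> t \<Longrightarrow> has_distr_deriv \<alpha> f (g \<alpha>)" "\<And>\<alpha> \<xi>. mi_order \<alpha> < t \<Longrightarrow> \<xi> \<in> Z \<Longrightarrow> g \<alpha> \<xi> = 0"
    using choice[of "\<lambda>\<alpha> g. mi_order \<alpha> \<le> t \<longrightarrow> continuous_on UNIV g \<and> has_distr_deriv \<alpha> f g \<and> (mi_order \<alpha> < t \<longrightarrow> (\<forall>\<xi>\<in>Z. g \<xi> = 0))"]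
    by (metis less_imp_le)
  have der: "(g \<alpha> has_derivative (\<lambda>w. \<Sum>i\<in>UNIV. w $ i *\<^sub>R g (\<alpha>(i := Suc (\<alpha> i))) x)) (at x)" if "mi_order \<alpha> < t" for \<alpha> x
    by (rule distr_deriv_has_derivative[OF g(1,2) that])
  have upd: "(count_list js)(i := Suc (count_list js i)) = count_list (i # js)" for i :: 'n and js
    by auto
  have eq: "partials js f = g (count_list js)" if "length js \<le> t" for js
    using that
  proof (induction js)
    case Nil
    have "mi_order (\<lambda>_::'n. 0) \<le> t" by (simp add: mi_order_def)
    then have "g (\<lambda>_. 0) = f"
      using g(1,2) continuous_fourier[OF \<psi>] by (intro distr_deriv_0_eq) (auto simp: f_def)
    moreover have "count_list [] = (\<lambda>_::'n. 0)" by auto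
    ultimately show ?case by simp
  next
    case (Cons i js)
    then have "mi_order (count_list js) < t" by (simp add: mi_order_count)
    from partial_deriv_eq(2)[OF der[OF this]]
    have "partial_deriv i (g (count_list js)) = g (count_list (i # js))"
      unfolding sum_vec_axis upd by blast
    moreover have "length js \<le> t" using Cons.prems by simp
    ultimately show ?case
      unfolding partials_Cons by (simp only: Cons.IH)
  qed
  obtain K where K: "\<And>\<alpha> x. mi_order \<alpha> \<le> t \<Longrightarrow> cmod (mi_deriv \<alpha> f x) \<le> K / (1 + norm x) ^ t"
    using schwartz_norm_bound[OF fin] unfolding f_def by blast
  have bound: "cmod (partials js f x) \<le> K / (1 + norm x) ^ t" if js: "length js \<le> t" for js x
  proof -
    obtain js' where js': "\<And>i. count_list js' i = count_list js i" "\<And>g. mi_deriv (count_list js) g = partials js' g"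
      using mi_deriv_partials[of "count_list js"] by metis
    then have cnt: "count_list js' = count_list js" by auto
    then have "length js' = length js"
      using mi_order_count[of js] mi_order_count[of js'] by simp
    then have "partials js f = mi_deriv (count_list js) f"
      using eq js cnt js'(2) by simp
    then show ?thesis
      using K[of "count_list js" x] js by (simp add: mi_order_count)
  qed
  have "flat_on Z t K f"
    unfolding flat_on_def
  proof (intro conjI allI impI ballI)
    fix js :: "'n list" assume js: "length js \<le> t"
    show "continuous_on UNIV (partials js f)"
      using g(1) js by (simp add: eq mi_order_count)
    show "cmod (partials js f x) \<le> K / (1 + norm x) ^ t" for x
      by (rule bound[OF js])
  next
    fix js :: "'n list" assume js: "length js < t"
    then have *: "partials (i # js) f = g ((count_list js)(i := Suc (count_list js i)))" for i
      using eq[of "i # js"] unfolding upd by simp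
    show "(partials js f has_derivative (\<lambda>w. \<Sum>i\<in>UNIV. w $ i *\<^sub>R partials (i # js) f x)) (at x)" for x
      using der[of "count_list js" x] js unfolding * by (simp add: eq mi_order_count)
    show "partials js f z = 0" if "z \<in> Z" for z
      using g(3)[of "count_list js" z] that js by (simp add: eq mi_order_count)
  qed
  then show ?thesis using that by (simp add: f_def)
qed

text \<open>The whole line through the nearest point \<open>\<eta>\<close> and the origin lies in the cone, so that \<open>\<eta>\<close> is the orthogonal
  projection to this line and the theorem of Pythagoras applies.\<close>

lemma nearest_point_of_cone:
  fixes \<xi> :: "real^'n"
  assumes Z: "closed Z" "Z \<noteq> {}" and cone: "\<And>z c. z \<in> Z \<Longrightarrow> c *\<^sub>R z \<in> Z"
  obtains \<eta> where "\<eta> \<in> Z" "norm (\<xi> - \<eta>) = infdist \<xi> Z" "(\<xi> - \<eta>) \<bullet> \<eta> = 0"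
    "norm \<eta> = sqrt ((norm \<xi>)\<^sup>2 - (infdist \<xi> Z)\<^sup>2)"
proof -
  obtain \<eta> where \<eta>: "\<eta> \<in> Z" "infdist \<xi> Z = dist \<xi> \<eta>"
    using infdist_attains_inf[OF Z] by metis
  have orth: "(\<xi> - \<eta>) \<bullet> \<eta> = 0"
  proof (cases "\<eta> = 0")
    case False
    define c where "c = (\<xi> \<bullet> \<eta>) / (\<eta> \<bullet> \<eta>)"
    have nz: "\<eta> \<bullet> \<eta> > 0" using False by simp
    have "dist \<xi> \<eta> \<le> dist \<xi> (c *\<^sub>R \<eta>)"
      using infdist_le[OF cone[OF \<eta>(1), of c], of \<xi>] \<eta>(2) by simp
    then have "(\<xi> - \<eta>) \<bullet> (\<xi> - \<eta>) \<le> (\<xi> - c *\<^sub>R \<eta>) \<bullet> (\<xi> - c *\<^sub>R \<eta>)"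
      by (simp add: dist_norm norm_le)
    then have "\<eta> \<bullet> \<eta> - 2 * (\<xi> \<bullet> \<eta>) \<le> c * (c * (\<eta> \<bullet> \<eta>)) - 2 * (c * (\<xi> \<bullet> \<eta>))"
      by (simp add: inner_diff_left inner_diff_right inner_commute)
    moreover have ceq: "\<xi> \<bullet> \<eta> = c * (\<eta> \<bullet> \<eta>)"
      using nz by (simp add: c_def)
    ultimately have "(\<eta> \<bullet> \<eta>) * (c - 1)\<^sup>2 \<le> 0"
      unfolding ceq by (simp add: power2_eq_square algebra_simps)
    then have "c = 1"
      using nz by (simp add: mult_le_0_iff)
    then show ?thesis
      using ceq by (simp add: inner_diff_left)
  qed simp
  have "(norm \<xi>)\<^sup>2 = (norm (\<xi> - \<eta>))\<^sup>2 + (norm \<eta>)\<^sup>2"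
    using orth norm_add_Pythagorean[of "\<xi> - \<eta>" \<eta>] by (simp add: orthogonal_def)
  then have "norm \<eta> = sqrt ((norm \<xi>)\<^sup>2 - (infdist \<xi> Z)\<^sup>2)"
    using \<eta>(2) by (simp add: dist_norm)
  then show ?thesis
    using that[of \<eta>] \<eta> orth by (simp add: dist_norm)
qed

text \<open>Taylor expansion at the nearest point of the cone. On the segment to that point the norm
  is at least that of the nearest point, which explains the denominator in \<open>aux_A\<close>.\<close>

lemma flat_on_bound:
  fixes f :: "real^'n \<Rightarrow> complex"
  assumes f: "flat_on Z t K f" and Z: "closed Z" "Z \<noteq> {}" and cone: "\<And>z c. z \<in> Z \<Longrightarrow> c *\<^sub>R z \<in> Z"
    and js: "length js + l \<le> t"
  shows "cmod (partials js f \<xi>) \<le> real CARD('n) ^ l * K * aux_A (- Z) \<xi> ^ l"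
proof -
  let ?n = "real CARD('n)"
  have n1: "1 \<le> ?n"
    by (metis One_nat_def Suc_leI of_nat_1 of_nat_le_iff zero_less_card_finite)
  have fb: "cmod (partials js f x) \<le> K / (1 + norm x) ^ t" if "length js \<le> t" for js x
    using f that unfolding flat_on_def by blast
  have fd: "(partials js f has_derivative (\<lambda>w. \<Sum>i\<in>UNIV. w $ i *\<^sub>R partials (i # js) f x)) (at x)" if "length js < t" for js x
    using f that unfolding flat_on_def by blast
  have f0: "partials js f z = 0" if "length js < t" "z \<in> Z" for js z
    using f that unfolding flat_on_def by blast
  have K: "0 \<le> K"
    using order_trans[OF norm_ge_zero fb[of "[]" 0]] by simp
  obtain \<eta> where \<eta>: "\<eta> \<in> Z" "norm (\<xi> - \<eta>) = infdist \<xi> Z" "(\<xi> - \<eta>) \<bullet> \<eta> = 0"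
    "norm \<eta> = sqrt ((norm \<xi>)\<^sup>2 - (infdist \<xi> Z)\<^sup>2)"
    using nearest_point_of_cone[OF Z cone] by metis
  define r where "r = infdist \<xi> Z"
  have r: "0 \<le> r" by (simp add: r_def infdist_nonneg)
  define p where "p s = \<eta> + s *\<^sub>R (\<xi> - \<eta>)" for s
  have pn: "norm \<eta> \<le> norm (p s)" for s
  proof -
    have "\<eta> \<bullet> \<eta> \<le> p s \<bullet> p s"
    proof -
      have "0 \<le> (s * s) * ((\<xi> - \<eta>) \<bullet> (\<xi> - \<eta>))" by simp
      then show ?thesis
        using \<eta>(3) by (simp add: p_def inner_add_left inner_add_right inner_commute mult.assoc)
    qed
    then show ?thesis by (simp add: norm_le)
  qed
  define B where "B = K / (1 + norm \<eta>) ^ t"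
  have B: "0 \<le> B" using K by (simp add: B_def)
  have taylor: "cmod (partials js f (p s)) \<le> (?n * r) ^ k * B" if "length js + k \<le> t" "s \<in> {0..1}" for js k s
    using that
  proof (induction k arbitrary: js s)
    case 0
    have "K / (1 + norm (p s)) ^ t \<le> B"
      unfolding B_def using K pn[of s] by (intro divide_left_mono power_mono mult_pos_pos zero_less_power) (auto simp: add_pos_nonneg)
    then show ?case
      using fb[of js "p s"] 0 by simp
  next
    case (Suc k)
    then have js: "length js < t" by simp
    define C where "C = (?n * r) ^ Suc k * B"
    have der: "((\<lambda>s. partials js f (p s)) has_vector_derivative (\<Sum>i\<in>UNIV. (\<xi> - \<eta>) $ i *\<^sub>R partials (i # js) f (p s))) (at s)" for s
    proof -
      have "(p has_derivative (\<lambda>h. h *\<^sub>R (\<xi> - \<eta>))) (at s)"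
        unfolding p_def[abs_def] by (auto intro!: derivative_eq_intros)
      from has_derivative_compose[OF this fd[OF js]]
      show ?thesis
        unfolding has_vector_derivative_def
        by (rule has_derivative_eq_rhs) (simp add: fun_eq_iff scaleR_sum_right)
    qed
    have dbound: "norm (\<Sum>i\<in>UNIV. (\<xi> - \<eta>) $ i *\<^sub>R partials (i # js) f (p s)) \<le> C" if "s \<in> {0..1}" for s
    proof -
      have "norm ((\<xi> - \<eta>) $ i *\<^sub>R partials (i # js) f (p s)) \<le> r * ((?n * r) ^ k * B)" for i
        unfolding norm_scaleR
      proof (rule mult_mono)
        show "\<bar>(\<xi> - \<eta>) $ i\<bar> \<le> r"
          using component_le_norm_cart[of "\<xi> - \<eta>" i] \<eta>(2) by (simp add: r_def)
        show "cmod (partials (i # js) f (p s)) \<le> (?n * r) ^ k * B"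
          using Suc.prems(1) that by (intro Suc.IH) auto
      qed (use r in auto)
      then have "norm (\<Sum>i\<in>UNIV. (\<xi> - \<eta>) $ i *\<^sub>R partials (i # js) f (p s)) \<le> (\<Sum>i\<in>(UNIV::'n set). r * ((?n * r) ^ k * B))"
        by (intro sum_norm_le)
      then show ?thesis by (simp add: C_def mult_ac)
    qed
    have C: "0 \<le> C" using r B by (simp add: C_def)
    show ?case
    proof (cases "s = 0")
      case True
      then show ?thesis
        using f0[OF js \<eta>(1)] r B by (simp add: p_def)
    next
      case False
      then have s: "0 < s" "s \<le> 1" using Suc.prems(2) by auto
      have "norm (partials js f (p s) - partials js f (p 0)) \<le> C * s - C * 0"
      proof (rule differentiable_bound_general[where f = "\<lambda>s. partials js f (p s)" and \<phi> = "\<lambda>s. C * s"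
            and \<phi>' = "\<lambda>_. C", OF s(1) _ _ der])
        show "continuous_on {0..s} (\<lambda>s. partials js f (p s))"
          using der by (meson continuous_at_imp_continuous_on has_vector_derivative_continuous)
        show "((\<lambda>s. C * s) has_vector_derivative C) (at x)" for x
          by (auto intro!: derivative_eq_intros simp: has_real_derivative_iff_has_vector_derivative[symmetric])
      qed (use dbound s in \<open>auto intro!: continuous_intros\<close>)
      moreover have "partials js f (p 0) = 0"
        using f0[OF js \<eta>(1)] by (simp add: p_def)
      ultimately have "norm (partials js f (p s)) \<le> C * s" by simp
      also have "\<dots> \<le> C" using C s by (simp add: mult_left_le)
      finally show ?thesis by (simp add: C_def)
    qed
  qed
  have power_t: "1 / a ^ t \<le> (1 / a) ^ l" if "1 \<le> a" for a :: real
    unfolding power_one_over using that js by (intro divide_left_mono power_increasing) auto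
  have "cmod (partials js f (p 1)) \<le> (?n * r) ^ l * B"
    using js by (intro taylor) auto
  also have "\<dots> = ?n ^ l * K * (r ^ l * (1 / (1 + norm \<eta>) ^ t))"
    by (simp add: B_def power_mult_distrib)
  also have "\<dots> \<le> ?n ^ l * K * (r ^ l * (1 / (1 + norm \<eta>)) ^ l)"
    using K r by (intro mult_left_mono power_t) auto
  also have "\<dots> = ?n ^ l * K * (r / (1 + norm \<eta>)) ^ l"
    by (simp add: power_divide power_one_over)
  finally have 1: "cmod (partials js f \<xi>) \<le> ?n ^ l * K * (r / (1 + norm \<eta>)) ^ l"
    by (simp add: p_def)
  have "cmod (partials js f \<xi>) \<le> K * (1 / (1 + norm \<xi>) ^ t)"
    using fb[of js \<xi>] js by simp
  also have "\<dots> \<le> K * (1 / (1 + norm \<xi>)) ^ l"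
    using K by (intro mult_left_mono power_t) auto
  also have "\<dots> \<le> (?n ^ l * K) * (1 / (1 + norm \<xi>)) ^ l"
    using n1 K one_le_power[OF n1, of l] mult_right_mono[of 1 "?n ^ l" K] by (intro mult_right_mono) auto
  finally have 2: "cmod (partials js f \<xi>) \<le> ?n ^ l * K * (1 / (1 + norm \<xi>)) ^ l" .
  have "aux_A (- Z) \<xi> = r / (1 + norm \<eta>) \<or> aux_A (- Z) \<xi> = 1 / (1 + norm \<xi>)"
    by (auto simp: aux_A_def r_def \<eta>(4) min_def)
  then show ?thesis
    using 1 2 by auto
qed

section \<open>Decay of the wavelet transform\<close>

lemma inner_transpose: "(A *v x) \<bullet> y = x \<bullet> (transpose A *v y)" for A :: "real^'n^'n"
  by (metis dot_lmul_matrix vector_transpose_matrix)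

lemma abs_component_le_norm: "\<bar>A $ i $ j\<bar> \<le> norm A" for A :: "real^'n^'m"
  by (rule order_trans[OF component_le_norm_cart Finite_Cartesian_Product.norm_nth_le])

text \<open>Decay in the single coordinates is decay in the norm, because the norm is comparable to the
  largest coordinate.\<close>

lemma power_le_max_component:
  fixes x :: "real^'n"
  obtains i where "(1 + norm x) ^ N \<le> (1 + real CARD('n)) ^ N * (1 + (2 * pi * \<bar>x $ i\<bar>) ^ N)"
proof -
  let ?n = "real CARD('n)"
  obtain i where "\<bar>x $ i\<bar> = Max (range (\<lambda>j. \<bar>x $ j\<bar>))"
    using Max_in[of "range (\<lambda>j. \<bar>x $ j\<bar>)"] by fastforce
  then have i: "\<bar>x $ j\<bar> \<le> \<bar>x $ i\<bar>" for j
    using Max_ge[of "range (\<lambda>j. \<bar>x $ j\<bar>)"] by simp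
  have "norm x \<le> (\<Sum>j\<in>UNIV. \<bar>x $ j\<bar>)" by (rule norm_le_l1_cart)
  also have "\<dots> \<le> ?n * \<bar>x $ i\<bar>" using sum_bounded_above[of UNIV "\<lambda>j. \<bar>x $ j\<bar>" "\<bar>x $ i\<bar>"] i by simp
  finally have xi: "norm x \<le> ?n * \<bar>x $ i\<bar>" .
  have "(1 + norm x) ^ N \<le> (1 + ?n) ^ N * (1 + (2 * pi * \<bar>x $ i\<bar>) ^ N)"
  proof (cases "\<bar>x $ i\<bar> \<le> 1")
    case True
    have "?n * \<bar>x $ i\<bar> \<le> ?n * 1"
      by (rule mult_left_mono[OF True]) simp
    with xi have "1 + norm x \<le> 1 + ?n" by linarith
    then have "(1 + norm x) ^ N \<le> (1 + ?n) ^ N" by (intro power_mono) auto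
    also have "\<dots> \<le> (1 + ?n) ^ N * (1 + (2 * pi * \<bar>x $ i\<bar>) ^ N)"
      by (simp add: distrib_left)
    finally show ?thesis .
  next
    case False
    have "1 + norm x \<le> (1 + ?n) * \<bar>x $ i\<bar>"
      using False xi by (simp add: distrib_right)
    also have "\<dots> \<le> (1 + ?n) * (2 * pi * \<bar>x $ i\<bar>)"
      using pi_ge_two by (intro mult_left_mono) (auto simp: mult_le_cancel_right1)
    finally have "(1 + norm x) ^ N \<le> ((1 + ?n) * (2 * pi * \<bar>x $ i\<bar>)) ^ N"
      by (intro power_mono) auto
    also have "\<dots> = (1 + ?n) ^ N * (2 * pi * \<bar>x $ i\<bar>) ^ N"
      by (simp add: power_mult_distrib)
    also have "\<dots> \<le> (1 + ?n) ^ N * (1 + (2 * pi * \<bar>x $ i\<bar>) ^ N)"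
      by (intro mult_left_mono) auto
    finally show ?thesis .
  qed
  then show ?thesis using that by blast
qed

text \<open>Each integration by parts moves one derivative to one of the factors; a derivative of the
  second factor costs a matrix entry.\<close>

lemma correlation_decay:
  fixes f :: "real^'n \<Rightarrow> complex" and h :: "real^'n^'n" and x :: "real^'n"
  assumes f: "flat_on Z t K f" and t: "t > CARD('n)"
    and A: "\<And>js \<xi>. length js \<le> m \<Longrightarrow> cmod (partials js f \<xi>) \<le> C * a \<xi>" and a: "a \<in> borel_measurable borel" "\<And>\<xi>. 0 \<le> a \<xi>"
    and P: "(\<integral>\<^sup>+\<xi>. ennreal (a \<xi>) * ennreal (a (transpose h *v \<xi>)) \<partial>lborel) = ennreal P" "0 \<le> P"
    and mt: "m < t" and C: "0 \<le> C"
  defines "T \<equiv> \<lambda>js ks. LINT \<xi>|lborel. partials js f \<xi> * cnj (partials ks f (transpose h *v \<xi>)) * wave (- (x \<bullet> \<xi>))"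
  shows "length js + length ks + N \<le> m \<Longrightarrow> (2 * pi * \<bar>x $ i\<bar>) ^ N * cmod (T js ks) \<le> C\<^sup>2 * (1 + CARD('n) * norm h) ^ N * P"
proof (induction N arbitrary: js ks)
  case 0
  have am [measurable]: "a \<in> borel_measurable borel" by fact
  have int: "integrable lborel (\<lambda>\<xi>. a \<xi> * a (transpose h *v \<xi>))"
    and val: "(LINT \<xi>|lborel. a \<xi> * a (transpose h *v \<xi>)) = P"
  proof -
    have nn: "(\<integral>\<^sup>+\<xi>. ennreal (a \<xi> * a (transpose h *v \<xi>)) \<partial>lborel) = ennreal P"
      using P(1) a(2) by (simp add: ennreal_mult)
    show "integrable lborel (\<lambda>\<xi>. a \<xi> * a (transpose h *v \<xi>))"
      by (rule integrableI_nonneg) (use nn a(2) in auto)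
    show "(LINT \<xi>|lborel. a \<xi> * a (transpose h *v \<xi>)) = P"
      by (subst integral_eq_nn_integral) (use nn a(2) P(2) in auto)
  qed
  have le: "norm (partials js f \<xi> * cnj (partials ks f (transpose h *v \<xi>)) * wave (- (x \<bullet> \<xi>))) \<le> C\<^sup>2 * (a \<xi> * a (transpose h *v \<xi>))" for \<xi>
  proof -
    have "cmod (partials js f \<xi>) * cmod (partials ks f (transpose h *v \<xi>)) \<le> (C * a \<xi>) * (C * a (transpose h *v \<xi>))"
      using 0 a(2) C by (intro mult_mono A) auto
    then show ?thesis
      by (simp add: norm_mult power2_eq_square mult_ac)
  qed
  have "cmod (T js ks) \<le> (LINT \<xi>|lborel. C\<^sup>2 * (a \<xi> * a (transpose h *v \<xi>)))"
    unfolding T_def using le int a(2) by (intro order_trans[OF integral_norm_bound integral_mono']) auto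
  then show ?case by (simp add: val)
next
  case (Suc N)
  then have len: "length js < t" "length ks < t" "length js \<le> t" "length ks \<le> t" using mt by auto
  have fb: "cmod (partials js f x) \<le> K / (1 + norm x) ^ t" if "length js \<le> t" for js x
    using f that unfolding flat_on_def by blast
  have fd: "(partials js f has_derivative (\<lambda>w. \<Sum>i\<in>UNIV. w $ i *\<^sub>R partials (i # js) f x)) (at x)" if "length js < t" for js x
    using f that unfolding flat_on_def by blast
  have fc: "continuous_on UNIV (partials js f)" if "length js \<le> t" for js
    using f that unfolding flat_on_def by blast
  have K: "0 \<le> K"
    using order_trans[OF norm_ge_zero fb[of "[]" 0]] by simp
  have fK: "cmod (partials js f x) \<le> K" if "length js \<le> t" for js x
  proof -
    have "K / (1 + norm x) ^ t \<le> K / 1"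
      using K by (intro divide_left_mono) (auto simp: one_le_power add_pos_nonneg)
    then show ?thesis using fb[OF that, of x] by simp
  qed
  have prod_bound: "cmod (partials js f \<xi> * cnj (partials ks f \<zeta>)) \<le> K\<^sup>2 / (1 + norm \<xi>) ^ t" if "length js \<le> t" "length ks \<le> t" for js ks \<xi> \<zeta>
  proof -
    have "cmod (partials js f \<xi>) * cmod (partials ks f \<zeta>) \<le> (K / (1 + norm \<xi>) ^ t) * K"
      using that K by (intro mult_mono fb fK) auto
    then show ?thesis by (simp add: norm_mult power2_eq_square)
  qed
  define v where "v \<xi> = partials js f \<xi> * cnj (partials ks f (transpose h *v \<xi>))" for \<xi>
  define V where "V \<xi> w = partials js f \<xi> * cnj (\<Sum>k\<in>UNIV. (transpose h *v w) $ k *\<^sub>R partials (k # ks) f (transpose h *v \<xi>)) +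
      (\<Sum>k\<in>UNIV. w $ k *\<^sub>R partials (k # js) f \<xi>) * cnj (partials ks f (transpose h *v \<xi>))" for \<xi> w
  have der: "(v has_derivative V \<xi>) (at \<xi>)" for \<xi>
  proof -
    have "((\<lambda>\<xi>. transpose h *v \<xi>) has_derivative (\<lambda>w. transpose h *v w)) (at \<xi>)"
      by (rule bounded_linear_imp_has_derivative[OF bounded_bilinear.bounded_linear_right[OF bounded_bilinear_matrix_vector]])
    from has_derivative_compose[OF this fd[OF len(2)]]
    have "((\<lambda>\<xi>. cnj (partials ks f (transpose h *v \<xi>))) has_derivative
        (\<lambda>w. cnj (\<Sum>k\<in>UNIV. (transpose h *v w) $ k *\<^sub>R partials (k # ks) f (transpose h *v \<xi>)))) (at \<xi>)"
      by (rule bounded_linear.has_derivative[OF bounded_linear_cnj])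
    from has_derivative_mult[OF fd[OF len(1)] this] show ?thesis
      unfolding v_def[abs_def] V_def .
  qed
  have tr: "(transpose h *v axis i 1) $ k = h $ i $ k" for k
    by (simp add: matrix_vector_mult_basis column_def transpose_def)
  have Vi: "V \<xi> (axis i 1) = partials (i # js) f \<xi> * cnj (partials ks f (transpose h *v \<xi>)) +
      (\<Sum>k\<in>UNIV. h $ i $ k *\<^sub>R (partials js f \<xi> * cnj (partials (k # ks) f (transpose h *v \<xi>))))" for \<xi>
    unfolding V_def sum_vec_axis tr by (simp add: cnj_sum sum_distrib_left add.commute)
  define K' where "K' = K\<^sup>2 * (1 + real CARD('n) * norm h)"
  have KK: "K\<^sup>2 \<le> K'"
    by (simp add: K'_def algebra_simps)
  have bv: "cmod (v \<xi>) \<le> K' / (1 + norm \<xi>) ^ t" for \<xi>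
    unfolding v_def by (rule order_trans[OF prod_bound[OF len(3,4)]]) (intro divide_right_mono KK, simp)
  have bV: "cmod (V \<xi> (axis i 1)) \<le> K' / (1 + norm \<xi>) ^ t" for \<xi>
  proof -
    have "cmod (\<Sum>k\<in>UNIV. h $ i $ k *\<^sub>R (partials js f \<xi> * cnj (partials (k # ks) f (transpose h *v \<xi>)))) \<le>
        (\<Sum>k\<in>(UNIV::'n set). norm h * (K\<^sup>2 / (1 + norm \<xi>) ^ t))"
      unfolding norm_scaleR[symmetric]
    proof (intro sum_norm_le)
      fix k
      show "norm (h $ i $ k *\<^sub>R (partials js f \<xi> * cnj (partials (k # ks) f (transpose h *v \<xi>)))) \<le> norm h * (K\<^sup>2 / (1 + norm \<xi>) ^ t)"
        unfolding norm_scaleR using len by (intro mult_mono abs_component_le_norm prod_bound) auto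
    qed
    moreover have "cmod (partials (i # js) f \<xi> * cnj (partials ks f (transpose h *v \<xi>))) \<le> K\<^sup>2 / (1 + norm \<xi>) ^ t"
      using len by (intro prod_bound) auto
    ultimately have "cmod (V \<xi> (axis i 1)) \<le> K\<^sup>2 / (1 + norm \<xi>) ^ t + (\<Sum>k\<in>(UNIV::'n set). norm h * (K\<^sup>2 / (1 + norm \<xi>) ^ t))"
      unfolding Vi by (intro norm_triangle_mono)
    also have "\<dots> = K' / (1 + norm \<xi>) ^ t"
      by (simp add: K'_def algebra_simps add_divide_distrib)
    finally show ?thesis .
  qed
  have cont: "continuous_on UNIV (\<lambda>\<xi>. partials js f \<xi> * cnj (partials ks f (transpose h *v \<xi>)))" if "length js \<le> t" "length ks \<le> t" for js ks
    by (intro continuous_intros fc that continuous_on_compose2[OF fc[OF that(2)]]) auto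
  have cV: "continuous_on UNIV (\<lambda>\<xi>. V \<xi> (axis i 1))"
    unfolding Vi by (intro continuous_intros cont) (use len in auto)
  have Tint: "integrable lborel (\<lambda>\<xi>. partials js f \<xi> * cnj (partials ks f (transpose h *v \<xi>)) * wave (- (x \<bullet> \<xi>)))"
    if "length js \<le> t" "length ks \<le> t" for js ks
    using continuous_decay_integrable[OF cont[OF that] prod_bound[OF that] t]
    by (rule integrable_times_bounded[where B = 1]) auto
  have "(LINT \<xi>|lborel. V \<xi> (axis i 1) * wave ((- x) \<bullet> \<xi>)) =
      2 * complex_of_real pi * \<i> * complex_of_real ((- x) $ i) * (LINT \<xi>|lborel. v \<xi> * wave ((- x) \<bullet> \<xi>))"
    by (rule integral_deriv_wave[OF der cV bv bV t])
  then have "2 * pi * \<bar>x $ i\<bar> * cmod (T js ks) = cmod (LINT \<xi>|lborel. V \<xi> (axis i 1) * wave (- (x \<bullet> \<xi>)))"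
    by (simp add: norm_mult T_def v_def)
  also have "(LINT \<xi>|lborel. V \<xi> (axis i 1) * wave (- (x \<bullet> \<xi>))) = T (i # js) ks + (\<Sum>k\<in>UNIV. h $ i $ k *\<^sub>R T js (k # ks))"
  proof -
    have "V \<xi> (axis i 1) * wave (- (x \<bullet> \<xi>)) = partials (i # js) f \<xi> * cnj (partials ks f (transpose h *v \<xi>)) * wave (- (x \<bullet> \<xi>)) +
       (\<Sum>k\<in>UNIV. h $ i $ k *\<^sub>R (partials js f \<xi> * cnj (partials (k # ks) f (transpose h *v \<xi>)) * wave (- (x \<bullet> \<xi>))))" for \<xi>
      unfolding Vi by (simp add: distrib_right sum_distrib_right)
    then show ?thesis
      unfolding T_def using len
      by (simp add: Bochner_Integration.integral_add Bochner_Integration.integral_sum Tint)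
  qed
  also have "cmod \<dots> \<le> cmod (T (i # js) ks) + (\<Sum>k\<in>UNIV. norm h * cmod (T js (k # ks)))"
    by (intro norm_triangle_mono order_refl sum_norm_le) (simp add: mult_right_mono abs_component_le_norm)
  finally have step: "2 * pi * \<bar>x $ i\<bar> * cmod (T js ks) \<le> cmod (T (i # js) ks) + (\<Sum>k\<in>UNIV. norm h * cmod (T js (k # ks)))" .
  define X where "X = (2 * pi * \<bar>x $ i\<bar>) ^ N"
  define D where "D = C\<^sup>2 * (1 + CARD('n) * norm h) ^ N * P"
  have X: "0 \<le> X" by (simp add: X_def)
  have "X * cmod (T (i # js) ks) \<le> D"
    unfolding X_def D_def using Suc.prems by (intro Suc.IH) simp
  moreover have "norm h * (X * cmod (T js (k # ks))) \<le> norm h * D" for k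
    unfolding X_def D_def using Suc.prems by (intro mult_left_mono Suc.IH) auto
  then have "(\<Sum>k\<in>(UNIV::'n set). norm h * (X * cmod (T js (k # ks)))) \<le> (\<Sum>k\<in>(UNIV::'n set). norm h * D)"
    by (intro sum_mono)
  ultimately have "X * (cmod (T (i # js) ks) + (\<Sum>k\<in>UNIV. norm h * cmod (T js (k # ks)))) \<le> D + CARD('n) * (norm h * D)"
    by (simp add: distrib_left sum_distrib_left mult.left_commute)
  moreover have "X * (2 * pi * \<bar>x $ i\<bar> * cmod (T js ks)) \<le> X * (cmod (T (i # js) ks) + (\<Sum>k\<in>UNIV. norm h * cmod (T js (k # ks))))"
    by (rule mult_left_mono[OF step X])
  ultimately have "X * (2 * pi * \<bar>x $ i\<bar> * cmod (T js ks)) \<le> D + CARD('n) * (norm h * D)"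
    by (rule order_trans[rotated])
  then show ?case
    by (simp add: X_def D_def algebra_simps)
qed

lemma integral_lborel_matrix:
  fixes M :: "real^'n^'n" and f :: "real^'n \<Rightarrow> complex"
  assumes M: "invertible M" and [measurable]: "f \<in> borel_measurable borel"
  shows "(LINT x|lborel. f x) = \<bar>det M\<bar> *\<^sub>R (LINT x|lborel. f (M *v x))"
proof -
  have "(LINT x|lborel. f x) = (LINT x|density (distr lborel borel (\<lambda>x. M *v x)) (\<lambda>_. ennreal \<bar>det M\<bar>). f x)"
    using lborel_matrix[OF M] by simp
  also have "\<dots> = (LINT x|distr lborel borel (\<lambda>x. M *v x). \<bar>det M\<bar> *\<^sub>R f x)"
    by (rule integral_density) auto
  also have "\<dots> = (LINT x|lborel. \<bar>det M\<bar> *\<^sub>R f (M *v x))"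
    by (rule integral_distr) measurable
  finally show ?thesis by simp
qed

lemma integrable_lborel_matrix:
  fixes M :: "real^'n^'n" and f :: "real^'n \<Rightarrow> complex"
  assumes M: "invertible M" and f: "integrable lborel f"
  shows "integrable lborel (\<lambda>x. f (M *v x))"
proof -
  have [measurable]: "f \<in> borel_measurable borel"
    using f by (auto dest: borel_measurable_integrable)
  have "integrable (density (distr lborel borel (\<lambda>x. M *v x)) (\<lambda>_. ennreal \<bar>det M\<bar>)) f"
    using f lborel_matrix[OF M] by simp
  then have "integrable (distr lborel borel (\<lambda>x. M *v x)) (\<lambda>x. \<bar>det M\<bar> *\<^sub>R f x)"
    by (subst (asm) integrable_density) auto
  then have "integrable lborel (\<lambda>x. \<bar>det M\<bar> *\<^sub>R f (M *v x))"
    by (subst (asm) integrable_distr_eq) auto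
  then have "integrable lborel (\<lambda>x. (1 / \<bar>det M\<bar>) *\<^sub>R (\<bar>det M\<bar> *\<^sub>R f (M *v x)))"
    by (rule integrable_scaleR_right)
  then show ?thesis
    using M by (simp add: invertible_det_nz)
qed

lemma negligible_affine_preimage:
  fixes h :: "real^'n^'n"
  assumes h: "invertible h" and ae: "AE y in lebesgue. P y"
  obtains N where "negligible N" "\<And>y. y \<notin> N \<Longrightarrow> P (matrix_inv h *v (y - x))"
proof -
  from ae obtain S where S: "{y \<in> space lebesgue. \<not> P y} \<subseteq> S" "emeasure lebesgue S = 0" "S \<in> sets lebesgue"
    by (rule AE_E)
  then have "negligible S"
    by (simp add: negligible_iff_null_sets null_sets_def)
  have "negligible ((\<lambda>z. x + h *v z) ` S)"
  proof (rule negligible_differentiable_image_negligible[OF _ \<open>negligible S\<close>])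
    show "(\<lambda>z. x + h *v z) differentiable_on S"
      by (intro linear_imp_differentiable_on differentiable_on_add differentiable_on_const) simp
  qed simp
  moreover have "P (matrix_inv h *v (y - x))" if "y \<notin> (\<lambda>z. x + h *v z) ` S" for y
  proof (rule ccontr)
    assume "\<not> P (matrix_inv h *v (y - x))"
    then have "matrix_inv h *v (y - x) \<in> S"
      using S(1) by auto
    moreover have "y = x + h *v (matrix_inv h *v (y - x))"
      by (simp add: matrix_vector_mul_assoc matrix_inv_inverse[OF h])
    ultimately show False
      using that by blast
  qed
  ultimately show ?thesis using that by blast
qed

text \<open>Translation by \<open>x\<close> becomes multiplication by a character, and the substitution \<open>y = x + h z\<close> turns
  dilation by \<open>h\<close> into the dual action.\<close>

lemma fourier_quasi_regular:
  fixes \<psi> :: "real^'n \<Rightarrow> complex"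
  assumes \<psi>: "integrable lebesgue \<psi>" and h: "invertible h"
  shows "integrable lebesgue (quasi_regular (x, h) \<psi>)"
    and "fourier (quasi_regular (x, h) \<psi>) \<xi> =
      complex_of_real (\<bar>det h\<bar> powr (1/2)) * (wave (x \<bullet> \<xi>) * fourier \<psi> (transpose h *v \<xi>))"
proof -
  obtain G where G: "integrable lborel G" and ae: "AE y in lebesgue. \<psi> y = G y"
    using borel_representative[OF \<psi>] by blast
  have [measurable]: "G \<in> borel_measurable borel"
    using G by (auto dest: borel_measurable_integrable)
  have hi: "invertible (matrix_inv h)"
    using matrix_inv_inverse[OF h] by (auto simp: invertible_def)
  have d: "det h \<noteq> 0" using h by (simp add: invertible_det_nz)
  define c where "c = complex_of_real (\<bar>det h\<bar> powr (-1/2))"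
  define g where "g y = c * G (matrix_inv h *v (y - x))" for y
  obtain N where N: "negligible N" "\<And>y. y \<notin> N \<Longrightarrow> \<psi> (matrix_inv h *v (y - x)) = G (matrix_inv h *v (y - x))"
    using negligible_affine_preimage[OF h ae, of x] by blast
  have gq: "quasi_regular (x, h) \<psi> y = g y" if "y \<notin> N" for y
    using N(2)[OF that] by (simp add: quasi_regular_def g_def c_def)
  have "integrable lborel (\<lambda>y. G (matrix_inv h *v y))"
    by (rule integrable_lborel_matrix[OF hi G])
  from integrable_lborel_scale[OF _ this, of 1 "- x"]
  have g_int: "integrable lborel g"
    unfolding g_def by (intro integrable_mult_right) simp
  then have [measurable]: "g \<in> borel_measurable borel"
    by (auto dest: borel_measurable_integrable)
  have g_leb: "integrable lebesgue g"
    using g_int by (simp add: integrable_completion)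
  have "quasi_regular (x, h) \<psi> absolutely_integrable_on UNIV"
    by (rule absolutely_integrable_spike[where f = g and S = N, OF _ N(1)]) (use g_leb gq in \<open>auto simp: set_integrable_def\<close>)
  then show q_int: "integrable lebesgue (quasi_regular (x, h) \<psi>)"
    by (simp add: set_integrable_def)
  have aeq: "AE y in lebesgue. quasi_regular (x, h) \<psi> y = g y"
    using N(1) gq by (intro AE_I'[of N]) (auto simp: negligible_iff_null_sets)
  have "fourier (quasi_regular (x, h) \<psi>) \<xi> = (LINT y|lebesgue. g y * wave (y \<bullet> \<xi>))"
    unfolding fourier_wave
  proof (rule integral_cong_AE)
    show "(\<lambda>y. quasi_regular (x, h) \<psi> y * wave (y \<bullet> \<xi>)) \<in> borel_measurable lebesgue"
      using q_int measurable_wave_lebesgue[of \<xi>] by measurable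
    show "(\<lambda>y. g y * wave (y \<bullet> \<xi>)) \<in> borel_measurable lebesgue"
      by (rule measurable_completion) simp
    show "AE y in lebesgue. quasi_regular (x, h) \<psi> y * wave (y \<bullet> \<xi>) = g y * wave (y \<bullet> \<xi>)"
      using aeq by eventually_elim simp
  qed
  also have "\<dots> = (LINT y|lborel. g y * wave (y \<bullet> \<xi>))"
    by (rule integral_completion) simp
  also have "\<dots> = (LINT y|lborel. g (y + x) * wave ((y + x) \<bullet> \<xi>))"
    by (rule integral_lborel_translation[symmetric]) simp
  also have "\<dots> = \<bar>det h\<bar> *\<^sub>R (LINT z|lborel. g (h *v z + x) * wave ((h *v z + x) \<bullet> \<xi>))"
    by (rule integral_lborel_matrix[OF h]) simp
  also have "(LINT z|lborel. g (h *v z + x) * wave ((h *v z + x) \<bullet> \<xi>)) =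
      (LINT z|lborel. c * wave (x \<bullet> \<xi>) * (G z * wave (z \<bullet> (transpose h *v \<xi>))))"
    by (intro Bochner_Integration.integral_cong)
      (auto simp: g_def matrix_vector_mul_assoc matrix_inv_inverse[OF h] inner_add_left inner_transpose wave_add)
  also have "\<dots> = c * wave (x \<bullet> \<xi>) * (LINT z|lborel. G z * wave (z \<bullet> (transpose h *v \<xi>)))"
    by (rule integral_mult_right_zero)
  also have "(LINT z|lborel. G z * wave (z \<bullet> (transpose h *v \<xi>))) = (LINT z|lebesgue. G z * wave (z \<bullet> (transpose h *v \<xi>)))"
    by (rule integral_completion[symmetric]) simp
  also have "\<dots> = fourier \<psi> (transpose h *v \<xi>)"
    unfolding fourier_wave
  proof (rule integral_cong_AE)
    show "(\<lambda>z. G z * wave (z \<bullet> (transpose h *v \<xi>))) \<in> borel_measurable lebesgue"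
      by (rule measurable_completion) simp
    show "(\<lambda>z. \<psi> z * wave (z \<bullet> (transpose h *v \<xi>))) \<in> borel_measurable lebesgue"
      using \<psi> measurable_wave_lebesgue[of "transpose h *v \<xi>"] by measurable
    show "AE z in lebesgue. G z * wave (z \<bullet> (transpose h *v \<xi>)) = \<psi> z * wave (z \<bullet> (transpose h *v \<xi>))"
      using ae by eventually_elim simp
  qed
  finally have "fourier (quasi_regular (x, h) \<psi>) \<xi> = \<bar>det h\<bar> *\<^sub>R (c * wave (x \<bullet> \<xi>) * fourier \<psi> (transpose h *v \<xi>))" .
  moreover have "complex_of_real \<bar>det h\<bar> * c = complex_of_real (\<bar>det h\<bar> powr (1/2))"
  proof -
    have "\<bar>det h\<bar> * \<bar>det h\<bar> powr (-1/2) = \<bar>det h\<bar> powr 1 * \<bar>det h\<bar> powr (-1/2)"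
      using d by simp
    also have "\<dots> = \<bar>det h\<bar> powr (1/2)"
      unfolding powr_add[symmetric] by simp
    finally show ?thesis
      unfolding c_def of_real_mult[symmetric] by simp
  qed
  ultimately show "fourier (quasi_regular (x, h) \<psi>) \<xi> =
      complex_of_real (\<bar>det h\<bar> powr (1/2)) * (wave (x \<bullet> \<xi>) * fourier \<psi> (transpose h *v \<xi>))"
    by (simp only: scaleR_conv_of_real mult.assoc[symmetric])
qed

lemma wavelet_transform_fourier:
  fixes \<psi> :: "real^'n \<Rightarrow> complex"
  assumes \<psi>: "integrable lebesgue \<psi>" and F: "integrable lborel (fourier \<psi>)" and h: "invertible h"
  shows "wavelet_transform \<psi> \<psi> (x, h) = complex_of_real (\<bar>det h\<bar> powr (1/2)) *
    (LINT \<xi>|lborel. fourier \<psi> \<xi> * cnj (fourier \<psi> (transpose h *v \<xi>)) * wave (- (x \<bullet> \<xi>)))"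
proof -
  have "wavelet_transform \<psi> \<psi> (x, h) = (LINT \<xi>|lborel. fourier \<psi> \<xi> * cnj (fourier (quasi_regular (x, h) \<psi>) \<xi>))"
    unfolding wavelet_transform_def by (rule L2_inner_fourier[OF \<psi> F fourier_quasi_regular(1)[OF \<psi> h]])
  also have "\<dots> = (LINT \<xi>|lborel. complex_of_real (\<bar>det h\<bar> powr (1/2)) *
      (fourier \<psi> \<xi> * cnj (fourier \<psi> (transpose h *v \<xi>)) * wave (- (x \<bullet> \<xi>))))"
    unfolding fourier_quasi_regular(2)[OF \<psi> h] by (simp add: cnj_wave mult_ac)
  finally show ?thesis by simp
qed

lemma aux_A_nonneg:
  assumes "0 \<notin> \<O>"
  shows "0 \<le> aux_A \<O> \<xi>"
proof -
  have "infdist \<xi> (- \<O>) \<le> norm \<xi>"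
    using infdist_le[of 0 "- \<O>" \<xi>] assms by simp
  then have "0 \<le> (norm \<xi>)\<^sup>2 - (infdist \<xi> (- \<O>))\<^sup>2"
    using infdist_nonneg[of \<xi> "- \<O>"] by (simp add: power_mono)
  then show ?thesis
    by (simp add: aux_A_def infdist_nonneg)
qed

lemma borel_measurable_infdist [measurable]: "(\<lambda>x. infdist x S) \<in> borel_measurable borel"
  by (intro borel_measurable_continuous_onI continuous_intros)

lemma aux_A_measurable [measurable]: "aux_A \<O> \<in> borel_measurable borel"
  unfolding aux_A_def[abs_def] by measurable

context orbit_group
begin

text \<open>For \<open>c \<noteq> 0\<close> the dilate \<open>c \<O>\<close> is an open orbit, hence meets \<open>\<O>\<close> and coincides with it.\<close>

lemma compl_closed_cone:
  shows "closed (- \<O>)" "0 \<notin> \<O>" "- \<O> \<noteq> {}" "\<And>z c. z \<in> - \<O> \<Longrightarrow> c *\<^sub>R z \<in> - \<O>"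
proof -
  show "closed (- \<O>)" using open_O by auto
  show zero: "0 \<notin> \<O>"
  proof
    assume "0 \<in> \<O>"
    then have "\<O> = {0}"
      using orbit_eq[of 0] one_H by auto
    then show False
      using open_O not_open_singleton[of "0::real^'n"] by simp
  qed
  then show "- \<O> \<noteq> {}" by auto
  fix z and c :: real assume z: "z \<in> - \<O>"
  show "c *\<^sub>R z \<in> - \<O>"
  proof (cases "c = 0")
    case False
    have "open ((\<lambda>x. c *\<^sub>R x) ` \<O>)"
      using False open_O by (rule open_scaling)
    then obtain x where x: "x \<in> \<O>" "c *\<^sub>R x \<in> \<O>"
      using open_meets_O[of "(\<lambda>x. c *\<^sub>R x) ` \<O>"] O_nonempty by auto
    have False if "c *\<^sub>R z \<in> \<O>"
    proof -
      have "c *\<^sub>R z \<in> (\<lambda>h. transpose h *v (c *\<^sub>R x)) ` H"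
        using orbit_eq[OF x(2)] that by blast
      then obtain h where h: "h \<in> H" "c *\<^sub>R z = transpose h *v (c *\<^sub>R x)" by auto
      then have "z = transpose h *v x"
        using False by (simp add: matrix_vector_mult_scaleR)
      then show False
        using act_O[OF x(1) h(1)] z by simp
    qed
    then show ?thesis by blast
  qed (use zero in simp)
qed

text \<open>The weight \<open>F\<close> in front of \<open>A (h\<^sup>T \<xi>\<^sub>0)\<^sup>l\<close> in the definition of a temperate embedding is submultiplicative, so
  that its two integrability conditions are exactly what the convolution estimate needs.\<close>

lemma flat_fourier_H1:
  assumes s: "0 \<le> s" and v: "weight (affine_group H) v" and w: "weight (dilation_group H) w"
    and vw: "\<forall>x. \<forall>h\<in>H. v (x, h) \<le> (1 + norm x) powr s * w h"
    and temp: "temperately_embedded H \<mu> \<O> s 1 w l"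
    and \<psi>: "integrable lebesgue \<psi>" and flat: "flat_on (- \<O>) t K (fourier \<psi>)"
    and t: "real t > real l + s + real CARD('n) + 1"
  shows "\<psi> \<in> H1 \<mu> v"
proof -
  let ?n = "real CARD('n)"
  define f where "f = fourier \<psi>"
  have tn: "t > CARD('n)" using t s by linarith
  have f_cont: "continuous_on UNIV f" and f_bound: "\<And>x. cmod (f x) \<le> K / (1 + norm x) ^ t"
    using flat unfolding flat_on_def f_def by (metis list.size(3) partials_Nil zero_le)+
  have F: "integrable lborel (fourier \<psi>)"
    using continuous_decay_integrable[OF f_cont f_bound tn] by (simp add: f_def)
  have K: "0 \<le> K"
    using order_trans[OF norm_ge_zero f_bound[of 0]] by simp
  have [measurable]: "f \<in> borel_measurable borel"
    using f_cont by (rule borel_measurable_continuous_onI)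
  \<comment> \<open>integrating by parts \<open>m\<close> times gives an integrable majorant in \<open>x\<close> within the available power of \<open>h\<close>\<close>
  define m where "m = nat \<lfloor>s + ?n\<rfloor> + 1"
  have m: "s + ?n < real m" "real m \<le> s + ?n + 1"
    using s by (auto simp: m_def of_nat_nat) linarith+
  have mlt: "m + l < t" "m < t"
    using m t by linarith+
  define a where "a \<xi> = aux_A \<O> \<xi> ^ l" for \<xi>
  have a0: "0 \<le> a \<xi>" for \<xi> by (simp add: a_def aux_A_nonneg compl_closed_cone(2))
  have [measurable]: "a \<in> borel_measurable borel" unfolding a_def by measurable
  define C where "C = ?n ^ l * K"
  have C: "0 \<le> C" using K by (simp add: C_def)
  have fa: "cmod (partials js (fourier \<psi>) \<xi>) \<le> C * a \<xi>" if "length js \<le> m" for js \<xi>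
    using flat_on_bound[OF flat compl_closed_cone(1,3,4), of js l \<xi>] that mlt by (simp add: C_def a_def)
  define \<Phi> where "\<Phi> h = (\<integral>\<^sup>+\<xi>. ennreal (a \<xi>) * ennreal (a (transpose h *v \<xi>)) \<partial>lborel)" for h
  define T where "T x h = (LINT \<xi>|lborel. f \<xi> * cnj (f (transpose h *v \<xi>)) * wave (- (x \<bullet> \<xi>)))" for x h
  define E where "E = 2 * (1 + ?n) ^ m * ?n ^ m * C\<^sup>2"
  have E: "0 \<le> E" using C by (simp add: E_def)
  have T_bound: "(1 + norm x) ^ m * cmod (T x h) \<le> E * (1 + norm h) ^ m * P" if P: "\<Phi> h = ennreal P" "0 \<le> P" for x h P
  proof -
    have n1: "1 \<le> ?n"
      by (metis One_nat_def Suc_leI of_nat_1 of_nat_le_iff zero_less_card_finite)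
    have decay: "(2 * pi * \<bar>x $ i\<bar>) ^ N * cmod (T x h) \<le> C\<^sup>2 * (1 + ?n * norm h) ^ N * P" if "N \<le> m" for i N
      using correlation_decay[OF flat tn fa _ a0 P[unfolded \<Phi>_def] mlt(2) C, where js = "[]" and ks = "[]" and N = N and i = i and x = x] that
      by (simp add: T_def f_def)
    obtain i where i: "(1 + norm x) ^ m \<le> (1 + ?n) ^ m * (1 + (2 * pi * \<bar>x $ i\<bar>) ^ m)"
      by (rule power_le_max_component)
    have le: "1 + ?n * norm h \<le> ?n * (1 + norm h)" "1 \<le> ?n * (1 + norm h)"
      using n1 mult_nonneg_nonneg[of ?n "norm h"] by (simp_all add: distrib_left add_increasing2)
    have "C\<^sup>2 * (1 + ?n * norm h) ^ N * P \<le> C\<^sup>2 * (?n * (1 + norm h)) ^ m * P" if "N = 0 \<or> N = m" for N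
      using that le P(2) by (intro mult_right_mono mult_left_mono) (auto intro: power_mono one_le_power)
    from order_trans[OF decay this] have decay': "(2 * pi * \<bar>x $ i\<bar>) ^ N * cmod (T x h) \<le> C\<^sup>2 * (?n * (1 + norm h)) ^ m * P" if "N = 0 \<or> N = m" for N
      using that by auto
    have "cmod (T x h) + (2 * pi * \<bar>x $ i\<bar>) ^ m * cmod (T x h) \<le> 2 * (C\<^sup>2 * (?n * (1 + norm h)) ^ m * P)"
      using decay'[of 0] decay'[of m] by simp
    then have "(1 + ?n) ^ m * ((1 + (2 * pi * \<bar>x $ i\<bar>) ^ m) * cmod (T x h)) \<le> (1 + ?n) ^ m * (2 * (C\<^sup>2 * (?n * (1 + norm h)) ^ m * P))"
      by (intro mult_left_mono) (simp_all add: distrib_right)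
    then have "(1 + norm x) ^ m * cmod (T x h) \<le> (1 + ?n) ^ m * (2 * (C\<^sup>2 * (?n * (1 + norm h)) ^ m * P))"
      using mult_right_mono[OF i norm_ge_zero[of "T x h"]] unfolding mult.assoc by linarith
    then show ?thesis
      by (simp add: E_def power_mult_distrib mult_ac)
  qed
  have w0: "0 < w h" if "h \<in> H" for h using w that by (simp add: weight_def)
  have wsub: "w (g ** h) \<le> w g * w h" if "g \<in> H" "h \<in> H" for g h
    using w that by (simp add: weight_def GL_group_def)
  have [measurable]: "w \<in> borel_measurable \<mu>"
    using w by (intro continuous_borel_mu) (simp add: weight_def)
  define J where "J = (LINT x|lborel. (1 + norm (x::real^'n)) powr - (real m - s))"
  have Jint: "integrable lborel (\<lambda>x::real^'n. (1 + norm x) powr - (real m - s))"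
    by (rule integrable_decay) (use m in simp)
  have J: "(\<integral>\<^sup>+x. ennreal ((1 + norm (x::real^'n)) powr - (real m - s)) \<partial>lborel) = ennreal J" "0 \<le> J"
    unfolding J_def using Jint by (auto intro!: nn_integral_eq_integral Bochner_Integration.integral_nonneg)
  define F where "F h = \<bar>det h\<bar> powr (-1/2) * (1 + norm h) powr (s + ?n + 1) * w h" for h
  have [measurable]: "F \<in> borel_measurable \<mu>" unfolding F_def by measurable
  have F0: "0 \<le> F h" if "h \<in> H" for h using w0[OF that] by (simp add: F_def)
  have Fsub: "F (g ** h) \<le> F g * F h" if gh: "g \<in> H" "h \<in> H" for g h
  proof -
    have "norm (g ** h) \<le> norm g * norm h" by (rule norm_matrix_mult_le)
    then have "1 + norm (g ** h) \<le> (1 + norm g) * (1 + norm h)"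
      by (simp add: algebra_simps add_increasing)
    then have 1: "(1 + norm (g ** h)) powr (s + ?n + 1) \<le> (1 + norm g) powr (s + ?n + 1) * (1 + norm h) powr (s + ?n + 1)"
      using s by (subst powr_mult[symmetric]) (auto intro!: powr_mono2)
    have "F (g ** h) \<le> (\<bar>det g\<bar> powr (-1/2) * \<bar>det h\<bar> powr (-1/2)) * ((1 + norm g) powr (s + ?n + 1) * (1 + norm h) powr (s + ?n + 1)) * (w g * w h)"
      unfolding F_def det_mul abs_mult
      by (subst powr_mult) (use 1 wsub[OF gh] w0[OF mult_H[OF gh]] in \<open>auto intro!: mult_mono\<close>)
    then show ?thesis by (simp add: F_def mult_ac)
  qed
  obtain \<xi>0 where \<xi>0: "\<xi>0 \<in> \<O>"
    and c1: "(\<lambda>h. \<bar>det h\<bar> powr (1/2 - 1/1) * (1 + norm h) powr (s + ?n + 1) * w h * aux_A \<O> (transpose h *v \<xi>0) ^ l) \<in> Lp 1 \<mu>"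
    and c2: "(\<lambda>h. \<bar>det h\<bar> powr (-1/2 - 1/1) * (1 + norm h) powr (s + ?n + 1) * w h * aux_A \<O> (transpose (matrix_inv h) *v \<xi>0) ^ l) \<in> Lp 1 \<mu>"
    using temp unfolding temperately_embedded_def by blast
  have fin: "(\<integral>\<^sup>+h. ennreal (F h) * \<Phi> h \<partial>\<mu>) < \<infinity>"
    unfolding \<Phi>_def
  proof (rule convolution_bound[OF \<xi>0])
    show "ennreal (F (g ** h)) \<le> ennreal (F g) * ennreal (F h)" if "g \<in> H" "h \<in> H" for g h
      using Fsub[OF that] F0[OF that(1)] F0[OF that(2)] by (simp add: ennreal_mult[symmetric] ennreal_leI)
    have "(\<integral>\<^sup>+h. ennreal (F h) * ennreal (a (transpose h *v \<xi>0)) \<partial>\<mu>) =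
      (\<integral>\<^sup>+h. ennreal (norm (norm (\<bar>det h\<bar> powr (1/2 - 1/1) * (1 + norm h) powr (s + ?n + 1) * w h * aux_A \<O> (transpose h *v \<xi>0) ^ l) powr 1)) \<partial>\<mu>)"
      using F0 a0 w0 by (intro nn_integral_cong) (simp add: space_mu F_def a_def ennreal_mult[symmetric] abs_mult abs_of_pos aux_A_nonneg compl_closed_cone(2))
    also have "\<dots> < \<infinity>"
      using c1 by (simp add: Lp_def integrable_iff_bounded)
    finally show "(\<integral>\<^sup>+h. ennreal (F h) * ennreal (a (transpose h *v \<xi>0)) \<partial>\<mu>) < \<infinity>" .
    have "(\<integral>\<^sup>+h. ennreal (F h) * ennreal (a (transpose (matrix_inv h) *v \<xi>0)) * ennreal (1 / \<bar>det h\<bar>) \<partial>\<mu>) =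
      (\<integral>\<^sup>+h. ennreal (norm (norm (\<bar>det h\<bar> powr (-1/2 - 1/1) * (1 + norm h) powr (s + ?n + 1) * w h * aux_A \<O> (transpose (matrix_inv h) *v \<xi>0) ^ l) powr 1)) \<partial>\<mu>)"
    proof (rule nn_integral_cong)
      fix h assume "h \<in> space \<mu>"
      then have h: "h \<in> H" by (simp add: space_mu)
      have dp: "\<bar>det h\<bar> powr (-1/2 - 1/1) = \<bar>det h\<bar> powr (-1/2) * (1 / \<bar>det h\<bar>)"
        unfolding powr_diff by simp
      show "ennreal (F h) * ennreal (a (transpose (matrix_inv h) *v \<xi>0)) * ennreal (1 / \<bar>det h\<bar>) =
          ennreal (norm (norm (\<bar>det h\<bar> powr (-1/2 - 1/1) * (1 + norm h) powr (s + ?n + 1) * w h * aux_A \<O> (transpose (matrix_inv h) *v \<xi>0) ^ l) powr 1))"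
        unfolding dp using F0[OF h] a0 w0[OF h]
        by (simp add: F_def a_def ennreal_mult[symmetric] abs_mult abs_of_pos aux_A_nonneg compl_closed_cone(2) mult_ac)
    qed
    also have "\<dots> < \<infinity>"
      using c2 by (simp add: Lp_def integrable_iff_bounded)
    finally show "(\<integral>\<^sup>+h. ennreal (F h) * ennreal (a (transpose (matrix_inv h) *v \<xi>0)) * ennreal (1 / \<bar>det h\<bar>) \<partial>\<mu>) < \<infinity>" .
  qed measurable
  let ?\<nu> = "density \<mu> (\<lambda>h. ennreal (1 / \<bar>det h\<bar>))"
  have sf: "sigma_finite_measure ?\<nu>"
    by (subst mu.sigma_finite_iff_density_finite) auto
  interpret \<nu>: sigma_finite_measure ?\<nu> by fact
  interpret P: pair_sigma_finite "lborel :: (real^'n) measure" ?\<nu> ..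
  define W where "W z = complex_of_real (\<bar>det (snd z)\<bar> powr (1/2)) * T (fst z) (snd z)" for z :: "(real^'n) \<times> (real^'n^'n)"
  have W_meas [measurable]: "W \<in> borel_measurable ((lborel :: (real^'n) measure) \<Otimes>\<^sub>M ?\<nu>)"
    unfolding W_def T_def by measurable
  have W_eq: "wavelet_transform \<psi> \<psi> z = W z" if "z \<in> space (affine_haar \<mu>)" for z
  proof -
    obtain x h where z: "z = (x, h)" by (cases z)
    then have "h \<in> H" using that by (simp add: affine_haar_def space_pair_measure space_mu)
    then show ?thesis
      using wavelet_transform_fourier[OF \<psi> F invertible_H] by (simp add: z W_def T_def f_def)
  qed
  have "wavelet_transform \<psi> \<psi> \<in> borel_measurable (affine_haar \<mu>)"
    by (subst measurable_cong[OF W_eq]) (use W_meas in \<open>simp_all add: affine_haar_def\<close>)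
  moreover have "(\<integral>\<^sup>+z. ennreal (cmod (wavelet_transform \<psi> \<psi> z) * v z) \<partial>affine_haar \<mu>) < \<infinity>"
  proof -
    define B where "B x h = ennreal (cmod (W (x, h)) * ((1 + norm x) powr s * w h))" for x :: "real^'n" and h
    have [measurable]: "case_prod B \<in> borel_measurable ((lborel :: (real^'n) measure) \<Otimes>\<^sub>M ?\<nu>)"
      unfolding B_def by measurable
    have "(\<integral>\<^sup>+z. ennreal (cmod (wavelet_transform \<psi> \<psi> z) * v z) \<partial>affine_haar \<mu>) \<le> (\<integral>\<^sup>+z. case_prod B z \<partial>((lborel :: (real^'n) measure) \<Otimes>\<^sub>M ?\<nu>))"
      unfolding affine_haar_def
    proof (rule nn_integral_mono)
      fix z assume z: "z \<in> space ((lborel :: (real^'n) measure) \<Otimes>\<^sub>M ?\<nu>)"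
      obtain x h where xh: "z = (x, h)" by (cases z)
      then have "h \<in> H" using z by (simp add: space_pair_measure space_mu)
      then have "v z \<le> (1 + norm x) powr s * w h" using vw by (simp add: xh)
      then show "ennreal (cmod (wavelet_transform \<psi> \<psi> z) * v z) \<le> case_prod B z"
        using W_eq[of z] z by (auto simp: B_def xh affine_haar_def intro!: ennreal_leI mult_left_mono)
    qed
    also have "\<dots> = (\<integral>\<^sup>+h. (\<integral>\<^sup>+x. B x h \<partial>lborel) \<partial>?\<nu>)"
      using P.nn_integral_snd[of "case_prod B"] by simp
    also have "\<dots> = (\<integral>\<^sup>+h. ennreal (1 / \<bar>det h\<bar>) * (\<integral>\<^sup>+x. B x h \<partial>lborel) \<partial>\<mu>)"
      by (rule nn_integral_density) measurable
    \<comment> \<open>the summand 1 makes the constant positive, which matters where \<open>\<Phi> h\<close> is infinite\<close>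
    also have "\<dots> \<le> (\<integral>\<^sup>+h. ennreal (E * J + 1) * (ennreal (F h) * \<Phi> h) \<partial>\<mu>)"
    proof (rule nn_integral_mono)
      fix h assume "h \<in> space \<mu>"
      then have h: "h \<in> H" by (simp add: space_mu)
      show "ennreal (1 / \<bar>det h\<bar>) * (\<integral>\<^sup>+x. B x h \<partial>lborel) \<le> ennreal (E * J + 1) * (ennreal (F h) * \<Phi> h)"
      proof (cases "\<Phi> h = \<infinity>")
        case False
        then obtain P where P: "\<Phi> h = ennreal P" "0 \<le> P"
          by (cases "\<Phi> h") auto
        define D where "D = \<bar>det h\<bar> powr (1/2) * w h * (E * (1 + norm h) ^ m * P)"
        have D: "0 \<le> D" using w0[OF h] E P(2) by (simp add: D_def)
        have "B x h \<le> ennreal D * ennreal ((1 + norm x) powr - (real m - s))" for x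
        proof -
          have pos: "0 < 1 + norm x" by (simp add: add_pos_nonneg)
          have "cmod (T x h) * (1 + norm x) powr s = ((1 + norm x) ^ m * cmod (T x h)) * (1 + norm x) powr - (real m - s)"
            using pos by (simp add: powr_diff powr_realpow)
          also have "\<dots> \<le> (E * (1 + norm h) ^ m * P) * (1 + norm x) powr - (real m - s)"
            by (intro mult_right_mono T_bound P) simp
          finally have "(\<bar>det h\<bar> powr (1/2) * w h) * (cmod (T x h) * (1 + norm x) powr s) \<le>
              (\<bar>det h\<bar> powr (1/2) * w h) * ((E * (1 + norm h) ^ m * P) * (1 + norm x) powr - (real m - s))"
            using w0[OF h] by (intro mult_left_mono) auto
          then have "cmod (W (x, h)) * ((1 + norm x) powr s * w h) \<le> D * (1 + norm x) powr - (real m - s)"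
            by (simp add: W_def D_def norm_mult mult_ac)
          then show ?thesis
            using D by (simp add: B_def ennreal_mult[symmetric] ennreal_leI)
        qed
        then have "(\<integral>\<^sup>+x. B x h \<partial>lborel) \<le> (\<integral>\<^sup>+x. ennreal D * ennreal ((1 + norm (x::real^'n)) powr - (real m - s)) \<partial>lborel)"
          by (rule nn_integral_mono)
        also have "\<dots> = ennreal (D * J)"
          using D J by (subst nn_integral_cmult) (auto simp: ennreal_mult)
        finally have "ennreal (1 / \<bar>det h\<bar>) * (\<integral>\<^sup>+x. B x h \<partial>lborel) \<le> ennreal (1 / \<bar>det h\<bar>) * ennreal (D * J)"
          by (rule mult_left_mono) simp
        also have "\<dots> = ennreal (1 / \<bar>det h\<bar> * (D * J))"
          using D J(2) by (intro ennreal_mult[symmetric]) auto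
        also have "\<dots> \<le> ennreal (E * J * (F h * P))"
        proof (rule ennreal_leI)
          have "\<bar>det h\<bar> powr (1/2) = \<bar>det h\<bar> powr (-1/2) * \<bar>det h\<bar>"
          proof -
            have "\<bar>det h\<bar> powr (-1/2) * \<bar>det h\<bar> powr 1 = \<bar>det h\<bar> powr (1/2)"
              unfolding powr_add[symmetric] by simp
            then show ?thesis by simp
          qed
          then have "1 / \<bar>det h\<bar> * (D * J) = (E * J) * (\<bar>det h\<bar> powr (-1/2) * (1 + norm h) ^ m * w h * P)"
            using det_nz[OF h] by (simp add: D_def mult_ac)
          also have "\<dots> \<le> (E * J) * (F h * P)"
          proof (intro mult_left_mono mult_right_mono)
            have "(1 + norm h) ^ m = (1 + norm h) powr real m"
              by (simp add: powr_realpow add_pos_nonneg)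
            also have "\<dots> \<le> (1 + norm h) powr (s + ?n + 1)"
              using m(2) by (intro powr_mono) auto
            finally show "\<bar>det h\<bar> powr (-1/2) * (1 + norm h) ^ m * w h \<le> F h"
              unfolding F_def using w0[OF h] by (intro mult_right_mono mult_left_mono) auto
          qed (use E J(2) P(2) in auto)
          finally show "1 / \<bar>det h\<bar> * (D * J) \<le> E * J * (F h * P)" .
        qed
        also have "\<dots> = ennreal (E * J) * (ennreal (F h) * \<Phi> h)"
          using E J(2) F0[OF h] P by (simp add: ennreal_mult)
        also have "\<dots> \<le> ennreal (E * J + 1) * (ennreal (F h) * \<Phi> h)"
          by (intro mult_right_mono ennreal_leI) auto
        finally show ?thesis .
      next
        case True
        have "1 + norm h \<noteq> 0" using norm_ge_zero[of h] by linarith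
        then have "0 < F h"
          unfolding F_def using w0[OF h] det_nz[OF h]
          by (intro mult_pos_pos) (auto simp only: powr_gt_zero abs_eq_0)
        moreover have "0 < E * J + 1"
          using E J(2) by (simp add: add_nonneg_pos)
        ultimately show ?thesis
          using True by (simp add: ennreal_mult_eq_top_iff ennreal_mult_top)
      qed
    qed
    also have "\<dots> = ennreal (E * J + 1) * (\<integral>\<^sup>+h. ennreal (F h) * \<Phi> h \<partial>\<mu>)"
      unfolding \<Phi>_def by (rule nn_integral_cmult) measurable
    also have "\<dots> < \<infinity>"
      using fin by (simp add: ennreal_mult_less_top)
    finally show ?thesis .
  qed
  ultimately show ?thesis
    using L2_of_integrable_fourier[OF \<psi> F] by (simp add: H1_def weighted_L1_def)
qed

end

section \<open>Test functions with prescribed zeros of the Fourier transform\<close>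

text \<open>A space of test functions that is closed under multiplication by polynomials and under
  differentiation; hence so is the space of their Fourier transforms.\<close>

inductive_set bump_span :: "(real^'n \<Rightarrow> complex) set" where
  base: "real_polynomial_function q \<Longrightarrow> (\<lambda>x. c * complex_of_real (q x * box_bump 0 1 \<kappa> x)) \<in> bump_span"
| add: "f \<in> bump_span \<Longrightarrow> g \<in> bump_span \<Longrightarrow> (\<lambda>x. f x + g x) \<in> bump_span"

lemma real_polynomial_function_has_derivative:
  fixes p :: "real^'n \<Rightarrow> real"
  assumes "real_polynomial_function p"
  shows "\<exists>d. (\<forall>i. real_polynomial_function (d i)) \<and> (\<forall>x. (p has_derivative (\<lambda>w. \<Sum>i\<in>UNIV. w $ i * d i x)) (at x))"
  using assms
proof (induction rule: real_polynomial_function.induct)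
  case (linear f)
  have lin: "f w = (\<Sum>i\<in>UNIV. w $ i * f (axis i 1))" for w
  proof -
    have "f w = f (\<Sum>i\<in>UNIV. w $ i *\<^sub>R axis i 1)"
      by (simp add: basis_expansion scalar_mult_eq_scaleR[symmetric])
    then show ?thesis
      by (simp add: linear_sum[OF bounded_linear.linear[OF linear]] linear_cmul[OF bounded_linear.linear[OF linear]])
  qed
  have "(\<lambda>w. \<Sum>i\<in>UNIV. w $ i * f (axis i 1)) = f"
    by (rule ext) (rule lin[symmetric])
  then show ?case
    using bounded_linear_imp_has_derivative[OF linear]
    by (intro exI[of _ "\<lambda>i x. f (axis i 1)"]) (auto intro: real_polynomial_function.intros)
next
  case (const c)
  show ?case
    by (intro exI[of _ "\<lambda>i x. 0"]) (auto intro: real_polynomial_function.intros)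
next
  case (add f g)
  then obtain d e where d: "\<And>i. real_polynomial_function (d i)" "\<And>x. (f has_derivative (\<lambda>w. \<Sum>i\<in>UNIV. w $ i * d i x)) (at x)"
    and e: "\<And>i. real_polynomial_function (e i)" "\<And>x. (g has_derivative (\<lambda>w. \<Sum>i\<in>UNIV. w $ i * e i x)) (at x)"
    by blast
  show ?case
  proof (intro exI[of _ "\<lambda>i x. d i x + e i x"] conjI allI)
    show "((\<lambda>x. f x + g x) has_derivative (\<lambda>w. \<Sum>i\<in>UNIV. w $ i * (d i x + e i x))) (at x)" for x
      by (rule has_derivative_eq_rhs[OF has_derivative_add[OF d(2) e(2)]]) (simp add: fun_eq_iff distrib_left sum.distrib)
  qed (intro real_polynomial_function.intros d e)
next
  case (mult f g)
  then obtain d e where d: "\<And>i. real_polynomial_function (d i)" "\<And>x. (f has_derivative (\<lambda>w. \<Sum>i\<in>UNIV. w $ i * d i x)) (at x)"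
    and e: "\<And>i. real_polynomial_function (e i)" "\<And>x. (g has_derivative (\<lambda>w. \<Sum>i\<in>UNIV. w $ i * e i x)) (at x)"
    by blast
  show ?case
  proof (intro exI[of _ "\<lambda>i x. f x * e i x + d i x * g x"] conjI allI)
    show "((\<lambda>x. f x * g x) has_derivative (\<lambda>w. \<Sum>i\<in>UNIV. w $ i * (f x * e i x + d i x * g x))) (at x)" for x
      by (rule has_derivative_eq_rhs[OF has_derivative_mult[OF d(2) e(2)]])
        (simp add: fun_eq_iff distrib_left sum.distrib sum_distrib_left sum_distrib_right mult_ac)
  qed (intro real_polynomial_function.intros d e mult.hyps)
qed

lemma bump_span_zero: "(\<lambda>x. 0) \<in> bump_span"
  using bump_span.base[of "\<lambda>x. 0" 0] by (simp add: real_polynomial_function.intros)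

lemma bump_span_sum:
  assumes "finite I" "\<And>i. i \<in> I \<Longrightarrow> f i \<in> bump_span"
  shows "(\<lambda>x. \<Sum>i\<in>I. f i x) \<in> bump_span"
  using assms by (induction I rule: finite_induct) (auto intro: bump_span_zero bump_span.add)

lemma bump_span_polynomial_mult:
  assumes "f \<in> bump_span" "real_polynomial_function r"
  shows "(\<lambda>x. b * complex_of_real (r x) * f x) \<in> bump_span"
  using assms
proof (induction rule: bump_span.induct)
  case (base q c \<kappa>)
  have "(\<lambda>x. b * complex_of_real (r x) * (c * complex_of_real (q x * box_bump 0 1 \<kappa> x))) =
      (\<lambda>x. (b * c) * complex_of_real ((r x * q x) * box_bump 0 1 \<kappa> x))"
    by (simp add: fun_eq_iff mult_ac)
  then show ?case
    using bump_span.base[OF real_polynomial_function.intros(4)[OF base.prems base.hyps], of "b * c" \<kappa>] by simp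
next
  case (add f g)
  then show ?case
    using bump_span.add[of "\<lambda>x. b * complex_of_real (r x) * f x" "\<lambda>x. b * complex_of_real (r x) * g x"]
    by (simp add: distrib_left)
qed

lemma bump_span_scale: "f \<in> bump_span \<Longrightarrow> (\<lambda>x. b * f x) \<in> bump_span"
  using bump_span_polynomial_mult[of f "\<lambda>x. 1" b] by (simp add: real_polynomial_function.intros)

lemma bump_span_coordinate: "f \<in> bump_span \<Longrightarrow> (\<lambda>x. b * complex_of_real (x $ i) * f x) \<in> bump_span"
  by (rule bump_span_polynomial_mult) (auto intro: real_polynomial_function.intros bounded_linear_vec_nth)

lemma bump_span_has_derivative:
  assumes "f \<in> bump_span"
  shows "\<exists>d. (\<forall>i. d i \<in> bump_span) \<and> (\<forall>x. (f has_derivative (\<lambda>w. \<Sum>i\<in>UNIV. w $ i *\<^sub>R d i x)) (at x))"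
  using assms
proof (induction rule: bump_span.induct)
  case (base q c \<kappa>)
  obtain d where d: "\<And>i. real_polynomial_function (d i)" "\<And>x. (q has_derivative (\<lambda>w. \<Sum>i\<in>UNIV. w $ i * d i x)) (at x)"
    using real_polynomial_function_has_derivative[OF base] by blast
  let ?d = "\<lambda>i x. c * complex_of_real (q x * box_bump 0 1 (\<kappa>(i := Suc (\<kappa> i))) x) + c * complex_of_real (d i x * box_bump 0 1 \<kappa> x)"
  show ?case
  proof (intro exI[of _ ?d] conjI allI)
    fix x
    have "((\<lambda>x. q x * box_bump 0 1 \<kappa> x) has_derivative
        (\<lambda>w. q x * (\<Sum>i\<in>UNIV. w $ i * box_bump 0 1 (\<kappa>(i := Suc (\<kappa> i))) x) + (\<Sum>i\<in>UNIV. w $ i * d i x) * box_bump 0 1 \<kappa> x)) (at x)"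
      by (rule has_derivative_mult[OF d(2) box_bump_has_derivative])
    from bounded_linear.has_derivative[OF bounded_linear_compose[OF bounded_linear_mult_right[of c] bounded_linear_of_real] this]
    show "((\<lambda>x. c * complex_of_real (q x * box_bump 0 1 \<kappa> x)) has_derivative (\<lambda>w. \<Sum>i\<in>UNIV. w $ i *\<^sub>R ?d i x)) (at x)"
      by (rule has_derivative_eq_rhs)
        (simp add: fun_eq_iff scaleR_conv_of_real sum_distrib_left sum_distrib_right sum.distrib distrib_left mult_ac)
  qed (intro bump_span.intros base d)
next
  case (add f g)
  then obtain d e where d: "\<And>i. d i \<in> bump_span" "\<And>x. (f has_derivative (\<lambda>w. \<Sum>i\<in>UNIV. w $ i *\<^sub>R d i x)) (at x)"
    and e: "\<And>i. e i \<in> bump_span" "\<And>x. (g has_derivative (\<lambda>w. \<Sum>i\<in>UNIV. w $ i *\<^sub>R e i x)) (at x)"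
    by blast
  show ?case
  proof (intro exI[of _ "\<lambda>i x. d i x + e i x"] conjI allI)
    show "((\<lambda>x. f x + g x) has_derivative (\<lambda>w. \<Sum>i\<in>UNIV. w $ i *\<^sub>R (d i x + e i x))) (at x)" for x
      by (rule has_derivative_eq_rhs[OF has_derivative_add[OF d(2) e(2)]]) (simp add: fun_eq_iff scaleR_add_right sum.distrib)
  qed (intro bump_span.intros d e)
qed

lemma partial_deriv_of_gradient:
  assumes "\<And>x. (f has_derivative (\<lambda>w. \<Sum>i\<in>UNIV. w $ i *\<^sub>R d i x)) (at x)"
  shows "partial_deriv i f = d i"
  by (rule ext) (simp only: partial_deriv_eq(2)[OF assms] sum_vec_axis)

lemma bump_span_partial:
  assumes "f \<in> bump_span"
  shows "partial_deriv i f \<in> bump_span"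
    and "(f has_derivative (\<lambda>w. \<Sum>i\<in>UNIV. w $ i *\<^sub>R partial_deriv i f x)) (at x)"
proof -
  obtain d where d: "\<And>i. d i \<in> bump_span" "\<And>x. (f has_derivative (\<lambda>w. \<Sum>i\<in>UNIV. w $ i *\<^sub>R d i x)) (at x)"
    using bump_span_has_derivative[OF assms] by blast
  have p: "partial_deriv i f = d i" for i
    by (rule partial_deriv_of_gradient[OF d(2)])
  show "partial_deriv i f \<in> bump_span" by (simp add: p d)
  show "(f has_derivative (\<lambda>w. \<Sum>i\<in>UNIV. w $ i *\<^sub>R partial_deriv i f x)) (at x)"
    unfolding p by (rule d(2))
qed

lemma bump_span_continuous: "f \<in> bump_span \<Longrightarrow> continuous_on UNIV f"
  by (intro continuous_at_imp_continuous_on ballI has_derivative_continuous[OF bump_span_partial(2)])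

lemma bump_span_support:
  fixes f :: "real^'n \<Rightarrow> complex"
  shows "f \<in> bump_span \<Longrightarrow> real CARD('n) < norm x \<Longrightarrow> f x = 0"
proof (induction rule: bump_span.induct)
  case (base q c \<kappa>)
  then have "box_bump 0 1 \<kappa> x = 0"
    using box_bump_support[of 1 0 \<kappa> x] by fastforce
  then show ?case by simp
qed simp

lemma bump_span_test_function:
  fixes f :: "real^'n \<Rightarrow> complex"
  assumes "f \<in> bump_span"
  shows "f \<in> test_functions"
proof -
  have partials: "partials js f \<in> bump_span" for js
    using assms by (induction js) (auto simp: partials_Cons bump_span_partial)
  have "smooth f"
    unfolding smooth_def
    using bump_span_continuous[OF partials] differentiableI_vector[OF partial_deriv_eq(1)[OF bump_span_partial(2)[OF partials]]]
    by blast
  moreover have "closure {x. f x \<noteq> 0} \<subseteq> cball 0 (real CARD('n))"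
    using bump_span_support[OF assms] by (intro closure_minimal) (auto simp: not_less[symmetric])
  then have "compact (closure {x. f x \<noteq> 0})"
    by (meson bounded_cball bounded_subset closed_closure compact_eq_bounded_closed)
  ultimately show ?thesis
    by (simp add: test_functions_def)
qed

lemma bump_span_decay:
  fixes f :: "real^'n \<Rightarrow> complex"
  assumes "f \<in> bump_span"
  obtains K where "\<And>x. cmod (f x) \<le> K / (1 + norm x) ^ p"
proof -
  have "compact (f ` cball 0 (real CARD('n)))"
    by (intro compact_continuous_image continuous_on_subset[OF bump_span_continuous[OF assms]]) auto
  then have "bounded (f ` cball 0 (real CARD('n)))" by (rule compact_imp_bounded)
  then obtain M where "\<forall>y\<in>f ` cball 0 (real CARD('n)). cmod y \<le> M"
    unfolding bounded_iff by blast
  then have M: "cmod (f x) \<le> M" if "norm x \<le> real CARD('n)" for x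
    using that by (simp add: ball_simps)
  have M0: "0 \<le> M" by (rule order_trans[OF norm_ge_zero M[of 0]]) simp
  have "cmod (f x) \<le> (M * (1 + real CARD('n)) ^ p) / (1 + norm x) ^ p" for x
  proof (cases "norm x \<le> real CARD('n)")
    case True
    have "cmod (f x) * (1 + norm x) ^ p \<le> M * (1 + real CARD('n)) ^ p"
      using M[OF True] True M0 by (intro mult_mono power_mono) auto
    then show ?thesis
      by (simp add: pos_le_divide_eq add_pos_nonneg)
  next
    case False
    then show ?thesis
      using bump_span_support[OF assms, of x] M0 by (simp add: not_le)
  qed
  then show ?thesis using that by blast
qed

lemma bump_span_integrable: 
  fixes f :: "real^'n \<Rightarrow> complex"
  assumes "f \<in> bump_span"
  shows "integrable lborel f" "integrable lebesgue f"
proof -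
  obtain K where "\<And>x. cmod (f x) \<le> K / (1 + norm x) ^ Suc CARD('n)"
    using bump_span_decay[OF assms] by blast
  then show "integrable lborel f"
    by (rule continuous_decay_integrable[OF bump_span_continuous[OF assms]]) simp
  then show "integrable lebesgue f"
    by (simp add: integrable_completion borel_measurable_integrable)
qed

lemma fourier_lborel:
  fixes f :: "real^'n \<Rightarrow> complex"
  assumes "f \<in> bump_span"
  shows "fourier f \<xi> = (LINT x|lborel. f x * wave (x \<bullet> \<xi>))"
proof -
  have [measurable]: "f \<in> borel_measurable borel"
    using bump_span_integrable[OF assms] by (auto dest: borel_measurable_integrable)
  show ?thesis
    unfolding fourier_wave by (rule integral_completion) simp
qed

lemma bump_span_wave_integrable:
  assumes "f \<in> bump_span"
  shows "integrable lborel (\<lambda>x. f x * wave (x \<bullet> \<xi>))"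
  using bump_span_integrable(1)[OF assms] by (rule integrable_times_bounded[where B = 1]) auto

lemma fourier_add:
  assumes "f \<in> bump_span" "g \<in> bump_span"
  shows "fourier (\<lambda>x. f x + g x) \<xi> = fourier f \<xi> + fourier g \<xi>"
  unfolding fourier_lborel[OF assms(1)] fourier_lborel[OF assms(2)] fourier_lborel[OF bump_span.add[OF assms]]
  by (simp add: distrib_right Bochner_Integration.integral_add bump_span_wave_integrable assms)

lemma fourier_scale: "fourier (\<lambda>x. b * f x) \<xi> = b * fourier f \<xi>"
  unfolding fourier_wave by (simp add: mult.assoc)

lemma fourier_sum:
  assumes "finite I" "\<And>i. i \<in> I \<Longrightarrow> f i \<in> bump_span"
  shows "fourier (\<lambda>x. \<Sum>i\<in>I. f i x) \<xi> = (\<Sum>i\<in>I. fourier (f i) \<xi>)"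
  using assms
proof (induction I rule: finite_induct)
  case empty
  show ?case by (simp add: fourier_wave)
next
  case (insert i I)
  then show ?case
    using fourier_add[of "f i" "\<lambda>x. \<Sum>i\<in>I. f i x"] bump_span_sum[of I f] by simp
qed

lemma fourier_partial_deriv:
  fixes f :: "real^'n \<Rightarrow> complex"
  assumes f: "f \<in> bump_span"
  shows "fourier (partial_deriv i f) \<xi> = 2 * complex_of_real pi * \<i> * complex_of_real (\<xi> $ i) * fourier f \<xi>"
proof -
  obtain K1 where K1: "\<And>x. cmod (f x) \<le> K1 / (1 + norm x) ^ Suc CARD('n)"
    using bump_span_decay[OF f] by blast
  obtain K2 where K2: "\<And>x. cmod (partial_deriv i f x) \<le> K2 / (1 + norm x) ^ Suc CARD('n)"
    using bump_span_decay[OF bump_span_partial(1)[OF f]] by blast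
  have b1: "cmod (f x) \<le> max K1 K2 / (1 + norm x) ^ Suc CARD('n)" for x
    by (rule order_trans[OF K1]) (intro divide_right_mono, auto)
  have b2: "cmod (partial_deriv i f x) \<le> max K1 K2 / (1 + norm x) ^ Suc CARD('n)" for x
    by (rule order_trans[OF K2]) (intro divide_right_mono, auto)
  have "(LINT x|lborel. (\<Sum>j\<in>UNIV. (axis i 1 :: real^'n) $ j *\<^sub>R partial_deriv j f x) * wave (\<xi> \<bullet> x)) =
      2 * complex_of_real pi * \<i> * complex_of_real (\<xi> $ i) * (LINT x|lborel. f x * wave (\<xi> \<bullet> x))"
    by (rule integral_deriv_wave[OF bump_span_partial(2)[OF f], where K = "max K1 K2" and p = "Suc CARD('n)"])
      (use b1 b2 bump_span_continuous[OF bump_span_partial(1)[OF f, of i]] in \<open>simp_all only: sum_vec_axis lessI\<close>)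
  then show ?thesis
    unfolding sum_vec_axis fourier_lborel[OF f] fourier_lborel[OF bump_span_partial(1)[OF f]] by (simp add: inner_commute)
qed

text \<open>Differentiation under the integral sign; the remainder is at most quadratic.\<close>

lemma fourier_has_derivative:
  fixes f :: "real^'n \<Rightarrow> complex"
  assumes f: "f \<in> bump_span"
  defines "d \<equiv> \<lambda>i x. (- 2 * complex_of_real pi * \<i>) * complex_of_real (x $ i) * f x"
  shows "(fourier f has_derivative (\<lambda>w. \<Sum>i\<in>UNIV. w $ i *\<^sub>R fourier (d i) \<xi>)) (at \<xi>)"
proof -
  define L where "L w = (\<Sum>i\<in>UNIV. w $ i *\<^sub>R fourier (d i) \<xi>)" for w :: "real^'n"
  have dB: "d i \<in> bump_span" for i unfolding d_def by (rule bump_span_coordinate[OF f])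
  let ?n = "real CARD('n)"
  define M where "M = (LINT x|lborel. cmod (f x)) * ((2 * pi * ?n)\<^sup>2 / 2)"
  have M0: "0 \<le> M"
    unfolding M_def by (intro mult_nonneg_nonneg Bochner_Integration.integral_nonneg) auto
  have key: "cmod (fourier f (\<xi> + w) - fourier f \<xi> - L w) \<le> M * (norm w)\<^sup>2" for w
  proof -
    have Lw: "L w = (LINT x|lborel. - 2 * complex_of_real pi * \<i> * complex_of_real (x \<bullet> w) * f x * wave (x \<bullet> \<xi>))"
    proof -
      have "L w = (\<Sum>i\<in>UNIV. (LINT x|lborel. w $ i *\<^sub>R (d i x * wave (x \<bullet> \<xi>))))"
        unfolding L_def fourier_lborel[OF dB] by simp
      also have "\<dots> = (LINT x|lborel. (\<Sum>i\<in>UNIV. w $ i *\<^sub>R (d i x * wave (x \<bullet> \<xi>))))"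
        by (rule Bochner_Integration.integral_sum[symmetric]) (intro integrable_scaleR_right bump_span_wave_integrable dB)
      also have "\<dots> = (LINT x|lborel. - 2 * complex_of_real pi * \<i> * complex_of_real (x \<bullet> w) * f x * wave (x \<bullet> \<xi>))"
        by (intro Bochner_Integration.integral_cong refl)
          (simp add: d_def inner_vec_def scaleR_conv_of_real sum_distrib_left sum_distrib_right mult_ac)
      finally show ?thesis .
    qed
    have Lint: "integrable lborel (\<lambda>x. - 2 * complex_of_real pi * \<i> * complex_of_real (x \<bullet> w) * f x * wave (x \<bullet> \<xi>))"
    proof -
      have "real_polynomial_function (\<lambda>x. x \<bullet> w)"
        by (rule real_polynomial_function.intros) (rule bounded_linear_inner_left)
      from bump_span_wave_integrable[OF bump_span_polynomial_mult[OF f this]]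
      show ?thesis .
    qed
    define R where "R x = f x * wave (x \<bullet> (\<xi> + w)) - f x * wave (x \<bullet> \<xi>) - (- 2 * complex_of_real pi * \<i> * complex_of_real (x \<bullet> w) * f x * wave (x \<bullet> \<xi>))" for x
    have R_int: "integrable lborel R"
      unfolding R_def by (intro Bochner_Integration.integrable_diff bump_span_wave_integrable[OF f] Lint)
    have "fourier f (\<xi> + w) - fourier f \<xi> - L w = (LINT x|lborel. R x)"
      unfolding R_def Lw fourier_lborel[OF f]
      by (simp only: Bochner_Integration.integral_diff Bochner_Integration.integrable_diff bump_span_wave_integrable[OF f] Lint)
    also have "cmod \<dots> \<le> (LINT x|lborel. cmod (f x) * ((2 * pi * ?n)\<^sup>2 / 2 * (norm w)\<^sup>2))"
    proof (rule order_trans[OF integral_norm_bound integral_mono])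
      show "integrable lborel (\<lambda>x. cmod (R x))" using R_int by (rule integrable_norm)
      show "integrable lborel (\<lambda>x. cmod (f x) * ((2 * pi * ?n)\<^sup>2 / 2 * (norm w)\<^sup>2))"
        using bump_span_integrable(1)[OF f] by simp
      fix x
      show "cmod (R x) \<le> cmod (f x) * ((2 * pi * ?n)\<^sup>2 / 2 * (norm w)\<^sup>2)"
      proof (cases "norm x \<le> ?n")
        case True
        define \<theta> where "\<theta> = - 2 * pi * (x \<bullet> w)"
        have w\<theta>: "wave (x \<bullet> w) = iexp \<theta>"
          by (simp add: wave_def \<theta>_def mult_ac)
        have "R x = f x * wave (x \<bullet> \<xi>) * (iexp \<theta> - (1 + \<i> * complex_of_real \<theta>))"
          unfolding w\<theta>[symmetric] by (simp add: R_def inner_add_right wave_add \<theta>_def algebra_simps)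
        then have "cmod (R x) = cmod (f x) * cmod (iexp \<theta> - (1 + \<i> * complex_of_real \<theta>))"
          by (simp add: norm_mult)
        also have "cmod (iexp \<theta> - (1 + \<i> * complex_of_real \<theta>)) \<le> \<theta>\<^sup>2 / 2"
          using iexp_approx1[of \<theta> 1] by (simp add: power2_eq_square abs_mult_self_eq)
        also have "\<theta>\<^sup>2 / 2 \<le> (2 * pi * ?n)\<^sup>2 / 2 * (norm w)\<^sup>2"
        proof -
          have "\<bar>x \<bullet> w\<bar> \<le> ?n * norm w"
            using Cauchy_Schwarz_ineq2[of x w] mult_right_mono[OF True, of "norm w"] by simp
          then have "\<bar>\<theta>\<bar> \<le> 2 * pi * ?n * norm w"
            by (simp add: \<theta>_def abs_mult mult.assoc)
          then have "\<bar>\<theta>\<bar>\<^sup>2 \<le> (2 * pi * ?n * norm w)\<^sup>2"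
            by (intro power_mono) auto
          then show ?thesis
            by (simp add: power_mult_distrib)
        qed
        finally show ?thesis
          by (simp add: mult_left_mono)
      next
        case False
        then show ?thesis
          using bump_span_support[OF f, of x] by (simp add: R_def)
      qed
    qed
    also have "\<dots> = M * (norm w)\<^sup>2"
      by (simp add: M_def)
    finally show ?thesis .
  qed
  show ?thesis
    unfolding has_derivative_at_alt L_def[symmetric]
  proof (intro conjI allI impI)
    show "bounded_linear L"
      unfolding L_def by (intro bounded_linear_sum bounded_linear_compose[OF bounded_linear_scaleR_left bounded_linear_vec_nth])
    fix e :: real assume e: "e > 0"
    show "\<exists>r>0. \<forall>y. norm (y - \<xi>) < r \<longrightarrow> norm (fourier f y - fourier f \<xi> - L (y - \<xi>)) \<le> e * norm (y - \<xi>)"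
    proof (intro exI[of _ "e / (M + 1)"] conjI allI impI)
      show "0 < e / (M + 1)" using e M0 by simp
      fix y assume y: "norm (y - \<xi>) < e / (M + 1)"
      have "(M + 1) * norm (y - \<xi>) < e"
        using y M0 by (simp add: pos_less_divide_eq mult.commute)
      then have Me: "M * norm (y - \<xi>) \<le> e"
        by (simp add: distrib_right) (smt (verit) norm_ge_zero)
      have "norm (fourier f y - fourier f \<xi> - L (y - \<xi>)) \<le> M * norm (y - \<xi>) * norm (y - \<xi>)"
        using key[of "y - \<xi>"] by (simp add: power2_eq_square)
      also have "\<dots> \<le> e * norm (y - \<xi>)"
        by (intro mult_right_mono Me) simp
      finally show "norm (fourier f y - fourier f \<xi> - L (y - \<xi>)) \<le> e * norm (y - \<xi>)" .
    qed
  qed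
qed

lemma fourier_decay_component:
  fixes f :: "real^'n \<Rightarrow> complex"
  assumes "f \<in> bump_span"
  shows "\<exists>K. \<forall>\<xi>. (2 * pi * \<bar>\<xi> $ i\<bar>) ^ N * cmod (fourier f \<xi>) \<le> K"
  using assms
proof (induction N arbitrary: f)
  case 0
  then show ?case
    using norm_fourier_le[OF bump_span_integrable(2)[OF 0]] by (simp, blast)
next
  case (Suc N)
  then obtain K where K: "\<And>\<xi>. (2 * pi * \<bar>\<xi> $ i\<bar>) ^ N * cmod (fourier (partial_deriv i f) \<xi>) \<le> K"
    using bump_span_partial(1) by blast
  have eq: "(2 * pi * \<bar>\<xi> $ i\<bar>) ^ Suc N * cmod (fourier f \<xi>) = (2 * pi * \<bar>\<xi> $ i\<bar>) ^ N * cmod (fourier (partial_deriv i f) \<xi>)" for \<xi>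
    by (simp add: fourier_partial_deriv[OF Suc.prems] norm_mult mult_ac)
  show ?case unfolding eq using K by blast
qed

lemma fourier_decay:
  fixes f :: "real^'n \<Rightarrow> complex"
  assumes f: "f \<in> bump_span"
  shows "\<exists>K. \<forall>\<xi>. cmod (fourier f \<xi>) \<le> K / (1 + norm \<xi>) ^ N"
proof -
  have "\<forall>i. \<exists>K. \<forall>\<xi>. (2 * pi * \<bar>\<xi> $ i\<bar>) ^ N * cmod (fourier f \<xi>) \<le> K"
    using fourier_decay_component[OF f] by blast
  from choice[OF this] obtain K where K: "\<And>i \<xi>. (2 * pi * \<bar>\<xi> $ i\<bar>) ^ N * cmod (fourier f \<xi>) \<le> K i"
    by blast
  obtain M where M: "\<And>\<xi>. cmod (fourier f \<xi>) \<le> M"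
    using norm_fourier_le[OF bump_span_integrable(2)[OF f]] by blast
  let ?n = "real CARD('n)"
  have "cmod (fourier f \<xi>) \<le> ((1 + ?n) ^ N * (M + (\<Sum>i\<in>UNIV. \<bar>K i\<bar>))) / (1 + norm \<xi>) ^ N" for \<xi>
  proof -
    obtain i where i: "(1 + norm \<xi>) ^ N \<le> (1 + ?n) ^ N * (1 + (2 * pi * \<bar>\<xi> $ i\<bar>) ^ N)"
      by (rule power_le_max_component)
    have "(1 + norm \<xi>) ^ N * cmod (fourier f \<xi>) \<le> (1 + ?n) ^ N * (1 + (2 * pi * \<bar>\<xi> $ i\<bar>) ^ N) * cmod (fourier f \<xi>)"
      by (rule mult_right_mono[OF i]) simp
    also have "\<dots> = (1 + ?n) ^ N * (cmod (fourier f \<xi>) + (2 * pi * \<bar>\<xi> $ i\<bar>) ^ N * cmod (fourier f \<xi>))"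
      by (simp add: algebra_simps)
    also have "\<dots> \<le> (1 + ?n) ^ N * (M + (\<Sum>i\<in>UNIV. \<bar>K i\<bar>))"
    proof (intro mult_left_mono add_mono M)
      have "K i \<le> (\<Sum>i\<in>UNIV. \<bar>K i\<bar>)"
        by (rule order_trans[OF abs_ge_self]) (rule member_le_sum, auto)
      then show "(2 * pi * \<bar>\<xi> $ i\<bar>) ^ N * cmod (fourier f \<xi>) \<le> (\<Sum>i\<in>UNIV. \<bar>K i\<bar>)"
        using K[of \<xi> i] by linarith
    qed simp
    finally show ?thesis
      by (simp add: pos_le_divide_eq add_pos_nonneg mult.commute)
  qed
  then show ?thesis by blast
qed

text \<open>Linear factors correspond to derivatives, products of polynomials to compositions.\<close>

lemma polynomial_times_fourier:
  fixes q :: "real^'n \<Rightarrow> real"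
  assumes "real_polynomial_function q" "f \<in> bump_span"
  shows "\<exists>g\<in>bump_span. \<forall>\<xi>. complex_of_real (q \<xi>) * fourier f \<xi> = fourier g \<xi>"
  using assms
proof (induction arbitrary: f rule: real_polynomial_function.induct)
  case (linear L)
  let ?c = "\<lambda>i. complex_of_real (L (axis i 1)) / (2 * complex_of_real pi * \<i>)"
  let ?g = "\<lambda>x. \<Sum>i\<in>UNIV. ?c i * partial_deriv i f x"
  have mem: "(\<lambda>x. ?c i * partial_deriv i f x) \<in> bump_span" for i
    by (intro bump_span_scale bump_span_partial linear)
  have "complex_of_real (L \<xi>) * fourier f \<xi> = fourier ?g \<xi>" for \<xi>
  proof -
    have "L \<xi> = L (\<Sum>i\<in>UNIV. \<xi> $ i *\<^sub>R axis i 1)"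
      by (simp add: basis_expansion scalar_mult_eq_scaleR[symmetric])
    also have "\<dots> = (\<Sum>i\<in>UNIV. \<xi> $ i * L (axis i 1))"
      using bounded_linear.linear[OF linear(1)] by (simp add: linear_sum linear_cmul)
    finally have "complex_of_real (L \<xi>) * fourier f \<xi> = (\<Sum>i\<in>UNIV. complex_of_real (\<xi> $ i * L (axis i 1)) * fourier f \<xi>)"
      by (simp add: sum_distrib_right)
    also have "\<dots> = (\<Sum>i\<in>UNIV. ?c i * fourier (partial_deriv i f) \<xi>)"
    proof (intro sum.cong refl)
      fix i
      have cancel: "u * b * y = (b / c) * (c * u * y)" if "c \<noteq> 0" for c u b y :: complex
        using that by simp
      show "complex_of_real (\<xi> $ i * L (axis i 1)) * fourier f \<xi> = ?c i * fourier (partial_deriv i f) \<xi>"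
        unfolding fourier_partial_deriv[OF linear(2)] of_real_mult by (rule cancel) simp
    qed
    also have "\<dots> = fourier ?g \<xi>"
      by (simp only: fourier_sum[OF finite mem] fourier_scale)
    finally show ?thesis .
  qed
  moreover have "?g \<in> bump_span"
    using mem by (intro bump_span_sum) auto
  ultimately show ?case by blast
next
  case (const c)
  then show ?case
    by (intro bexI[of _ "\<lambda>x. complex_of_real c * f x"] allI bump_span_scale fourier_scale[symmetric])
next
  case (add p q)
  obtain g1 where g1: "g1 \<in> bump_span" "\<And>\<xi>. complex_of_real (p \<xi>) * fourier f \<xi> = fourier g1 \<xi>"
    using add.IH(1)[OF add.prems] by blast
  obtain g2 where g2: "g2 \<in> bump_span" "\<And>\<xi>. complex_of_real (q \<xi>) * fourier f \<xi> = fourier g2 \<xi>"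
    using add.IH(2)[OF add.prems] by blast
  show ?case
    by (intro bexI[of _ "\<lambda>x. g1 x + g2 x"] allI bump_span.add g1 g2) (simp add: fourier_add g1 g2 distrib_right)
next
  case (mult p q)
  obtain g where g: "g \<in> bump_span" "\<And>\<xi>. complex_of_real (q \<xi>) * fourier f \<xi> = fourier g \<xi>"
    using mult.IH(2)[OF mult.prems] by blast
  obtain g' where g': "g' \<in> bump_span" "\<And>\<xi>. complex_of_real (p \<xi>) * fourier g \<xi> = fourier g' \<xi>"
    using mult.IH(1)[OF g(1)] by blast
  show ?case
    by (intro bexI[of _ g'] allI g') (simp add: g'(2)[symmetric] g(2)[symmetric] mult.assoc)
qed

text \<open>Each derivative lowers the order of the zeros on the zero set of \<open>P\<close> by at most one.\<close>

lemma partials_power_polynomial: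
  fixes P :: "real^'n \<Rightarrow> real"
  assumes P: "real_polynomial_function P" and b: "b \<in> bump_span" and js: "length js \<le> t"
    and u: "\<And>\<xi>. u \<xi> = complex_of_real (P \<xi>) ^ t * fourier b \<xi>"
  shows "\<exists>g\<in>bump_span. partials js u = (\<lambda>\<xi>. complex_of_real (P \<xi>) ^ (t - length js) * fourier g \<xi>)"
  using js
proof (induction js)
  case Nil
  then show ?case using b u by (auto intro!: bexI[of _ b])
next
  case (Cons i js)
  define m where "m = t - length (i # js)"
  have m: "t - length js = Suc m" using Cons.prems by (simp add: m_def)
  obtain g where g: "g \<in> bump_span" and pg: "partials js u = (\<lambda>\<xi>. complex_of_real (P \<xi>) ^ Suc m * fourier g \<xi>)"
    using Cons m by auto
  obtain dP where dP: "\<And>i. real_polynomial_function (dP i)" "\<And>x. (P has_derivative (\<lambda>w. \<Sum>i\<in>UNIV. w $ i * dP i x)) (at x)"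
    using real_polynomial_function_has_derivative[OF P] by blast
  let ?dg = "\<lambda>i x. (- 2 * complex_of_real pi * \<i>) * complex_of_real (x $ i) * g x"
  have dg: "?dg i \<in> bump_span" for i by (rule bump_span_coordinate[OF g])
  obtain g1 where g1: "g1 \<in> bump_span" "\<And>\<xi>. complex_of_real (dP i \<xi>) * fourier g \<xi> = fourier g1 \<xi>"
    using polynomial_times_fourier[OF dP(1) g] by blast
  obtain g2 where g2: "g2 \<in> bump_span" "\<And>\<xi>. complex_of_real (P \<xi>) * fourier (?dg i) \<xi> = fourier g2 \<xi>"
    using polynomial_times_fourier[OF P dg] by blast
  let ?g = "\<lambda>x. of_nat (Suc m) * g1 x + g2 x"
  have "partial_deriv i (partials js u) \<xi> = complex_of_real (P \<xi>) ^ m * fourier ?g \<xi>" for \<xi>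
  proof -
    have "((\<lambda>\<xi>. complex_of_real (P \<xi>)) has_derivative (\<lambda>w. complex_of_real (\<Sum>i\<in>UNIV. w $ i * dP i \<xi>))) (at \<xi>)"
      by (rule bounded_linear.has_derivative[OF bounded_linear_of_real dP(2)])
    from has_derivative_mult[OF has_derivative_power[OF this, of "Suc m"] fourier_has_derivative[OF g]]
    have "(partials js u has_derivative (\<lambda>w. complex_of_real (P \<xi>) ^ Suc m * (\<Sum>i\<in>UNIV. w $ i *\<^sub>R fourier (?dg i) \<xi>) +
        of_nat (Suc m) * complex_of_real (\<Sum>i\<in>UNIV. w $ i * dP i \<xi>) * complex_of_real (P \<xi>) ^ (Suc m - 1) * fourier g \<xi>)) (at \<xi>)"
      unfolding pg .
    from partial_deriv_eq(2)[OF this, of i]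
    have "partial_deriv i (partials js u) \<xi> = complex_of_real (P \<xi>) ^ Suc m * fourier (?dg i) \<xi> +
        of_nat (Suc m) * complex_of_real (\<Sum>j\<in>UNIV. (axis i 1 :: real^'n) $ j * dP j \<xi>) * complex_of_real (P \<xi>) ^ (Suc m - 1) * fourier g \<xi>"
      unfolding sum_vec_axis .
    also have "(\<Sum>j\<in>UNIV. (axis i 1 :: real^'n) $ j * dP j \<xi>) = dP i \<xi>"
      using sum_vec_axis[of i "\<lambda>j. dP j \<xi>"] by simp
    also have "complex_of_real (P \<xi>) ^ Suc m * fourier (?dg i) \<xi> +
        of_nat (Suc m) * complex_of_real (dP i \<xi>) * complex_of_real (P \<xi>) ^ (Suc m - 1) * fourier g \<xi> =
        complex_of_real (P \<xi>) ^ m * (of_nat (Suc m) * fourier g1 \<xi> + fourier g2 \<xi>)"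
      unfolding g1(2)[symmetric] g2(2)[symmetric] by (simp add: algebra_simps)
    also have "of_nat (Suc m) * fourier g1 \<xi> + fourier g2 \<xi> = fourier ?g \<xi>"
      unfolding fourier_add[OF bump_span_scale[OF g1(1)] g2(1)] fourier_scale ..
    finally show ?thesis .
  qed
  moreover have "?g \<in> bump_span"
    by (intro bump_span.add bump_span_scale g1 g2)
  ultimately show ?case
    unfolding m_def[symmetric] partials_Cons[symmetric] by (intro bexI[of _ ?g] ext) simp_all
qed

text \<open>All derivatives of the Fourier transform of a member of \<open>bump_span\<close> are again such transforms, which
  gives the decay; the zeros come from the power of \<open>P\<close>.\<close>

lemma flat_on_polynomial_times_fourier:
  fixes P :: "real^'n \<Rightarrow> real"
  assumes P: "real_polynomial_function P" and Z: "\<And>z. z \<in> Z \<Longrightarrow> P z = 0" and b: "b \<in> bump_span"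
  obtains \<psi> K where "\<psi> \<in> bump_span" "flat_on Z t K (fourier \<psi>)" "\<And>\<xi>. fourier \<psi> \<xi> = complex_of_real (P \<xi>) ^ t * fourier b \<xi>"
proof -
  obtain \<psi> where \<psi>: "\<psi> \<in> bump_span" "\<And>\<xi>. complex_of_real (P \<xi> ^ t) * fourier b \<xi> = fourier \<psi> \<xi>"
    using polynomial_times_fourier[OF real_polynomial_function_power[OF P, of t] b] by blast
  then have eq: "fourier \<psi> \<xi> = complex_of_real (P \<xi>) ^ t * fourier b \<xi>" for \<xi>
    by (simp add: \<psi>(2)[symmetric])
  have closed: "\<exists>g\<in>bump_span. partials js (fourier \<psi>) = fourier g" for js
  proof (induction js)
    case (Cons i js)
    then obtain g where g: "g \<in> bump_span" "partials js (fourier \<psi>) = fourier g" by blast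
    then have "partials (i # js) (fourier \<psi>) = fourier (\<lambda>x. (- 2 * complex_of_real pi * \<i>) * complex_of_real (x $ i) * g x)"
      using partial_deriv_of_gradient[OF fourier_has_derivative[OF g(1)], of i] by (simp only: partials_Cons)
    then show ?case
      using bump_span_coordinate[OF g(1)] by blast
  qed (use \<psi> in auto)
  have der: "(partials js (fourier \<psi>) has_derivative (\<lambda>w. \<Sum>i\<in>UNIV. w $ i *\<^sub>R partials (i # js) (fourier \<psi>) x)) (at x)" for js x
  proof -
    obtain g where g: "g \<in> bump_span" "partials js (fourier \<psi>) = fourier g" using closed by blast
    show ?thesis
      unfolding partials_Cons g(2) partial_deriv_of_gradient[OF fourier_has_derivative[OF g(1)]]
      by (rule fourier_has_derivative[OF g(1)])
  qed
  have "\<forall>js. \<exists>K. \<forall>x. cmod (partials js (fourier \<psi>) x) \<le> K / (1 + norm x) ^ t"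
  proof
    fix js
    obtain g where "g \<in> bump_span" "partials js (fourier \<psi>) = fourier g" using closed by blast
    then show "\<exists>K. \<forall>x. cmod (partials js (fourier \<psi>) x) \<le> K / (1 + norm x) ^ t"
      using fourier_decay[of g t] by simp
  qed
  from choice[OF this] obtain K where K: "\<And>js x. cmod (partials js (fourier \<psi>) x) \<le> K js / (1 + norm x) ^ t"
    by blast
  let ?J = "{js :: 'n list. set js \<subseteq> UNIV \<and> length js \<le> t}"
  have finJ: "finite ?J" by (rule finite_lists_length_le) simp
  have bound: "cmod (partials js (fourier \<psi>) x) \<le> (\<Sum>js\<in>?J. \<bar>K js\<bar>) / (1 + norm x) ^ t" if "length js \<le> t" for js x
  proof -
    have "K js \<le> (\<Sum>js\<in>?J. \<bar>K js\<bar>)"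
      by (rule order_trans[OF abs_ge_self]) (rule member_le_sum, use that finJ in auto)
    then show ?thesis
      by (intro order_trans[OF K] divide_right_mono) auto
  qed
  have "flat_on Z t (\<Sum>js\<in>?J. \<bar>K js\<bar>) (fourier \<psi>)"
    unfolding flat_on_def
  proof (intro conjI allI impI ballI)
    show "continuous_on UNIV (partials js (fourier \<psi>))" for js
      by (intro continuous_at_imp_continuous_on ballI has_derivative_continuous[OF der])
    fix js :: "'n list" and z assume js: "length js < t" and z: "z \<in> Z"
    obtain g where "partials js (fourier \<psi>) = (\<lambda>\<xi>. complex_of_real (P \<xi>) ^ (t - length js) * fourier g \<xi>)"
      using partials_power_polynomial[OF P b _ eq, of js] js by auto
    then show "partials js (fourier \<psi>) z = 0"
      using js Z[OF z] by simp
  qed (use bound der in auto)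
  then show ?thesis using that \<psi>(1) eq by blast
qed

section \<open>Membership in the weighted space\<close>

context orbit_group
begin

text \<open>The transform \<open>P\<^sup>t * fourier b\<close> does not vanish identically: \<open>fourier b\<close> is continuous and nonzero at the
  origin, where it is the mass of the bump \<open>b\<close>, and \<open>P\<close> has no zeros on the line through \<open>\<xi>0\<close> except
  at the origin.\<close>

lemma exists_test_function_wavelet:
  assumes s: "0 \<le> s" and v: "weight (affine_group H) v" and w: "weight (dilation_group H) w"
    and vw: "\<forall>x. \<forall>h\<in>H. v (x, h) \<le> (1 + norm x) powr s * w h"
    and temp: "temperately_embedded H \<mu> \<O> s 1 w l"
  shows "\<exists>\<psi>. \<psi> \<in> test_functions \<and> \<psi> \<in> H1 \<mu> v \<and> (\<exists>x. \<psi> x \<noteq> 0)"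
proof -
  obtain \<xi>0 where \<xi>0: "\<xi>0 \<in> \<O>"
    using temp unfolding temperately_embedded_def by blast
  obtain P :: "real^'n \<Rightarrow> real" where P: "real_polynomial_function P" "\<And>z. z \<notin> \<O> \<Longrightarrow> P z = 0"
    "\<And>c. c \<noteq> 0 \<Longrightarrow> P (c *\<^sub>R \<xi>0) \<noteq> 0"
    using vanishing_polynomial[OF \<xi>0] by blast
  define b :: "real^'n \<Rightarrow> complex" where "b = (\<lambda>x. complex_of_real (box_bump 0 1 (\<lambda>_. 0) x))"
  have b: "b \<in> bump_span"
    using bump_span.base[OF real_polynomial_function.intros(2), of 1 1 "\<lambda>_. 0"] by (simp add: b_def)
  obtain t :: nat where t: "real t > real l + s + real CARD('n) + 1"
    using reals_Archimedean2 by blast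
  have "z \<in> - \<O> \<Longrightarrow> P z = 0" for z using P(2) by simp
  from flat_on_polynomial_times_fourier[OF P(1) this b] obtain \<psi> K where
    \<psi>: "\<psi> \<in> bump_span" "flat_on (- \<O>) t K (fourier \<psi>)" "\<And>\<xi>. fourier \<psi> \<xi> = complex_of_real (P \<xi>) ^ t * fourier b \<xi>"
    by blast
  have "\<exists>x. \<psi> x \<noteq> 0"
  proof (rule ccontr)
    assume "\<not> (\<exists>x. \<psi> x \<noteq> 0)"
    then have "fourier \<psi> \<xi> = 0" for \<xi>
      by (simp add: fourier_wave)
    then have zero: "fourier b (c *\<^sub>R \<xi>0) = 0" if "c \<noteq> 0" for c
      using \<psi>(3)[of "c *\<^sub>R \<xi>0"] P(3)[OF that] by simp
    have "((\<lambda>c. fourier b (c *\<^sub>R \<xi>0)) \<longlongrightarrow> fourier b (0 *\<^sub>R \<xi>0)) (at 0)"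
    proof -
      have "continuous_on UNIV (\<lambda>c. fourier b (c *\<^sub>R \<xi>0))"
        by (rule continuous_on_compose2[OF continuous_fourier[OF bump_span_integrable(2)[OF b]]])
          (auto intro!: continuous_intros)
      then show ?thesis
        using continuous_on_def by blast
    qed
    moreover have "((\<lambda>c. fourier b (c *\<^sub>R \<xi>0)) \<longlongrightarrow> 0) (at 0)"
      by (rule tendsto_eventually) (auto simp: eventually_at_filter zero)
    ultimately have "fourier b 0 = 0"
      using tendsto_unique[of "at (0::real)"] by fastforce
    moreover have "fourier b 0 = complex_of_real (bump_mass TYPE('n) 1)"
      unfolding fourier_lborel[OF b] by (simp add: b_def bump_mass_def wave_def)
    ultimately show False
      using bump_mass_pos[of 1, where ?'n = 'n] by simp
  qed
  moreover have "\<psi> \<in> H1 \<mu> v"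
    by (rule flat_fourier_H1[OF s v w vw temp bump_span_integrable(2)[OF \<psi>(1)] \<psi>(2) t])
  ultimately show ?thesis
    using bump_span_test_function[OF \<psi>(1)] by blast
qed

end

theorem corollary4p4:
  fixes H :: "(real^'n^'n) set" and \<mu> :: "(real^'n^'n) measure" and \<O> :: "(real^'n) set"
    and s :: real and v :: "(real^'n) \<times> (real^'n^'n) \<Rightarrow> real" and w :: "real^'n^'n \<Rightarrow> real"
    and l :: nat
  assumes "1 < CARD('n)"
    and "left_haar_measure (dilation_group H) \<mu>"
    and "admissible_dilation_group H \<mu>"
    and "open_dual_orbit H \<O>"
    and "0 \<le> s"
    and "weight (affine_group H) v"
    and "weight (dilation_group H) w"
    and "\<forall>x. \<forall>h\<in>H. v (x, h) \<le> (1 + norm x) powr s * w h"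
    and "temperately_embedded H \<mu> \<O> s 1 w l"
  shows "(\<forall>(t::nat) \<psi>. real t > real l + s + real CARD('n) + 1 \<and>
            integrable lebesgue \<psi> \<and> vanishing_moments (- \<O>) t \<psi> \<and>
            schwartz_norm (real t) (real t) (fourier \<psi>) < \<infinity> \<longrightarrow>
            \<psi> \<in> H1 \<mu> v)
       \<and> (\<exists>\<psi>. \<psi> \<in> test_functions \<and> \<psi> \<in> H1 \<mu> v \<and> (\<exists>x. \<psi> x \<noteq> 0))"
proof -
  interpret orbit_group H \<mu> \<O>
    using assms(2-4) by unfold_locales (auto simp: admissible_dilation_group_def)
  have "\<psi> \<in> H1 \<mu> v"
    if t: "real t > real l + s + real CARD('n) + 1" and \<psi>: "integrable lebesgue \<psi>"
      and van: "vanishing_moments (- \<O>) t \<psi>" and fin: "schwartz_norm (real t) (real t) (fourier \<psi>) < \<infinity>"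
    for t :: nat and \<psi>
  proof -
    obtain K where "flat_on (- \<O>) t K (fourier \<psi>)"
      by (rule flat_on_fourier[OF \<psi> van fin])
    then show ?thesis
      by (rule flat_fourier_H1[OF assms(5-9) \<psi> _ t])
  qed
  then show ?thesis
    using exists_test_function_wavelet[OF assms(5-9)] by blast
qed

end
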